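(* Let $\delta\in(0,1)$, $\iota'=\log(3A_{\mathcal X}T/\delta)$ and $\lambda=1+\log_2(1+T)$. Adaptive-FTRL with $\eta=2\sqrt{\iota'T/(\lambda A_{\mathcal X})}$, $\gamma=\sqrt{2\iota'HT/(\lambda A_{\mathcal X})}$ and $\mu^0$ the uniform policy, run against any (possibly adaptive) sequence of opponent policies, satisfies with probability at least $1-\delta$ $$\mathrm{Reg}^T_{\max}\le 6H\sqrt{\iota'\lambda A_{\mathcal X}T}.$$
   Context: Setting. An episodic two-player zero-sum imperfect-information game with horizon $H$ and perfect recall. Max-player information sets $\mathcal X=\bigsqcup_{h=1}^H\mathcal X_h$, action sets $\mathcal A(x)$ of size $A(x)$; each $x_h\in\mathcal X_h$ has a unique history $(x_1,a_1,\dots,x_h)$; $x'\ge x$ means $x'=x$ or $x$ is in the history of $x'$; $\mathcal A(\mathcal X_h)=\{(x_h,a_h)\}$, $A_{\mathcal X}=\sum_xA(x)$. Policies $\mu$ give distributions $\mu_h(\cdot|x_h)$ on $\mathcal A(x_h)$; $\Pi_{\max}$ is the set of policies; $\mu_{1:h}(x_h,a_h)=\prod_{h'\le h}\mu_{h'}(a_{h'}|x_{h'})$ along the history. For a min-player policy $\nu$, $p^\nu_{1:h}(x_h)$ is the probability (induced by the game and $\nu$) that the max-player's information set sequence follows the history of $x_h$ given that the max-player plays the actions of that history, $r^\nu_h(x_h,a_h)\in[0,1]$ the expected reward, and $\ell^\nu_h(x_h,a_h)=p^\nu_{1:h}(x_h)(1-r^\nu_h(x_h,a_h))$; $\langle\mu_{1:},\ell\rangle=\sum_h\sum_{(x_h,a_h)}\mu_{1:h}(x_h,a_h)\ell_h(x_h,a_h)$.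 Protocol: $T$ episodes; $\mu^t,\nu^t$ are $\mathcal F_{t-1}$-measurable ($\mathcal F_t$ generated by the observations of episodes $\le t$ and by $\nu^{t+1}$); in episode $t$, for $h=1..H$, the max-player observes $x^t_h$, plays $a^t_h\sim\mu^t_h(\cdot|x^t_h)$, receives $r^t_h\in[0,1]$, with $\Pr(x^t_h=x_h,a^t_h=a_h|\mathcal F_{t-1})=p^{\nu^t}_{1:h}(x_h)\mu^t_{1:h}(x_h,a_h)$ and $\mathbb E[\mathbb 1\{x^t_h=x_h,a^t_h=a_h\}(1-r^t_h)|\mathcal F_{t-1}]=\mu^t_{1:h}(x_h,a_h)\ell^{\nu^t}_h(x_h,a_h)$. Regret $\mathrm{Reg}^T_{\max}=\max_{\mu^\dagger\in\Pi_{\max}}\sum_t\langle\mu^t_{1:}-\mu^\dagger_{1:},\ell^{\nu^t}\rangle$. Dilated divergence: for positive weights $\eta'=(\eta'_h(x_h))$ and policies $\mu^1,\mu^0$, $D_{\eta'}(\mu^1,\mu^0)=\sum_h\sum_{(x_h,a_h)}\frac{\mu^1_{1:h}(x_h,a_h)}{\eta'_h(x_h)}\log\frac{\mu^1_h(a_h|x_h)}{\mu^0_h(a_h|x_h)}$. Adaptive-FTRL with parameters $\eta,\gamma>0$ and base policy $\mu^0$: set $\tilde P^0\equiv0$, $\tilde L^0\equiv0$. For $t=1..T$: $\gamma^t_h(x_h,a_h)=\gamma/(1+\tilde P^{t-1}_{1:h}(x_h,a_h))$; $\tilde P^{t-1}_{1:h}(x_h)=\frac1{A(x_h)}\sum_{a_h}\tilde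 P^{t-1}_{1:h}(x_h,a_h)$; $\eta^t_h(x_h)=\min_{x'_{h'}\ge x_h}\eta/(1+\tilde P^{t-1}_{1:h'}(x'_{h'}))$; $\mu^t=\arg\min_{\mu\in\Pi_{\max}}\langle\mu_{1:},\tilde L^{t-1}\rangle+D_{\eta^t}(\mu,\mu^0)$; after the episode, $\tilde p^t_{1:h}(x_h,a_h)=\mathbb 1\{x^t_h=x_h,a^t_h=a_h\}/(\mu^t_{1:h}(x_h,a_h)+\gamma^t_h(x_h,a_h))$, $\tilde\ell^t_h(x_h,a_h)=\tilde p^t_{1:h}(x_h,a_h)(1-r^t_h)$, $\tilde P^t=\tilde P^{t-1}+\tilde p^t$, $\tilde L^t=\tilde L^{t-1}+\tilde\ell^t$. *)

theory Defs
  imports "HOL-Probability.Probability"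
begin

text \<open>Tree of max-player information sets: horizon H, the finite set of information
sets, the step (level) of each information set, its action set, and its parent
(x_{h-1}, a_{h-1}) in the unique history (None at step 1).\<close>

record ('x, 'a) efg =
  horizon  :: nat
  infosets :: "'x set"
  level    :: "'x \<Rightarrow> nat"
  acts     :: "'x \<Rightarrow> 'a set"
  parent   :: "'x \<Rightarrow> ('x \<times> 'a) option"

definition game_tree :: "('x, 'a) efg \<Rightarrow> bool" where
  "game_tree G \<longleftrightarrow> 1 \<le> horizon G \<and> finite (infosets G) \<and>
     (\<forall>x\<in>infosets G. level G x \<in> {1..horizon G} \<and> finite (acts G x) \<and> acts G x \<noteq> {} \<and>
        (level G x = 1 \<longrightarrow> parent G x = None) \<and>
        (1 < level G x \<longrightarrow> (\<exists>y b. parent G x = Some (y, b) \<and> y \<in> infosets G \<and>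
                                   b \<in> acts G y \<and> level G y = level G x - 1)))"

definition A_X :: "('x, 'a) efg \<Rightarrow> nat" where
  "A_X G = (\<Sum>x\<in>infosets G. card (acts G x))"

definition is_desc :: "('x, 'a) efg \<Rightarrow> 'x \<Rightarrow> 'x \<Rightarrow> bool" where
  "is_desc G x' x \<longleftrightarrow> (\<lambda>u v. \<exists>b. parent G u = Some (v, b))\<^sup>*\<^sup>* x' x"

definition policies :: "('x, 'a) efg \<Rightarrow> ('x \<Rightarrow> 'a \<Rightarrow> real) set" where
  "policies G = {\<mu>. \<forall>x\<in>infosets G. (\<forall>a\<in>acts G x. 0 \<le> \<mu> x a) \<and> (\<Sum>a\<in>acts G x. \<mu> x a) = 1}"

definition uniform_policy :: "('x, 'a) efg \<Rightarrow> 'x \<Rightarrow> 'a \<Rightarrow> real" where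
  "uniform_policy G x a = 1 / real (card (acts G x))"

text \<open>Sequence form mu_{1:h}(x_h,a_h): product of the policy along the history
(the fuel argument is the level).\<close>
fun seq_aux :: "nat \<Rightarrow> ('x, 'a) efg \<Rightarrow> ('x \<Rightarrow> 'a \<Rightarrow> real) \<Rightarrow> 'x \<Rightarrow> 'a \<Rightarrow> real" where
  "seq_aux 0 G \<mu> x a = 1"
| "seq_aux (Suc n) G \<mu> x a =
     \<mu> x a * (case parent G x of None \<Rightarrow> 1 | Some (y, b) \<Rightarrow> seq_aux n G \<mu> y b)"

definition seqp :: "('x, 'a) efg \<Rightarrow> ('x \<Rightarrow> 'a \<Rightarrow> real) \<Rightarrow> 'x \<Rightarrow> 'a \<Rightarrow> real" where
  "seqp G \<mu> x a = seq_aux (level G x) G \<mu> x a"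

definition inner_seq :: "('x, 'a) efg \<Rightarrow> ('x \<Rightarrow> 'a \<Rightarrow> real) \<Rightarrow> ('x \<Rightarrow> 'a \<Rightarrow> real) \<Rightarrow> real" where
  "inner_seq G \<mu> l = (\<Sum>x\<in>infosets G. \<Sum>a\<in>acts G x. seqp G \<mu> x a * l x a)"

definition dil_div :: "('x, 'a) efg \<Rightarrow> ('x \<Rightarrow> real) \<Rightarrow> ('x \<Rightarrow> 'a \<Rightarrow> real) \<Rightarrow> ('x \<Rightarrow> 'a \<Rightarrow> real) \<Rightarrow> real" where
  "dil_div G \<eta>' \<mu>1 \<mu>0 =
     (\<Sum>x\<in>infosets G. \<Sum>a\<in>acts G x. seqp G \<mu>1 x a / \<eta>' x * ln (\<mu>1 x a / \<mu>0 x a))"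

text \<open>Opponent model: for an opponent policy nu, P nu x = p^nu_{1:h}(x_h) and
Rw nu x a = r^nu_h(x_h,a_h). The constraints are those of a game in which every
episode lasts H steps: reach probabilities are nonnegative, sum to 1 at step 1, and
split over the children of every (x_h,a_h), h<H; rewards lie in [0,1].\<close>
definition valid_opponents ::
  "('x, 'a) efg \<Rightarrow> ('nu \<Rightarrow> 'x \<Rightarrow> real) \<Rightarrow> ('nu \<Rightarrow> 'x \<Rightarrow> 'a \<Rightarrow> real) \<Rightarrow> bool" where
  "valid_opponents G P Rw \<longleftrightarrow> (\<forall>\<nu>.
     (\<forall>x\<in>infosets G. 0 \<le> P \<nu> x) \<and>
     (\<Sum>x\<in>{x\<in>infosets G. level G x = 1}. P \<nu> x) = 1 \<and>
     (\<forall>x\<in>infosets G. \<forall>a\<in>acts G x. level G x < horizon G \<longrightarrow>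
        (\<Sum>x'\<in>{x'\<in>infosets G. parent G x' = Some (x, a)}. P \<nu> x') = P \<nu> x) \<and>
     (\<forall>x\<in>infosets G. \<forall>a\<in>acts G x. 0 \<le> Rw \<nu> x a \<and> Rw \<nu> x a \<le> 1))"

definition loss :: "('nu \<Rightarrow> 'x \<Rightarrow> real) \<Rightarrow> ('nu \<Rightarrow> 'x \<Rightarrow> 'a \<Rightarrow> real) \<Rightarrow> 'nu \<Rightarrow> 'x \<Rightarrow> 'a \<Rightarrow> real" where
  "loss P Rw \<nu> x a = P \<nu> x * (1 - Rw \<nu> x a)"

text \<open>Observations: Xo t h w = x^t_h, Ao t h w = a^t_h, Ro t h w = r^t_h; mu t w = mu^t.
Ptil ... t w x a = P~^t_{1:h}(x_h,a_h), with gamma^{t}(x,a) = gamma/(1+P~^{t-1}(x,a)).\<close>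
primrec Ptil :: "('x, 'a) efg \<Rightarrow> real \<Rightarrow> (nat \<Rightarrow> 'w \<Rightarrow> 'x \<Rightarrow> 'a \<Rightarrow> real) \<Rightarrow>
   (nat \<Rightarrow> nat \<Rightarrow> 'w \<Rightarrow> 'x) \<Rightarrow> (nat \<Rightarrow> nat \<Rightarrow> 'w \<Rightarrow> 'a) \<Rightarrow> nat \<Rightarrow> 'w \<Rightarrow> 'x \<Rightarrow> 'a \<Rightarrow> real" where
  "Ptil G \<gamma> mu Xo Ao 0 w x a = 0"
| "Ptil G \<gamma> mu Xo Ao (Suc t) w x a = Ptil G \<gamma> mu Xo Ao t w x a +
     (if Xo (Suc t) (level G x) w = x \<and> Ao (Suc t) (level G x) w = a
      then 1 / (seqp G (mu (Suc t) w) x a + \<gamma> / (1 + Ptil G \<gamma> mu Xo Ao t w x a))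
      else 0)"

primrec Ltil :: "('x, 'a) efg \<Rightarrow> real \<Rightarrow> (nat \<Rightarrow> 'w \<Rightarrow> 'x \<Rightarrow> 'a \<Rightarrow> real) \<Rightarrow>
   (nat \<Rightarrow> nat \<Rightarrow> 'w \<Rightarrow> 'x) \<Rightarrow> (nat \<Rightarrow> nat \<Rightarrow> 'w \<Rightarrow> 'a) \<Rightarrow> (nat \<Rightarrow> nat \<Rightarrow> 'w \<Rightarrow> real) \<Rightarrow>
   nat \<Rightarrow> 'w \<Rightarrow> 'x \<Rightarrow> 'a \<Rightarrow> real" where
  "Ltil G \<gamma> mu Xo Ao Ro 0 w x a = 0"
| "Ltil G \<gamma> mu Xo Ao Ro (Suc t) w x a = Ltil G \<gamma> mu Xo Ao Ro t w x a +
     (if Xo (Suc t) (level G x) w = x \<and> Ao (Suc t) (level G x) w = a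
      then (1 - Ro (Suc t) (level G x) w) /
             (seqp G (mu (Suc t) w) x a + \<gamma> / (1 + Ptil G \<gamma> mu Xo Ao t w x a))
      else 0)"

text \<open>eta^t_h(x_h) = min_{x' \<ge> x_h} eta / (1 + P~^{t-1}_{1:h'}(x')), where
P~(x') is the average of P~(x',a') over a' in A(x'). Argument Pp = P~^{t-1}.\<close>
definition eta_t :: "('x, 'a) efg \<Rightarrow> real \<Rightarrow> ('x \<Rightarrow> 'a \<Rightarrow> real) \<Rightarrow> 'x \<Rightarrow> real" where
  "eta_t G \<eta> Pp x = Min ((\<lambda>x'. \<eta> / (1 + (\<Sum>a\<in>acts G x'. Pp x' a) / real (card (acts G x'))))
                          ` {x'\<in>infosets G. is_desc G x' x})"

definition ftrl_step :: "('x, 'a) efg \<Rightarrow> real \<Rightarrow> ('x \<Rightarrow> 'a \<Rightarrow> real) \<Rightarrow>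
   ('x \<Rightarrow> 'a \<Rightarrow> real) \<Rightarrow> ('x \<Rightarrow> 'a \<Rightarrow> real) \<Rightarrow> ('x \<Rightarrow> 'a \<Rightarrow> real) \<Rightarrow> bool" where
  "ftrl_step G \<eta> \<mu>0 Pp Lp \<mu> \<longleftrightarrow> \<mu> \<in> policies G \<and>
     (\<forall>\<mu>'\<in>policies G. inner_seq G \<mu> Lp + dil_div G (eta_t G \<eta> Pp) \<mu> \<mu>0
                     \<le> inner_seq G \<mu>' Lp + dil_div G (eta_t G \<eta> Pp) \<mu>' \<mu>0)"

end

theory Submission
  imports Defs
begin

text \<open>
The regret splits into four parts. (i) Realized against expected losses of the played policies: an
Azuma bound. (ii) The bias of implicit exploration: it is \<open>\<gamma> \<Sum> p~/(1 + P~)\<close> and telescopes into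
\<open>\<gamma> A_X log_2 (1 + P~)\<close>. (iii) The bias of the loss estimates at the comparator: since the weights
\<open>\<gamma>^t\<close> decrease, an exponential supermartingale started at every episode \<open>s\<close> (whence the factor \<open>T\<close> in
the union bound) and summation by parts give \<open>L~ - L \<le> \<iota>'(1 + P~)/(2\<gamma>)\<close>, and likewise \<open>P~ \<lesssim> P\<close>.
(iv) The FTRL regret on the estimated losses: the penalty is \<open>\<lesssim> \<iota>' H T / \<eta>\<close>, because \<open>P\<close> decreases
along the tree, so that the minimum over descendants in \<open>\<eta>^t\<close> costs nothing. The estimated loss of an episode
lives on one path, along which \<open>\<eta>^t\<close> is nondecreasing; comparing the log-partition functions of
consecutive steps bounds the stability term of the episode by \<open>H \<Sum>_h \<eta>^t(x_h) l~_h\<close>, and these terms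
again telescope into a logarithm. If \<open>T \<le> 36 \<iota>' \<lambda> A_X\<close>, the trivial bound \<open>H T\<close> suffices.
\<close>

section \<open>Dilated divergence on the tree of information sets\<close>

text \<open>Costs are counted in the unit \<open>H * S\<close> with \<open>S = lam * A * q\<close>,
  where q = sqrt(\<iota>' T / (lam A)), so that \<eta> = 2q, \<gamma> = sqrt(2H) q, \<iota>' T = lam
  A q^2 and S = sqrt(\<iota>' lam A T). The pieces cost 1 in (i), 1.42 in (ii), 0.4 in (iii), and
  0.55 (penalty) plus 2 (stability) in (iv): 5.37 in total, below 6. The threshold 36 is the square
  of 6: below it H T is at most 6 H S, above it q is at least 6 \<iota>'. The latter makes \<gamma>
  large against \<iota>', so that the deviation bound for P~, which contains P~ itself, can be
  solved for P~. It also gives \<gamma> \<ge> 1, hence p~^t \<le> 1 + P~^{t-1}, the condition for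
  the logarithmic telescoping. The 3 in \<iota>' pays for three kinds of bad events, and
  \<open>lam\<close> is log_2 of 2 (1 + T), a bound on 1 + P~. The obstacle in (iv) is that
  consecutive information sets carry log-partition functions at different temperatures, which do not
  compose directly.\<close>

definition roots :: "('x, 'a) efg \<Rightarrow> 'x set" where
  "roots G = {x \<in> infosets G. level G x = 1}"

definition childs :: "('x, 'a) efg \<Rightarrow> 'x \<Rightarrow> 'a \<Rightarrow> 'x set" where
  "childs G x a = {x' \<in> infosets G. parent G x' = Some (x, a)}"

definition pseq :: "('x, 'a) efg \<Rightarrow> ('x \<Rightarrow> 'a \<Rightarrow> real) \<Rightarrow> 'x \<Rightarrow> real" where
  "pseq G \<mu> x = (case parent G x of None \<Rightarrow> 1 | Some (y, b) \<Rightarrow> seqp G \<mu> y b)"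

locale efg_tree =
  fixes G :: "('x, 'a) efg"
  assumes tree: "game_tree G"
begin

section \<open>Levels, parents and sequence-form weights\<close>

lemma horizon_ge_1: "1 \<le> horizon G"
  and finite_infosets: "finite (infosets G)"
  using tree by (auto simp: game_tree_def)

lemma finite_acts: "x \<in> infosets G \<Longrightarrow> finite (acts G x)"
  and acts_nonempty: "x \<in> infosets G \<Longrightarrow> acts G x \<noteq> {}"
  and level_ge_1: "x \<in> infosets G \<Longrightarrow> 1 \<le> level G x"
  and level_le_horizon: "x \<in> infosets G \<Longrightarrow> level G x \<le> horizon G"
  using tree by (auto simp: game_tree_def)

lemma card_acts_pos: "x \<in> infosets G \<Longrightarrow> 0 < card (acts G x)"
  by (simp add: acts_nonempty card_gt_0_iff finite_acts)

lemma infoset_cases [consumes 1, case_names root child]: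
  assumes "x \<in> infosets G"
  obtains "level G x = 1" "parent G x = None"
  | y b where "parent G x = Some (y, b)" "y \<in> infosets G" "b \<in> acts G y" "level G x = Suc (level G y)"
proof (cases "level G x = 1")
  case True
  then show ?thesis using that(1) tree assms by (auto simp: game_tree_def)
next
  case False
  have "1 \<le> level G x" using level_ge_1[OF assms] .
  with False have "1 < level G x" by simp
  then obtain y b where "parent G x = Some (y, b)" "y \<in> infosets G" "b \<in> acts G y" 
     "level G y = level G x - 1"
    using tree assms unfolding game_tree_def by blast
  then show ?thesis using that(2) \<open>1 < level G x\<close> by auto
qed

lemma parent_SomeD:
  assumes "x \<in> infosets G" "parent G x = Some (y, b)"
  shows "y \<in> infosets G" "b \<in> acts G y" "level G x = Suc (level G y)"
  using assms by (auto elim: infoset_cases)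

lemma parent_None_iff: "x \<in> infosets G \<Longrightarrow> parent G x = None \<longleftrightarrow> level G x = 1"
proof (erule infoset_cases)
  fix y b assume "y \<in> infosets G" "parent G x = Some (y, b)" "level G x = Suc (level G y)"
  then show "parent G x = None \<longleftrightarrow> level G x = 1" using level_ge_1[of y] by simp
qed simp

lemma finite_childs: "finite (childs G x a)"
  using finite_infosets by (auto simp: childs_def)

lemma childsD:
  assumes "x' \<in> childs G x a"
  shows "x' \<in> infosets G" "parent G x' = Some (x, a)" "x \<in> infosets G" "a \<in> acts G x"
    "level G x' = Suc (level G x)"
  using assms parent_SomeD by (auto simp: childs_def)

text \<open>The fuel of \<open>seq_aux\<close> left after one step is exactly the level of the
  parent, so the recursion unfolds without leaving \<open>seqp\<close>.\<close>

lemma seqp_eq: "x \<in> infosets G \<Longrightarrow> seqp G \<mu> x a = \<mu> x a * pseq G \<mu> x"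
  by (erule infoset_cases) (auto simp: seqp_def pseq_def)

lemma policy_nonneg: "\<mu> \<in> policies G \<Longrightarrow> x \<in> infosets G \<Longrightarrow> a \<in> acts G x \<Longrightarrow> 0 \<le> \<mu> x a"
  and policy_sum: "\<mu> \<in> policies G \<Longrightarrow> x \<in> infosets G \<Longrightarrow> (\<Sum>a\<in>acts G x. \<mu> x a) = 1"
  by (auto simp: policies_def)

lemma policy_le_1:
  assumes "\<mu> \<in> policies G" "x \<in> infosets G" "a \<in> acts G x"
  shows "\<mu> x a \<le> 1"
proof -
  have "\<mu> x a \<le> (\<Sum>a\<in>acts G x. \<mu> x a)"
    using assms by (intro member_le_sum) (auto simp: finite_acts policy_nonneg)
  then show ?thesis using policy_sum assms by simp
qed

lemma pseq_bounds:
  assumes "\<mu> \<in> policies G" "x \<in> infosets G"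
  shows "0 \<le> pseq G \<mu> x \<and> pseq G \<mu> x \<le> 1"
  using assms(2)
proof (induction "level G x" arbitrary: x rule: less_induct)
  case less
  from \<open>x \<in> infosets G\<close> show ?case
  proof (cases rule: infoset_cases)
    case root
    then show ?thesis by (simp add: pseq_def)
  next
    case (child y b)
    have "0 \<le> pseq G \<mu> y \<and> pseq G \<mu> y \<le> 1" using less child by auto
    moreover have "pseq G \<mu> x = \<mu> y b * pseq G \<mu> y"
      using child by (simp add: pseq_def seqp_eq)
    ultimately show ?thesis
      using policy_nonneg[OF assms(1) child(2,3)] policy_le_1[OF assms(1) child(2,3)]
      by (simp add: mult_le_one)
  qed
qed

lemma seqp_bounds:
  assumes "\<mu> \<in> policies G" "x \<in> infosets G" "a \<in> acts G x"
  shows "0 \<le> seqp G \<mu> x a" "seqp G \<mu> x a \<le> 1"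
  using pseq_bounds[OF assms(1,2)] policy_nonneg[OF assms] policy_le_1[OF assms]
  by (auto simp: seqp_eq assms mult_le_one)

lemma sum_seqp:
  assumes "\<mu> \<in> policies G" "x \<in> infosets G"
  shows "(\<Sum>a\<in>acts G x. seqp G \<mu> x a) = pseq G \<mu> x"
  using assms by (simp add: seqp_eq flip: sum_distrib_right) (simp add: policy_sum)

text \<open>Each information set that is not a root is a child of exactly one pair (x, a), and its
  \<open>pseq\<close> is the \<open>seqp\<close> of that pair; the identity groups the sum by
  parent. With \<open>V\<close> as a potential it cancels node values against child values, both in
  the divergence identity and in counting the steps of an episode.\<close>

lemma sum_pseq_telescope:
  fixes V :: "'x \<Rightarrow> real"
  shows "(\<Sum>x\<in>infosets G. pseq G \<mu> x * V x) = (\<Sum>x\<in>roots G. V x) +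
    (\<Sum>x\<in>infosets G. \<Sum>a\<in>acts G x. seqp G \<mu> x a * (\<Sum>x'\<in>childs G x a. V x'))"
proof -
  let ?N = "{x \<in> infosets G. parent G x \<noteq> None}"
  let ?S = "Sigma (infosets G) (acts G)"
  have "roots G = {x \<in> infosets G. parent G x = None}"
    by (auto simp: roots_def parent_None_iff)
  then have split: "infosets G = roots G \<union> ?N" "roots G \<inter> ?N = {}" by auto
  have fin: "finite (roots G)" "finite ?N" "finite ?S"
    using finite_infosets finite_acts by (auto simp: roots_def)
  have "(\<Sum>x\<in>infosets G. pseq G \<mu> x * V x)
      = (\<Sum>x\<in>roots G. pseq G \<mu> x * V x) + (\<Sum>x\<in>?N. pseq G \<mu> x * V x)"
    by (subst split(1)) (rule sum.union_disjoint[OF fin(1,2) split(2)])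
  also have "(\<Sum>x\<in>roots G. pseq G \<mu> x * V x) = (\<Sum>x\<in>roots G. V x)"
  proof (intro sum.cong refl)
    fix x assume "x \<in> roots G"
    then have "parent G x = None" by (simp add: roots_def parent_None_iff)
    then show "pseq G \<mu> x * V x = V x" by (simp add: pseq_def)
  qed
  also have "(\<Sum>x\<in>?N. pseq G \<mu> x * V x)
      = (\<Sum>y\<in>?S. \<Sum>x\<in>{x \<in> ?N. the (parent G x) = y}. pseq G \<mu> x * V x)"
    by (rule sum.group[symmetric, OF fin(2,3)]) (auto dest: parent_SomeD)
  also have "\<dots> = (\<Sum>y\<in>?S. seqp G \<mu> (fst y) (snd y) * (\<Sum>x'\<in>childs G (fst y) (snd y). V x'))"
  proof (intro sum.cong refl)
    fix y assume "y \<in> ?S"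
    have "{x \<in> ?N. the (parent G x) = y} = childs G (fst y) (snd y)"
      by (auto simp: childs_def)
    then show "(\<Sum>x\<in>{x \<in> ?N. the (parent G x) = y}. pseq G \<mu> x * V x)
        = seqp G \<mu> (fst y) (snd y) * (\<Sum>x'\<in>childs G (fst y) (snd y). V x')"
      by (auto simp: sum_distrib_left childs_def pseq_def case_prod_beta intro!: sum.cong)
  qed
  also have "\<dots> = (\<Sum>x\<in>infosets G. \<Sum>a\<in>acts G x. seqp G \<mu> x a * (\<Sum>x'\<in>childs G x a. V x'))"
    using finite_infosets finite_acts by (subst sum.Sigma) (auto simp: case_prod_beta)
  finally show ?thesis .
qed

text \<open>This is a policy iff \<open>V\<close> solves the backward recursion
\<open>V x = - 1/\<eta>(x) ln \<Sum>\<^sub>a b x a exp (- \<eta>(x) (L x a + \<Sum> V over the children of (x, a)))\<close>.\<close>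

definition soft :: "('x \<Rightarrow> real) \<Rightarrow> ('x \<Rightarrow> 'a \<Rightarrow> real) \<Rightarrow> ('x \<Rightarrow> 'a \<Rightarrow> real) \<Rightarrow> ('x \<Rightarrow> real)
    \<Rightarrow> 'x \<Rightarrow> 'a \<Rightarrow> real" where
  "soft \<eta> b L V x a = b x a * exp (- \<eta> x * (L x a + (\<Sum>x'\<in>childs G x a. V x') - V x))"

lemma soft_exists:
  assumes b: "\<And>x a. x \<in> infosets G \<Longrightarrow> a \<in> acts G x \<Longrightarrow> 0 < b x a"
    and \<eta>: "\<And>x. x \<in> infosets G \<Longrightarrow> 0 < \<eta> x"
  obtains V where "soft \<eta> b L V \<in> policies G"
proof -
  define step where "step v x = - ln (\<Sum>a\<in>acts G x. b x a * exp (- \<eta> x * (L x a + (\<Sum>x'\<in>childs G x a. v x')))) / \<eta> x"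
    for v :: "'x \<Rightarrow> real" and x
  \<comment> \<open>One iteration at the last level and one more for each level above: the children
    of \<open>x\<close> sit exactly one iteration behind it, and the initial value 0 is overwritten
    on every information set.\<close>
  define V where "V x = (step ^^ (Suc (horizon G) - level G x)) (\<lambda>_. 0) x" for x
  have V: "V x = step V x" if x: "x \<in> infosets G" for x
  proof -
    have "Suc (horizon G) - level G x = Suc (horizon G - level G x)"
      using level_le_horizon[OF x] by simp
    then have "V x = step ((step ^^ (horizon G - level G x)) (\<lambda>_. 0)) x"
      by (simp add: V_def)
    also have "\<dots> = step V x"
    proof -
      have "(\<Sum>x'\<in>childs G x a. (step ^^ (horizon G - level G x)) (\<lambda>_. 0) x') = (\<Sum>x'\<in>childs G x a. V x')" for a
        by (intro sum.cong) (auto simp: V_def childsD(5))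
      then show ?thesis by (simp add: step_def)
    qed
    finally show ?thesis .
  qed
  have "soft \<eta> b L V \<in> policies G"
    unfolding policies_def mem_Collect_eq
  proof (intro ballI conjI)
    fix x a assume x: "x \<in> infosets G" and a: "a \<in> acts G x"
    show "0 \<le> soft \<eta> b L V x a" using b[OF x a] by (simp add: soft_def)
  next
    fix x assume x: "x \<in> infosets G"
    define Z where "Z = (\<Sum>a\<in>acts G x. b x a * exp (- \<eta> x * (L x a + (\<Sum>x'\<in>childs G x a. V x'))))"
    have "0 < Z" unfolding Z_def
      using x b by (intro sum_pos) (auto simp: finite_acts acts_nonempty)
    moreover have "\<eta> x * V x = - ln Z"
      using V[OF x] \<eta>[OF x] by (simp add: step_def Z_def)
    ultimately have eZ: "exp (\<eta> x * V x) = 1 / Z" by (simp add: exp_minus field_simps)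
    have "(\<Sum>a\<in>acts G x. soft \<eta> b L V x a) = (\<Sum>a\<in>acts G x. 
        b x a * exp (- \<eta> x * (L x a + (\<Sum>x'\<in>childs G x a. V x'))) * exp (\<eta> x * V x))"
      by (intro sum.cong refl) (simp add: soft_def algebra_simps flip: exp_add)
    also have "\<dots> = Z * exp (\<eta> x * V x)" by (simp add: Z_def sum_distrib_right)
    finally show "(\<Sum>a\<in>acts G x. soft \<eta> b L V x a) = 1" using eZ \<open>0 < Z\<close> by simp
  qed
  then show ?thesis using that by blast
qed

lemma soft_pos: "0 < b x a \<Longrightarrow> 0 < soft \<eta> b L V x a"
  by (simp add: soft_def)

text \<open>The logarithm of \<open>soft\<close> is linear in \<open>L\<close> and \<open>V\<close>,
  so each summand of the objective is a divergence term plus \<open>V x\<close> minus the child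
  values, and these telescope to the roots. The objective is thus a constant plus the divergence to
  \<open>soft\<close>.\<close>

lemma dil_div_soft:
  assumes \<mu>: "\<mu> \<in> policies G"
    and b: "\<And>x a. x \<in> infosets G \<Longrightarrow> a \<in> acts G x \<Longrightarrow> 0 < b x a"
    and \<eta>: "\<And>x. x \<in> infosets G \<Longrightarrow> 0 < \<eta> x"
  shows "inner_seq G \<mu> L + dil_div G \<eta> \<mu> b = (\<Sum>x\<in>roots G. V x) + dil_div G \<eta> \<mu> (soft \<eta> b L V)"
proof -
  have "seqp G \<mu> x a * L x a + seqp G \<mu> x a / \<eta> x * ln (\<mu> x a / b x a)
      = seqp G \<mu> x a * V x - seqp G \<mu> x a * (\<Sum>x'\<in>childs G x a. V x')
        + seqp G \<mu> x a / \<eta> x * ln (\<mu> x a / soft \<eta> b L V x a)"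
    if x: "x \<in> infosets G" and a: "a \<in> acts G x" for x a
  proof (cases "\<mu> x a = 0")
    case True
    then show ?thesis by (simp add: seqp_eq[OF x])
  next
    case False
    then have m: "0 < \<mu> x a" using policy_nonneg[OF \<mu> x a] by simp
    have "ln (\<mu> x a / soft \<eta> b L V x a)
        = ln (\<mu> x a / b x a) + \<eta> x * (L x a + (\<Sum>x'\<in>childs G x a. V x') - V x)"
      using m b[OF x a] soft_pos[of b x a \<eta> L V]
      by (simp add: ln_div soft_def ln_mult)
    then show ?thesis using \<eta>[OF x] by (simp only:) (simp add: field_simps)
  qed
  then have "inner_seq G \<mu> L + dil_div G \<eta> \<mu> b = (\<Sum>x\<in>infosets G. \<Sum>a\<in>acts G x. 
      seqp G \<mu> x a * V x - seqp G \<mu> x a * (\<Sum>x'\<in>childs G x a. V x')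
        + seqp G \<mu> x a / \<eta> x * ln (\<mu> x a / soft \<eta> b L V x a))"
    unfolding inner_seq_def dil_div_def by (simp flip: sum.distrib)
  also have "\<dots> = (\<Sum>x\<in>infosets G. \<Sum>a\<in>acts G x. seqp G \<mu> x a * V x)
     - (\<Sum>x\<in>infosets G. \<Sum>a\<in>acts G x. seqp G \<mu> x a * (\<Sum>x'\<in>childs G x a. V x'))
     + dil_div G \<eta> \<mu> (soft \<eta> b L V)"
    unfolding dil_div_def by (simp add: sum.distrib sum_subtractf)
  also have "(\<Sum>x\<in>infosets G. \<Sum>a\<in>acts G x. seqp G \<mu> x a * V x) = (\<Sum>x\<in>infosets G. pseq G \<mu> x * V x)"
    by (intro sum.cong refl) (simp add: sum_seqp[OF \<mu>] flip: sum_distrib_right)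
  finally show ?thesis by (simp add: sum_pseq_telescope)
qed

section \<open>Local Kullback-Leibler divergences and the FTRL minimizer\<close>

definition kl :: "('x \<Rightarrow> 'a \<Rightarrow> real) \<Rightarrow> ('x \<Rightarrow> 'a \<Rightarrow> real) \<Rightarrow> 'x \<Rightarrow> real" where
  "kl \<mu> b x = (\<Sum>a\<in>acts G x. \<mu> x a * ln (\<mu> x a / b x a))"

lemma dil_div_kl: "dil_div G \<eta> \<mu> b = (\<Sum>x\<in>infosets G. pseq G \<mu> x / \<eta> x * kl \<mu> b x)"
  unfolding dil_div_def kl_def sum_distrib_left
  by (intro sum.cong refl) (simp add: seqp_eq)

text \<open>Both parts are \<open>ln z \<le> z - 1\<close> and its equality case at z = q / p. For p
  = 0 the product with the logarithm is 0.\<close>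

lemma mult_ln_ge_diff:
  fixes p q :: real
  assumes "0 \<le> p" "0 < q"
  shows "p - q \<le> p * ln (p / q)" and "p * ln (p / q) = p - q \<Longrightarrow> p = q"
proof -
  have *: "ln (q / p) \<le> q / p - 1" if "0 < p" using that assms by (intro ln_le_minus_one) simp
  show "p - q \<le> p * ln (p / q)"
  proof (cases "p = 0")
    case False
    then have "0 < p" using assms by simp
    then show ?thesis using * assms by (simp add: ln_div field_simps)
  qed (use assms in auto)
  show "p = q" if eq: "p * ln (p / q) = p - q"
  proof (cases "p = 0")
    case False
    then have "0 < p" using assms by simp
    then have "ln (q / p) = q / p - 1" using eq assms by (simp add: ln_div field_simps)
    then have "q / p = 1" using \<open>0 < p\<close> assms by (intro ln_eq_minus_one) auto
    then show ?thesis using \<open>0 < p\<close> by simp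
  qed (use assms eq in auto)
qed

text \<open>Gibbs' inequality: the termwise lower bounds \<open>\<mu> x a - b x a\<close> sum to 1 -
  1 = 0.\<close>

lemma kl_nonneg:
  assumes "\<mu> \<in> policies G" "b \<in> policies G" "x \<in> infosets G"
    and "\<And>a. a \<in> acts G x \<Longrightarrow> 0 < b x a"
  shows "0 \<le> kl \<mu> b x"
proof -
  have "0 = (\<Sum>a\<in>acts G x. \<mu> x a - b x a)" using assms by (simp add: sum_subtractf policy_sum)
  also have "\<dots> \<le> kl \<mu> b x" unfolding kl_def
    using assms by (intro sum_mono mult_ln_ge_diff(1)) (auto simp: policy_nonneg)
  finally show ?thesis .
qed

lemma kl_eq_0D:
  assumes "\<mu> \<in> policies G" "b \<in> policies G" "x \<in> infosets G"
    and b: "\<And>a. a \<in> acts G x \<Longrightarrow> 0 < b x a"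
    and 0: "kl \<mu> b x = 0" and a: "a \<in> acts G x"
  shows "\<mu> x a = b x a"
proof -
  have "(\<Sum>a\<in>acts G x. \<mu> x a * ln (\<mu> x a / b x a) - (\<mu> x a - b x a)) = 0"
    using assms 0 by (simp add: sum_subtractf policy_sum kl_def)
  moreover have "\<And>a. a \<in> acts G x \<Longrightarrow> 0 \<le> \<mu> x a * ln (\<mu> x a / b x a) - (\<mu> x a - b x a)"
    using mult_ln_ge_diff(1) policy_nonneg[OF assms(1,3)] b by simp
  ultimately have "\<mu> x a * ln (\<mu> x a / b x a) - (\<mu> x a - b x a) = 0"
    using a finite_acts[OF assms(3)] by (metis (no_types, lifting) sum_nonneg_eq_0_iff)
  then show ?thesis using mult_ln_ge_diff(2)[of "\<mu> x a" "b x a"] policy_nonneg[OF assms(1,3)] b a by simp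
qed

lemma kl_refl: "kl b b x = 0"
proof -
  have "b x a * ln (b x a / b x a) = 0" for a by (cases "b x a = 0") auto
  then show ?thesis unfolding kl_def by (intro sum.neutral) blast
qed

lemma dil_div_antimono:
  assumes "\<mu> \<in> policies G" "b \<in> policies G"
    and "\<And>x a. x \<in> infosets G \<Longrightarrow> a \<in> acts G x \<Longrightarrow> 0 < b x a"
    and "\<And>x. x \<in> infosets G \<Longrightarrow> 0 < \<eta>' x" "\<And>x. x \<in> infosets G \<Longrightarrow> \<eta>' x \<le> \<eta> x"
  shows "dil_div G \<eta> \<mu> b \<le> dil_div G \<eta>' \<mu> b"
  unfolding dil_div_kl
proof (intro sum_mono mult_right_mono)
  fix x assume "x \<in> infosets G"
  then show "pseq G \<mu> x / \<eta> x \<le> pseq G \<mu> x / \<eta>' x"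
    using assms(4,5)[of x] pseq_bounds[OF assms(1), of x] by (intro divide_left_mono) auto
qed (use assms kl_nonneg in auto)

lemma dil_div_nonneg:
  assumes "\<mu> \<in> policies G" "b \<in> policies G"
    and "\<And>x a. x \<in> infosets G \<Longrightarrow> a \<in> acts G x \<Longrightarrow> 0 < b x a"
    and "\<And>x. x \<in> infosets G \<Longrightarrow> 0 < \<eta> x"
  shows "0 \<le> dil_div G \<eta> \<mu> b"
  unfolding dil_div_kl
  using assms pseq_bounds kl_nonneg by (intro sum_nonneg mult_nonneg_nonneg divide_nonneg_pos) auto

text \<open>The objective is a constant plus the divergence to the positive policy
  \<open>soft\<close>, so a minimizer has divergence 0 and must agree with it. Replacing
  \<open>soft\<close> by the minimizer gives an exact Pythagorean identity, rather than the
  inequality of first-order optimality.\<close>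

lemma ftrl_minimizer:
  assumes m: "m \<in> policies G"
    and min: "\<And>\<mu>. \<mu> \<in> policies G \<Longrightarrow>
      inner_seq G m L + dil_div G \<eta> m b \<le> inner_seq G \<mu> L + dil_div G \<eta> \<mu> b"
    and b: "\<And>x a. x \<in> infosets G \<Longrightarrow> a \<in> acts G x \<Longrightarrow> 0 < b x a"
    and \<eta>: "\<And>x. x \<in> infosets G \<Longrightarrow> 0 < \<eta> x"
  shows "x \<in> infosets G \<Longrightarrow> a \<in> acts G x \<Longrightarrow> 0 < m x a"
    and "\<mu> \<in> policies G \<Longrightarrow> inner_seq G \<mu> L + dil_div G \<eta> \<mu> b
      = inner_seq G m L + dil_div G \<eta> m b + dil_div G \<eta> \<mu> m"
proof -
  obtain V where s: "soft \<eta> b L V \<in> policies G" using soft_exists[of b \<eta>] b \<eta> by blast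
  let ?s = "soft \<eta> b L V"
  note id = dil_div_soft[where V = V and L = L and b = b and \<eta> = \<eta>, OF _ b \<eta>, simplified]
  have spos: "\<And>x a. x \<in> infosets G \<Longrightarrow> a \<in> acts G x \<Longrightarrow> 0 < ?s x a" using b soft_pos by blast
  have "dil_div G \<eta> ?s ?s = 0" by (simp add: dil_div_kl kl_refl)
  then have "dil_div G \<eta> m ?s \<le> 0" using min[OF s] id[OF m] id[OF s] by simp
  moreover have nn: "0 \<le> pseq G m x / \<eta> x * kl m ?s x" if "x \<in> infosets G" for x
    using m s \<eta> spos that by (intro mult_nonneg_nonneg divide_nonneg_pos kl_nonneg) (auto simp: pseq_bounds)
  ultimately have "(\<Sum>x\<in>infosets G. pseq G m x / \<eta> x * kl m ?s x) = 0"
    unfolding dil_div_kl by (intro antisym sum_nonneg) auto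
  then have z: "pseq G m x / \<eta> x * kl m ?s x = 0" if "x \<in> infosets G" for x
    using that nn finite_infosets by (metis (no_types, lifting) sum_nonneg_eq_0_iff)
  \<comment> \<open>A vanishing summand determines \<open>m\<close> only where its reach weight is
    positive. Going down from the roots, agreement with the positive \<open>soft\<close> at the
    parent keeps that weight positive at the child.\<close>
  have "0 < pseq G m x \<and> (\<forall>a\<in>acts G x. m x a = ?s x a)" if "x \<in> infosets G" for x
    using that
  proof (induction "level G x" arbitrary: x rule: less_induct)
    case less
    have p: "0 < pseq G m x" using \<open>x \<in> infosets G\<close>
    proof (cases rule: infoset_cases)
      case root
      then show ?thesis by (simp add: pseq_def)
    next
      case (child y b')
      have "0 < pseq G m y" "m y b' = ?s y b'" using less child by auto
      moreover have "pseq G m x = m y b' * pseq G m y"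
        using child by (simp add: pseq_def seqp_eq)
      ultimately show ?thesis using spos[OF child(2,3)] by simp
    qed
    have "kl m ?s x = 0" using z[OF less.prems] p \<eta>[OF less.prems] by simp
    then show ?case using p kl_eq_0D[OF m s less.prems spos[OF less.prems]] by simp
  qed
  then have eq: "\<And>x a. x \<in> infosets G \<Longrightarrow> a \<in> acts G x \<Longrightarrow> m x a = ?s x a" by simp
  show "x \<in> infosets G \<Longrightarrow> a \<in> acts G x \<Longrightarrow> 0 < m x a" using eq spos by simp
  have "dil_div G \<eta> \<mu> ?s = dil_div G \<eta> \<mu> m" for \<mu>
    unfolding dil_div_def using eq by (intro sum.cong refl) simp
  moreover have "dil_div G \<eta> m m = 0" by (simp add: dil_div_kl kl_refl)
  ultimately show "\<mu> \<in> policies G \<Longrightarrow> inner_seq G \<mu> L + dil_div G \<eta> \<mu> b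
      = inner_seq G m L + dil_div G \<eta> m b + dil_div G \<eta> \<mu> m"
    using id[OF m] id[of \<mu>] by simp
qed

text \<open>Induction over episodes: the hypothesis is used at the played policy
  \<open>m (Suc n)\<close>, and the Pythagorean identity carries it to an arbitrary
  \<open>\<mu>\<close>, leaving exactly the divergence that \<open>stab\<close> consumes. The rate
  \<open>\<eta> n\<close> belongs to episode \<open>Suc n\<close>, since it is computed from the
  first n episodes.\<close>

lemma ftrl_regret:
  fixes m L l :: "nat \<Rightarrow> 'x \<Rightarrow> 'a \<Rightarrow> real" and \<eta> :: "nat \<Rightarrow> 'x \<Rightarrow> real"
  assumes b: "b \<in> policies G" "\<And>x a. x \<in> infosets G \<Longrightarrow> a \<in> acts G x \<Longrightarrow> 0 < b x a"
    and \<eta>: "\<And>n x. n \<le> T \<Longrightarrow> x \<in> infosets G \<Longrightarrow> 0 < \<eta> n x"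
    and \<eta>_decr: "\<And>n x. n < T \<Longrightarrow> x \<in> infosets G \<Longrightarrow> \<eta> (Suc n) x \<le> \<eta> n x"
    and L0: "\<And>x a. L 0 x a = 0"
    and LSuc: "\<And>n x a. L (Suc n) x a = L n x a + l (Suc n) x a"
    and m: "\<And>n. n < T \<Longrightarrow> m (Suc n) \<in> policies G"
    and min: "\<And>n \<mu>. n < T \<Longrightarrow> \<mu> \<in> policies G \<Longrightarrow>
      inner_seq G (m (Suc n)) (L n) + dil_div G (\<eta> n) (m (Suc n)) b
        \<le> inner_seq G \<mu> (L n) + dil_div G (\<eta> n) \<mu> b"
    and stab: "\<And>n \<mu>. n < T \<Longrightarrow> \<mu> \<in> policies G \<Longrightarrow>
      inner_seq G (m (Suc n)) (l (Suc n)) - B (Suc n)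
        \<le> inner_seq G \<mu> (l (Suc n)) + dil_div G (\<eta> n) \<mu> (m (Suc n))"
    and \<mu>: "\<mu> \<in> policies G"
  shows "(\<Sum>t=1..T. inner_seq G (m t) (l t)) - inner_seq G \<mu> (L T)
    \<le> dil_div G (\<eta> T) \<mu> b + (\<Sum>t=1..T. B t)"
proof -
  have "(\<Sum>t=1..n. inner_seq G (m t) (l t) - B t) \<le> inner_seq G \<mu> (L n) + dil_div G (\<eta> n) \<mu> b"
    if "n \<le> T" "\<mu> \<in> policies G" for n \<mu>
    using that
  proof (induction n arbitrary: \<mu>)
    case 0
    then show ?case using dil_div_nonneg[OF _ b] \<eta> by (simp add: inner_seq_def L0)
  next
    case (Suc n)
    let ?m = "m (Suc n)"
    have n: "n < T" using Suc by simp
    have inner: "inner_seq G \<mu> (L (Suc n)) = inner_seq G \<mu> (L n) + inner_seq G \<mu> (l (Suc n))"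
      by (simp add: inner_seq_def LSuc distrib_left sum.distrib)
    have "(\<Sum>t=1..n. inner_seq G (m t) (l t) - B t) \<le> inner_seq G ?m (L n) + dil_div G (\<eta> n) ?m b"
      using Suc m[OF n] by simp
    moreover have "inner_seq G \<mu> (L n) + dil_div G (\<eta> n) \<mu> b
        = inner_seq G ?m (L n) + dil_div G (\<eta> n) ?m b + dil_div G (\<eta> n) \<mu> ?m"
      using ftrl_minimizer(2)[OF m[OF n] min[OF n] b(2) \<eta>] n Suc.prems by simp
    moreover have "dil_div G (\<eta> n) \<mu> b \<le> dil_div G (\<eta> (Suc n)) \<mu> b"
      using Suc.prems n b \<eta> \<eta>_decr by (intro dil_div_antimono) auto
    ultimately show ?case using stab[OF n Suc.prems(2)] inner by simp
  qed
  from this[OF order_refl \<mu>] show ?thesis by (simp add: sum_subtractf)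
qed

end

section \<open>Stability along a single path\<close>

text \<open>The product of 1 + u + u^2/2 and 1 - u + u^2/2 is 1 + u^4/4, and the first factor is at
  most \<open>exp u\<close>.\<close>

lemma exp_minus_le_quadratic:
  fixes u :: real
  assumes "0 \<le> u"
  shows "exp (- u) \<le> 1 - u + u\<^sup>2 / 2"
proof -
  have "1 \<le> (1 + u + u\<^sup>2 / 2) * (1 - u + u\<^sup>2 / 2)"
  proof -
    have "(1 + u + u\<^sup>2 / 2) * (1 - u + u\<^sup>2 / 2) = 1 + u ^ 4 / 4"
      by (simp add: field_simps power2_eq_square power4_eq_xxxx)
    then show ?thesis by simp
  qed
  also have "\<dots> \<le> exp u * (1 - u + u\<^sup>2 / 2)"
  proof (rule mult_right_mono[OF exp_lower_Taylor_quadratic[OF assms]])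
    have "1 - u + u\<^sup>2 / 2 = ((u - 1)\<^sup>2 + 1) / 2" by (simp add: power2_eq_square field_simps)
    then show "0 \<le> 1 - u + u\<^sup>2 / 2" by (simp only:) simp
  qed
  finally show ?thesis by (simp add: exp_minus field_simps)
qed

text \<open>Convexity of exp: with \<theta> = e / \<eta>, the point - e V is the \<theta>-average of
  - \<eta> V and 0. Here \<open>V\<close> may be negative; the inequality is then a chord bound for
  exp, the form used for the logarithm and for the implicit-exploration tail.\<close>

lemma one_minus_exp_scale:
  fixes e \<eta> V :: real
  assumes "0 < e" "e \<le> \<eta>"
  shows "e / \<eta> * (1 - exp (- \<eta> * V)) \<le> 1 - exp (- e * V)"
proof -
  define \<theta> where "\<theta> = e / \<eta>"
  have \<theta>: "0 \<le> \<theta>" "\<theta> \<le> 1" "\<theta> * \<eta> = e" using assms by (auto simp: \<theta>_def)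
  have tangent: "exp y * (1 + z - y) \<le> exp z" for y z :: real
  proof -
    have "exp y * (1 + (z - y)) \<le> exp y * exp (z - y)"
      by (intro mult_left_mono exp_ge_add_one_self) auto
    then show ?thesis by (simp add: algebra_simps flip: exp_add)
  qed
  have "\<theta> * (exp (- e * V) * (1 + (- \<eta> * V) - (- e * V))) + (1 - \<theta>) * (exp (- e * V) * (1 + 0 - (- e * V)))
      \<le> \<theta> * exp (- \<eta> * V) + (1 - \<theta>) * exp 0"
    using \<theta> by (intro add_mono mult_left_mono tangent) auto
  moreover have "\<theta> * (exp (- e * V) * (1 + (- \<eta> * V) - (- e * V))) + (1 - \<theta>) * (exp (- e * V) * (1 + 0 - (- e * V)))
      = exp (- e * V) * (1 + V * (e - \<theta> * \<eta>))" by (simp add: algebra_simps)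
  ultimately have "exp (- e * V) \<le> \<theta> * exp (- \<eta> * V) + (1 - \<theta>)" using \<theta>(3) by simp
  then have "\<theta> * (1 - exp (- \<eta> * V)) \<le> 1 - exp (- e * V)" by (simp add: algebra_simps)
  then show ?thesis unfolding \<theta>_def .
qed

text \<open>One backward step along the visited path: \<open>V\<close>, \<open>V'\<close> are the log-partition values at the current and
the next information set, \<open>p\<close>, \<open>m\<close> the probabilities of reaching them, and \<open>K\<close> the accumulated lower
bound. Having it for all rates \<open>e \<le> \<eta>\<close> is what lets the rate change along the path.\<close>

lemma stability_step:
  fixes e \<eta> m c K N V V' p :: real
  assumes e: "0 < e" "e \<le> \<eta>" and m: "0 \<le> m" "m * c \<le> 1" and c: "0 \<le> c"
    and K: "K \<le> N" "0 \<le> N" "\<eta> * K \<le> m * (1 - exp (- \<eta> * V'))"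
    and V: "m * (1 - exp (- \<eta> * (c + V'))) \<le> p * (1 - exp (- \<eta> * V))" and p: "0 \<le> p"
  shows "e * (m * c + K - (N + 1) * \<eta> * c) \<le> p * (1 - exp (- e * V))"
proof -
  have \<eta>: "0 < \<eta>" using e by simp
  define u where "u = \<eta> * c"
  have u: "0 \<le> u" using \<eta> c by (simp add: u_def)
  \<comment> \<open>\<open>K\<close> may be negative. For \<open>K \<ge> 0\<close> this is
    \<open>1 - u \<le> exp (- u)\<close> together with \<open>K \<le> N\<close>; for
    \<open>K < 0\<close> it is \<open>exp (- u) \<le> 1\<close>.\<close>
  have "K - u * N \<le> exp (- u) * K"
  proof (cases "0 \<le> K")
    case True
    have "K - u * N \<le> (1 - u) * K" using mult_left_mono[OF K(1) u] by (simp add: left_diff_distrib)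
    also have "\<dots> \<le> exp (- u) * K" 
      using True exp_ge_add_one_self[of "- u"] by (intro mult_right_mono) auto
    finally show ?thesis .
  next
    case False
    have "exp (- u) * K \<ge> 1 * K" using False u by (intro mult_right_mono_neg) auto
    moreover have "0 \<le> u * N" using u K by simp
    ultimately show ?thesis by simp
  qed
  then have 1: "\<eta> * (K - u * N) \<le> exp (- u) * (\<eta> * K)"
    using \<eta> by (simp add: mult.left_commute)
  also have "\<dots> \<le> exp (- u) * (m * (1 - exp (- \<eta> * V')))" using K(3) by simp
  finally have 1: "\<eta> * (K - u * N) \<le> exp (- u) * (m * (1 - exp (- \<eta> * V')))" .
  have 2: "m * (u - u\<^sup>2 / 2) \<le> m * (1 - exp (- u))"
    using exp_minus_le_quadratic[OF u] m by (intro mult_left_mono) auto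
  \<comment> \<open>\<open>m * c \<le> 1\<close> makes the second-order term linear in
    \<open>c\<close>. It holds for importance-weighted losses, which are at most 1 / m.\<close>
  have "m * (u\<^sup>2 / 2) = \<eta> * u / 2 * (m * c)" by (simp add: u_def power2_eq_square)
  also have "\<dots> \<le> \<eta> * u / 2 * 1" using \<eta> u m by (intro mult_left_mono) auto
  finally have 3: "m * (u\<^sup>2 / 2) \<le> \<eta> * u" using \<eta> u
    by (smt (verit) mult_nonneg_nonneg field_sum_of_halves)
  have "\<eta> * (m * c + K - (N + 1) * \<eta> * c) = m * u - \<eta> * u + \<eta> * (K - u * N)"
    by (simp add: u_def algebra_simps)
  also have "\<dots> \<le> m * (u - u\<^sup>2 / 2) + exp (- u) * (m * (1 - exp (- \<eta> * V')))"
    using 1 3 by (simp add: right_diff_distrib)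
  also have "\<dots> \<le> m * (1 - exp (- u)) + exp (- u) * (m * (1 - exp (- \<eta> * V')))" using 2 by simp
  also have "\<dots> = m * (1 - exp (- \<eta> * (c + V')))"
    by (simp add: u_def algebra_simps flip: exp_add)
  also note V
  finally have "e / \<eta> * (\<eta> * (m * c + K - (N + 1) * \<eta> * c)) \<le> e / \<eta> * (p * (1 - exp (- \<eta> * V)))"
    using e \<eta> by (intro mult_left_mono) auto
  also have "\<dots> = p * (e / \<eta> * (1 - exp (- \<eta> * V)))" by simp
  also have "\<dots> \<le> p * (1 - exp (- e * V))"
    using p e by (intro mult_left_mono one_minus_exp_scale) auto
  finally show ?thesis using \<eta> by simp
qed

context efg_tree
begin

text \<open>An information set can only be met at its own level, so \<open>level G\<close> inverts
  the path and each step contributes exactly one cell of the tree.\<close>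

lemma sum_path:
  fixes f :: "'x \<Rightarrow> 'a \<Rightarrow> real"
  assumes path: "\<And>h. h \<in> {1..horizon G} \<Longrightarrow> X h \<in> infosets G \<and> level G (X h) = h \<and> A h \<in> acts G (X h)"
  shows "(\<Sum>x\<in>infosets G. \<Sum>a\<in>acts G x. if X (level G x) = x \<and> A (level G x) = a then f x a else 0)
    = (\<Sum>h=1..horizon G. f (X h) (A h))"
proof -
  have lev: "level G x \<in> {1..horizon G}" if "x \<in> infosets G" for x
    using that level_ge_1 level_le_horizon by simp
  have "(\<Sum>x\<in>infosets G. \<Sum>a\<in>acts G x. if X (level G x) = x \<and> A (level G x) = a then f x a else 0)
      = (\<Sum>x\<in>infosets G. if X (level G x) = x then f x (A (level G x)) else 0)"
  proof (intro sum.cong refl)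
    fix x assume x: "x \<in> infosets G"
    show "(\<Sum>a\<in>acts G x. if X (level G x) = x \<and> A (level G x) = a then f x a else 0)
        = (if X (level G x) = x then f x (A (level G x)) else 0)"
      using path[OF lev[OF x]] finite_acts[OF x]
      by (cases "X (level G x) = x") (auto simp: sum.delta')
  qed
  also have "\<dots> = (\<Sum>x\<in>{x \<in> infosets G. X (level G x) = x}. f x (A (level G x)))"
    by (simp add: sum.inter_filter finite_infosets)
  also have "{x \<in> infosets G. X (level G x) = x} = X ` {1..horizon G}"
  proof (intro equalityI subsetI)
    fix x assume "x \<in> {x \<in> infosets G. X (level G x) = x}"
    then show "x \<in> X ` {1..horizon G}" using lev[of x] by (intro image_eqI[of _ _ "level G x"]) auto
  next
    fix x assume "x \<in> X ` {1..horizon G}"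
    then show "x \<in> {x \<in> infosets G. X (level G x) = x}" using path by auto
  qed
  also have "(\<Sum>x\<in>X ` {1..horizon G}. f x (A (level G x))) = (\<Sum>h=1..horizon G. f (X h) (A h))"
  proof (subst sum.reindex)
    show "inj_on X {1..horizon G}" using path by (intro inj_on_inverseI[where g = "level G"]) blast
  qed (use path in \<open>auto intro!: sum.cong\<close>)
  finally show ?thesis .
qed

text \<open>Induction from the leaves: if \<open>V x\<close> were negative, every exponent in
  \<open>soft\<close> would be negative and \<open>soft\<close> would lie strictly below
  \<open>b\<close> at each action of \<open>x\<close>, although both sum to 1.\<close>

lemma soft_value_nonneg:
  assumes b: "b \<in> policies G" "\<And>x a. x \<in> infosets G \<Longrightarrow> a \<in> acts G x \<Longrightarrow> 0 < b x a"
    and \<eta>: "\<And>x. x \<in> infosets G \<Longrightarrow> 0 < \<eta> x"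
    and L: "\<And>x a. x \<in> infosets G \<Longrightarrow> a \<in> acts G x \<Longrightarrow> 0 \<le> L x a"
    and s: "soft \<eta> b L V \<in> policies G" and "x \<in> infosets G"
  shows "0 \<le> V x"
  using \<open>x \<in> infosets G\<close>
proof (induction "horizon G - level G x" arbitrary: x rule: less_induct)
  case less
  note x = \<open>x \<in> infosets G\<close>
  show ?case
  proof (rule ccontr)
    assume neg: "\<not> 0 \<le> V x"
    have "soft \<eta> b L V x a < b x a" if a: "a \<in> acts G x" for a
    proof -
      have "0 \<le> (\<Sum>x'\<in>childs G x a. V x')"
      proof (intro sum_nonneg less.hyps)
        fix x' assume "x' \<in> childs G x a"
        note c = childsD[OF this]
        show "x' \<in> infosets G" by fact
        show "horizon G - level G x' < horizon G - level G x"
          using c(5) level_le_horizon[OF c(1)] by simp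
      qed
      then have "0 < \<eta> x * (L x a + (\<Sum>x'\<in>childs G x a. V x') - V x)"
        using L[OF x a] neg \<eta>[OF x] by (intro mult_pos_pos) auto
      then show ?thesis using b(2)[OF x a] by (simp add: soft_def)
    qed
    then have "(\<Sum>a\<in>acts G x. soft \<eta> b L V x a) < (\<Sum>a\<in>acts G x. b x a)"
      using finite_acts[OF x] acts_nonempty[OF x] by (intro sum_strict_mono) auto
    then show False using policy_sum[OF s x] policy_sum[OF b(1) x] by simp
  qed
qed

text \<open>By \<open>dil_div_soft\<close> the right-hand side is at least the sum of
  \<open>V\<close> over the roots, so a lower bound on \<open>V\<close> at the root of the path
  suffices. It comes from a backward induction with one use of \<open>stability_step\<close> per
  step; information sets off the path have nonnegative values and are dropped.\<close>

lemma path_stability: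
  fixes c :: "nat \<Rightarrow> real"
  assumes path: "\<And>h. h \<in> {1..horizon G} \<Longrightarrow> X h \<in> infosets G \<and> level G (X h) = h \<and> A h \<in> acts G (X h)
        \<and> (h < horizon G \<longrightarrow> parent G (X (Suc h)) = Some (X h, A h))"
    and b: "b \<in> policies G" "\<And>x a. x \<in> infosets G \<Longrightarrow> a \<in> acts G x \<Longrightarrow> 0 < b x a"
    and \<eta>: "\<And>x. x \<in> infosets G \<Longrightarrow> 0 < \<eta> x"
    and \<eta>_mono: "\<And>h. h \<in> {1..<horizon G} \<Longrightarrow> \<eta> (X h) \<le> \<eta> (X (Suc h))"
    and c: "\<And>h. h \<in> {1..horizon G} \<Longrightarrow> 0 \<le> c h"
      "\<And>h. h \<in> {1..horizon G} \<Longrightarrow> seqp G b (X h) (A h) * c h \<le> 1"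
    and l: "\<And>x a. l x a = (if X (level G x) = x \<and> A (level G x) = a then c (level G x) else 0)"
    and \<mu>: "\<mu> \<in> policies G"
  shows "inner_seq G b l - real (horizon G) * (\<Sum>h=1..horizon G. \<eta> (X h) * c h)
    \<le> inner_seq G \<mu> l + dil_div G \<eta> \<mu> b"
proof -
  let ?H = "horizon G"
  obtain V where s: "soft \<eta> b l V \<in> policies G" using soft_exists[of b \<eta>] b \<eta> by blast
  have lpos: "0 \<le> l x a" if "x \<in> infosets G" for x a
    using c(1)[of "level G x"] level_ge_1[OF that] level_le_horizon[OF that] by (simp add: l)
  have Vpos: "0 \<le> V x" if "x \<in> infosets G" for x
    using soft_value_nonneg[OF b \<eta> _ s that] lpos by blast
  define q where "q h = seqp G b (X h) (A h) * c h" for h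
  \<comment> \<open>The lower bound collected from step h on. The coefficient H - k + 1 is the
    \<open>N + 1\<close> of \<open>stability_step\<close>: N = H - k bounds what the later steps
    contribute.\<close>
  define R where "R h = (\<Sum>k=h..?H. q k - (real ?H - real k + 1) * \<eta> (X k) * c k)" for h
  have R_le: "R h \<le> real ?H - real h + 1" if "1 \<le> h" "h \<le> Suc ?H" for h
  proof -
    have "R h \<le> (\<Sum>k=h..?H. 1)"
      unfolding R_def
    proof (intro sum_mono)
      fix k assume k: "k \<in> {h..?H}"
      then have k': "k \<in> {1..?H}" using that by simp
      have "0 \<le> (real ?H - real k + 1) * \<eta> (X k) * c k"
        using k c(1)[OF k'] \<eta>[of "X k"] path[OF k'] by (intro mult_nonneg_nonneg) auto
      then show "q k - (real ?H - real k + 1) * \<eta> (X k) * c k \<le> 1" using c(2)[OF k'] by (simp add: q_def)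
    qed
    also have "\<dots> = real ?H - real h + 1" using that by (simp add: of_nat_diff)
    finally show ?thesis .
  qed
  \<comment> \<open>The case h uses the case \<open>Suc h\<close> at the rate
    \<open>\<eta> (X h)\<close>, which is admissible there because the rates do not decrease along
    the path; hence the quantification over \<open>e\<close>.\<close>
  have claim: "e * R h \<le> pseq G b (X h) * (1 - exp (- e * V (X h)))"
    if "h \<in> {1..?H}" "0 < e" "e \<le> \<eta> (X h)" for h e
    using that
  proof (induction "?H - h" arbitrary: h e rule: less_induct)
    case less
    note h = \<open>h \<in> {1..?H}\<close>
    let ?x = "X h" and ?a = "A h"
    have x: "?x \<in> infosets G" "level G ?x = h" "?a \<in> acts G ?x" using path[OF h] by auto
    define m where "m = seqp G b ?x ?a"
    \<comment> \<open>Past the last step the value 0 matches the empty remainder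
      \<open>R (Suc h) = 0\<close>.\<close>
    define V' where "V' = (if h < ?H then V (X (Suc h)) else 0)"
    define Q where "Q a = l ?x a + (\<Sum>x'\<in>childs G ?x a. V x')" for a
    have RS: "R h = q h - (real ?H - real h + 1) * \<eta> ?x * c h + R (Suc h)"
      unfolding R_def using h by (subst sum.atLeast_Suc_atMost) auto
    have Qpos: "0 \<le> Q a" for a unfolding Q_def
      using lpos x Vpos by (intro add_nonneg_nonneg sum_nonneg) (auto simp: childsD)
    have lh: "l ?x ?a = c h" by (simp add: l x)
    have V'Q: "c h + V' \<le> Q ?a"
    proof (cases "h < ?H")
      case True
      have "Suc h \<in> {1..?H}" using True by simp
      then have "X (Suc h) \<in> childs G ?x ?a" using path[OF h] path[of "Suc h"] True
        by (simp add: childs_def)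
      then have "V (X (Suc h)) \<le> (\<Sum>x'\<in>childs G ?x ?a. V x')"
        using finite_childs Vpos by (intro member_le_sum) (auto simp: childsD)
      then show ?thesis using True by (simp add: V'_def Q_def lh)
    next
      case False
      then show ?thesis using Vpos by (auto simp: V'_def Q_def lh childsD intro!: sum_nonneg)
    qed
    have K: "\<eta> ?x * R (Suc h) \<le> m * (1 - exp (- \<eta> ?x * V'))"
    proof (cases "h < ?H")
      case True
      have "Suc h \<in> {1..?H}" using True by simp
      then have "\<eta> ?x * R (Suc h) \<le> pseq G b (X (Suc h)) * (1 - exp (- \<eta> ?x * V (X (Suc h))))"
        using less.hyps[of "Suc h" "\<eta> ?x"] \<eta>_mono[of h] h True \<eta>[OF x(1)] by auto
      moreover have "pseq G b (X (Suc h)) = m"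
        using path[OF h] True by (simp add: pseq_def m_def)
      ultimately show ?thesis using True by (simp add: V'_def)
    next
      case False
      then show ?thesis using h by (simp add: R_def V'_def)
    qed
    \<comment> \<open>The recursion for \<open>V\<close> reads 1 - exp (- \<eta> V) = \<Sum> b (1 -
      exp (- \<eta> Q)). Every term is nonnegative since \<open>Q\<close> is, so only the played
      action is kept.\<close>
    have Vx: "m * (1 - exp (- \<eta> ?x * (c h + V'))) \<le> pseq G b ?x * (1 - exp (- \<eta> ?x * V ?x))"
    proof -
      have "(\<Sum>a\<in>acts G ?x. b ?x a * exp (- \<eta> ?x * Q a)) * exp (\<eta> ?x * V ?x) = (\<Sum>a\<in>acts G ?x. soft \<eta> b l V ?x a)"
        unfolding sum_distrib_right
        by (intro sum.cong refl) (simp add: soft_def Q_def algebra_simps flip: exp_add)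
      then have "(\<Sum>a\<in>acts G ?x. b ?x a * exp (- \<eta> ?x * Q a)) * exp (\<eta> ?x * V ?x) = 1"
        using policy_sum[OF s x(1)] by simp
      then have "exp (- \<eta> ?x * V ?x) = (\<Sum>a\<in>acts G ?x. b ?x a * exp (- \<eta> ?x * Q a))"
        by (simp add: exp_minus field_simps)
      then have "1 - exp (- \<eta> ?x * V ?x) = (\<Sum>a\<in>acts G ?x. b ?x a * (1 - exp (- \<eta> ?x * Q a)))"
        using policy_sum[OF b(1) x(1)] by (simp add: right_diff_distrib sum_subtractf)
      also have "\<dots> \<ge> b ?x ?a * (1 - exp (- \<eta> ?x * Q ?a))"
        using x finite_acts Qpos \<eta>[OF x(1)] b(2)[OF x(1)]
        by (intro member_le_sum[of ?a]) (auto intro!: mult_nonneg_nonneg intro: less_imp_le)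
      finally have "b ?x ?a * (1 - exp (- \<eta> ?x * Q ?a)) \<le> 1 - exp (- \<eta> ?x * V ?x)" .
      moreover have "b ?x ?a * (1 - exp (- \<eta> ?x * (c h + V'))) \<le> b ?x ?a * (1 - exp (- \<eta> ?x * Q ?a))"
        using V'Q \<eta>[OF x(1)] b(2)[OF x(1,3)] by (intro mult_left_mono) auto
      ultimately have "pseq G b ?x * (b ?x ?a * (1 - exp (- \<eta> ?x * (c h + V')))) 
          \<le> pseq G b ?x * (1 - exp (- \<eta> ?x * V ?x))"
        using pseq_bounds[OF b(1) x(1)] by (intro mult_left_mono) auto
      then show ?thesis by (simp add: m_def seqp_eq[OF x(1)] mult_ac)
    qed
    have "e * (m * c h + R (Suc h) - ((real ?H - real h) + 1) * \<eta> ?x * c h)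
        \<le> pseq G b ?x * (1 - exp (- e * V ?x))"
    proof (rule stability_step[OF less.prems(2,3) _ _ c(1)[OF h] _ _ K Vx])
      show "0 \<le> m" "m * c h \<le> 1" using seqp_bounds(1)[OF b(1) x(1,3)] c(2)[OF h] by (auto simp: m_def)
      show "R (Suc h) \<le> real ?H - real h" using R_le[of "Suc h"] h by simp
      show "0 \<le> real ?H - real h" using h by simp
      show "0 \<le> pseq G b ?x" using pseq_bounds[OF b(1) x(1)] by simp
    qed
    then show ?case unfolding RS by (simp add: q_def m_def algebra_simps)
  qed
  have 1: "1 \<in> {1..?H}" using horizon_ge_1 by simp
  note x1 = path[OF 1]
  have root: "X 1 \<in> roots G" using x1 by (simp add: roots_def)
  have "pseq G b (X 1) = 1" using x1 parent_None_iff[of "X 1"] by (simp add: pseq_def)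
  then have "\<eta> (X 1) * R 1 \<le> 1 - exp (- \<eta> (X 1) * V (X 1))"
    using claim[OF 1, of "\<eta> (X 1)"] \<eta>[of "X 1"] x1 by simp
  also have "\<dots> \<le> \<eta> (X 1) * V (X 1)"
    using exp_ge_add_one_self[of "- \<eta> (X 1) * V (X 1)"] by simp
  finally have "R 1 \<le> V (X 1)" using \<eta>[of "X 1"] x1 by simp
  also have "\<dots> \<le> (\<Sum>x\<in>roots G. V x)"
    using root Vpos finite_infosets by (intro member_le_sum) (auto simp: roots_def)
  finally have R1: "R 1 \<le> (\<Sum>x\<in>roots G. V x)" .
  have "inner_seq G b l = (\<Sum>x\<in>infosets G. \<Sum>a\<in>acts G x. 
      if X (level G x) = x \<and> A (level G x) = a then seqp G b x a * c (level G x) else 0)"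
    unfolding inner_seq_def l by (intro sum.cong refl) auto
  also have "\<dots> = (\<Sum>h=1..?H. q h)"
    using path by (subst sum_path) (auto simp: q_def)
  finally have inner: "inner_seq G b l = (\<Sum>h=1..?H. q h)" .
  have "(\<Sum>h=1..?H. q h) - real ?H * (\<Sum>h=1..?H. \<eta> (X h) * c h) \<le> R 1"
    unfolding R_def sum_distrib_left sum_subtractf[symmetric]
  proof (intro sum_mono)
    fix k assume k: "k \<in> {1..?H}"
    have "(real ?H - real k + 1) * (\<eta> (X k) * c k) \<le> real ?H * (\<eta> (X k) * c k)"
      using k c(1)[OF k] \<eta>[of "X k"] path[OF k] by (intro mult_right_mono mult_nonneg_nonneg) auto
    then show "q k - real ?H * (\<eta> (X k) * c k) \<le> q k - (real ?H - real k + 1) * \<eta> (X k) * c k"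
      by (simp add: mult_ac)
  qed
  moreover have "(\<Sum>x\<in>roots G. V x) \<le> inner_seq G \<mu> l + dil_div G \<eta> \<mu> b"
    using dil_div_soft[OF \<mu> b(2) \<eta>, where L = l and V = V] dil_div_nonneg[where \<eta> = \<eta>, OF \<mu> s soft_pos[OF b(2)] \<eta>] by simp
  ultimately show ?thesis using R1 inner by simp
qed

end

section \<open>Elementary inequalities\<close>

text \<open>The chord of 2^z over [0, 1] is 1 + z, that is, \<open>one_minus_exp_scale\<close> at V
  = - ln 2. In base 2 the constant 1 is correct all the way up to z = 1.\<close>

lemma le_log2_one_plus:
  fixes z :: real
  assumes "0 \<le> z" "z \<le> 1"
  shows "z \<le> log 2 (1 + z)"
proof (cases "z = 0")
  case False
  then have "z / 1 * (1 - exp (- 1 * (- ln 2))) \<le> 1 - exp (- z * (- ln 2))"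
    using assms by (intro one_minus_exp_scale) auto
  then have "exp (z * ln 2) \<le> 1 + z" by simp
  then have "z * ln 2 \<le> ln (1 + z)" using assms by (simp add: ln_ge_iff)
  then show ?thesis by (simp add: log_def field_simps)
qed simp

text \<open>With z = u / (1 + U) in [0, 1], each summand is at most log_2 (1 + z), which is the
  increment of log_2 (1 + U).\<close>

lemma sum_increment_ratio_le_log:
  fixes u U :: "nat \<Rightarrow> real"
  assumes "U 0 = 0" "\<And>n. n < N \<Longrightarrow> U (Suc n) = U n + u (Suc n)"
    and "\<And>n. n < N \<Longrightarrow> 0 \<le> u (Suc n)" "\<And>n. n < N \<Longrightarrow> u (Suc n) \<le> 1 + U n"
  shows "(\<Sum>t=1..N. u t / (1 + U (t - 1))) \<le> log 2 (1 + U N)"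
proof -
  have "0 \<le> U n \<and> (\<Sum>t=1..n. u t / (1 + U (t - 1))) \<le> log 2 (1 + U n)" if "n \<le> N" for n
    using that
  proof (induction n)
    case (Suc n)
    then have n: "n < N" "0 \<le> U n" by auto
    have "u (Suc n) / (1 + U n) \<le> log 2 (1 + u (Suc n) / (1 + U n))"
      using n assms(3,4)[OF n(1)] by (intro le_log2_one_plus) auto
    moreover have pos: "0 < 1 + u (Suc n) / (1 + U n)"
      using n assms(3)[OF n(1)] by (intro add_pos_nonneg) auto
    moreover have "1 + U (Suc n) = (1 + U n) * (1 + u (Suc n) / (1 + U n))"
      using n assms(2)[OF n(1)] by (simp add: field_simps)
    then have "log 2 (1 + U (Suc n)) = log 2 (1 + U n) + log 2 (1 + u (Suc n) / (1 + U n))"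
      using n pos by (simp add: log_mult)
    ultimately show ?case using Suc assms(2,3)[OF n(1)] n by simp
  qed (use assms in simp)
  then show ?thesis by simp
qed

text \<open>Bounding the tails (rather than the initial segments) of the weighted sum keeps the
coefficients of the summation by parts nonnegative.\<close>

lemma sum_le_of_weighted_tails:
  fixes D g :: "nat \<Rightarrow> real"
  assumes g: "\<And>t. t \<in> {1..T} \<Longrightarrow> 0 < g t" and decr: "\<And>t. t \<in> {1..<T} \<Longrightarrow> g (Suc t) \<le> g t"
    and tails: "\<And>s. s \<in> {1..T} \<Longrightarrow> (\<Sum>t=s..T. g t * D t) \<le> c" and T: "1 \<le> T"
  shows "(\<Sum>t=1..T. D t) \<le> c / g T"
proof -
  define R where "R s = (\<Sum>t=s..T. g t * D t)" for s
  \<comment> \<open>Abel summation run downward from T, with D s = (R s - R (Suc s)) / g s: the tail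
    \<open>R (Suc s)\<close> gets the coefficient 1 / g (Suc s) - 1 / g s, and the correction with
    \<open>c\<close> telescopes.\<close>
  have "1 \<le> s \<longrightarrow> (\<Sum>t=s..T. D t) \<le> R s / g s + c * (1 / g T - 1 / g s)" if "s \<le> T" for s
    using that
  proof (induction s rule: inc_induct)
    case base
    then show ?case using g[of T] T by (simp add: R_def)
  next
    case (step s)
    show ?case
    proof
      assume s: "1 \<le> s"
      have gs: "0 < g s" "0 < g (Suc s)" "g (Suc s) \<le> g s" using g decr s step by auto
      have "(\<Sum>t=s..T. D t) = D s + (\<Sum>t=Suc s..T. D t)"
        using step by (intro sum.atLeast_Suc_atMost) simp
      also have "\<dots> \<le> D s + (R (Suc s) / g (Suc s) + c * (1 / g T - 1 / g (Suc s)))"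
        using step by simp
      also have "R s = g s * D s + R (Suc s)"
        unfolding R_def using step by (intro sum.atLeast_Suc_atMost) simp
      then have "D s = (R s - R (Suc s)) / g s" using gs by (simp add: field_simps)
      also have "(R s - R (Suc s)) / g s + (R (Suc s) / g (Suc s) + c * (1 / g T - 1 / g (Suc s)))
          = R s / g s + R (Suc s) * (1 / g (Suc s) - 1 / g s) + c * (1 / g T - 1 / g (Suc s))"
        by (simp add: algebra_simps diff_divide_distrib)
      also have "\<dots> \<le> R s / g s + c * (1 / g (Suc s) - 1 / g s) + c * (1 / g T - 1 / g (Suc s))"
        using tails[of "Suc s"] step gs unfolding R_def
        by (intro add_right_mono add_left_mono mult_right_mono) (auto simp: frac_le)
      also have "\<dots> = R s / g s + c * (1 / g T - 1 / g s)" by (simp add: algebra_simps)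
      finally show "(\<Sum>t=s..T. D t) \<le> R s / g s + c * (1 / g T - 1 / g s)" .
    qed
  qed
  from this[OF T] have "(\<Sum>t=1..T. D t) \<le> R 1 / g 1 + c * (1 / g T - 1 / g 1)" by simp
  also have "\<dots> \<le> c / g 1 + c * (1 / g T - 1 / g 1)"
    using tails[of 1] g[of 1] T by (intro add_right_mono divide_right_mono) (auto simp: R_def)
  finally show ?thesis by (simp add: algebra_simps)
qed

text \<open>The difference of the two sides vanishes at 0 and has derivative x^2 / ((1 + x) (2 +
  x)^2).\<close>

lemma ln_one_plus_ge_pade:
  fixes z :: real
  assumes "0 \<le> z"
  shows "2 * z / (2 + z) \<le> ln (1 + z)"
proof -
  define f where "f z = ln (1 + z) - 2 * z / (2 + z)" for z :: real
  have "f 0 \<le> f z"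
  proof (rule DERIV_nonneg_imp_nondecreasing[OF assms])
    fix x :: real assume x: "0 \<le> x" "x \<le> z"
    have "(f has_real_derivative (1 / (1 + x) - (2 * (2 + x) - 2 * x * 1) / ((2 + x) * (2 + x)))) (at x)"
      unfolding f_def using x by (auto intro!: derivative_eq_intros)
    moreover have "1 / (1 + x) - (2 * (2 + x) - 2 * x * 1) / ((2 + x) * (2 + x)) = x\<^sup>2 / ((1 + x) * (2 + x)\<^sup>2)"
      using x by (simp add: divide_simps) (simp add: power2_eq_square algebra_simps)
    ultimately show "\<exists>y. (f has_real_derivative y) (at x) \<and> 0 \<le> y" using x by auto
  qed
  then show ?thesis by (simp add: f_def)
qed

text \<open>\<open>ln_one_plus_ge_pade\<close> at z = 2 g / m. The left-hand side is the exponential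
  moment of the weight 1 / (m + g), scaled by 2 g and taken with probability m: the bias g in the
  denominator pays for the exponent 2 g.\<close>

lemma implicit_exploration_exp_bound:
  fixes m g :: real
  assumes "0 \<le> m" "0 < g"
  shows "m * (exp (2 * g / (m + g)) - 1) \<le> 2 * g"
proof (cases "m = 0")
  case False
  then have m: "0 < m" using assms by simp
  have "2 * g / (m + g) = 2 * (2 * g / m) / (2 + 2 * g / m)" using m assms by (simp add: field_simps)
  also have "\<dots> \<le> ln (1 + 2 * g / m)" using m assms by (intro ln_one_plus_ge_pade) auto
  finally have "exp (2 * g / (m + g)) \<le> 1 + 2 * g / m"
    using m assms by (subst (asm) ln_ge_iff) (auto intro: add_pos_nonneg)
  then have "m * (exp (2 * g / (m + g)) - 1) \<le> m * (2 * g / m)" using m by (intro mult_left_mono) auto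
  then show ?thesis using m by simp
qed (use assms in auto)

section \<open>Opponents and learning rates\<close>

context efg_tree
begin

context
  fixes P :: "'nu \<Rightarrow> 'x \<Rightarrow> real" and Rw :: "'nu \<Rightarrow> 'x \<Rightarrow> 'a \<Rightarrow> real"
  assumes opp: "valid_opponents G P Rw"
begin

lemma reach_nonneg: "x \<in> infosets G \<Longrightarrow> 0 \<le> P \<nu> x"
  and sum_reach_roots: "(\<Sum>x\<in>roots G. P \<nu> x) = 1"
  and sum_reach_childs: "x \<in> infosets G \<Longrightarrow> a \<in> acts G x \<Longrightarrow> level G x < horizon G \<Longrightarrow>
    (\<Sum>x'\<in>childs G x a. P \<nu> x') = P \<nu> x"
  and reward_bounds: "x \<in> infosets G \<Longrightarrow> a \<in> acts G x \<Longrightarrow> 0 \<le> Rw \<nu> x a \<and> Rw \<nu> x a \<le> 1"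
  using opp by (auto simp: valid_opponents_def roots_def childs_def)

lemma reach_child_le:
  assumes "x' \<in> infosets G" "parent G x' = Some (x, a)"
  shows "P \<nu> x' \<le> P \<nu> x"
proof -
  note p = parent_SomeD[OF assms]
  have "P \<nu> x' \<le> (\<Sum>x'\<in>childs G x a. P \<nu> x')"
    using assms by (intro member_le_sum) (auto simp: childs_def finite_infosets reach_nonneg)
  also have "\<dots> = P \<nu> x" using p level_le_horizon[OF assms(1)] by (intro sum_reach_childs) auto
  finally show ?thesis .
qed

lemma reach_desc_le:
  assumes "x' \<in> infosets G" "is_desc G x' x"
  shows "P \<nu> x' \<le> P \<nu> x"
  using assms(2,1) unfolding is_desc_def
proof (induction rule: converse_rtranclp_induct)
  case (step y z)
  then obtain b where "parent G y = Some (z, b)" by blast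
  then show ?case using step parent_SomeD[of y z b] reach_child_le[of y z b \<nu>] by simp
qed simp

lemma reach_le_1:
  assumes "x \<in> infosets G"
  shows "P \<nu> x \<le> 1"
  using assms
proof (induction "level G x" arbitrary: x rule: less_induct)
  case less
  from \<open>x \<in> infosets G\<close> show ?case
  proof (cases rule: infoset_cases)
    case root
    then have "x \<in> roots G" using less by (simp add: roots_def)
    then have "P \<nu> x \<le> (\<Sum>x\<in>roots G. P \<nu> x)"
      using reach_nonneg finite_infosets by (intro member_le_sum) (auto simp: roots_def)
    then show ?thesis by (simp add: sum_reach_roots)
  next
    case (child y b)
    then show ?thesis using reach_child_le[of x y b \<nu>] less.prems less.hyps[of y] by simp
  qed
qed

text \<open>An episode visits one information set per step, so the total is the number of steps.
  \<open>W\<close> is the reach probability times the number of steps from \<open>x\<close> on, and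
  \<open>sum_pseq_telescope\<close> cancels all but its value at the roots.\<close>

lemma sum_seqp_reach:
  assumes \<mu>: "\<mu> \<in> policies G"
  shows "(\<Sum>x\<in>infosets G. \<Sum>a\<in>acts G x. seqp G \<mu> x a * P \<nu> x) = real (horizon G)"
proof -
  define W where "W x = P \<nu> x * (real (horizon G) + 1 - real (level G x))" for x
  have S: "(\<Sum>x\<in>infosets G. \<Sum>a\<in>acts G x. seqp G \<mu> x a * f x) = (\<Sum>x\<in>infosets G. pseq G \<mu> x * f x)"
    for f :: "'x \<Rightarrow> real"
    by (intro sum.cong refl) (simp add: sum_seqp[OF \<mu>] flip: sum_distrib_right)
  have "(\<Sum>x\<in>roots G. W x) = (\<Sum>x\<in>roots G. P \<nu> x) * real (horizon G)"
    unfolding sum_distrib_right by (intro sum.cong) (auto simp: W_def roots_def)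
  then have r: "(\<Sum>x\<in>roots G. W x) = real (horizon G)" by (simp add: sum_reach_roots)
  have ch: "(\<Sum>x'\<in>childs G x a. W x') = P \<nu> x * (real (horizon G) - real (level G x))"
    if x: "x \<in> infosets G" "a \<in> acts G x" for x a
  proof (cases "level G x < horizon G")
    case True
    have "(\<Sum>x'\<in>childs G x a. W x') = (\<Sum>x'\<in>childs G x a. P \<nu> x') * (real (horizon G) - real (level G x))"
      unfolding sum_distrib_right by (intro sum.cong) (auto simp: W_def childsD(5))
    then show ?thesis using sum_reach_childs[OF x True] by simp
  next
    case False
    then have "level G x = horizon G" using level_le_horizon[OF x(1)] by simp
    moreover from this have "childs G x a = {}"
      using childsD level_le_horizon by (metis all_not_in_conv not_less_eq_eq order_refl)
    ultimately show ?thesis by simp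
  qed
  have "(\<Sum>x\<in>infosets G. \<Sum>a\<in>acts G x. seqp G \<mu> x a * (\<Sum>x'\<in>childs G x a. W x'))
      = (\<Sum>x\<in>infosets G. pseq G \<mu> x * (P \<nu> x * (real (horizon G) - real (level G x))))"
    unfolding S[symmetric] by (intro sum.cong refl) (simp add: ch)
  then have "(\<Sum>x\<in>infosets G. pseq G \<mu> x * W x) = real (horizon G)
      + (\<Sum>x\<in>infosets G. pseq G \<mu> x * (P \<nu> x * (real (horizon G) - real (level G x))))"
    using sum_pseq_telescope[of \<mu> W] r by simp
  moreover have "(\<Sum>x\<in>infosets G. pseq G \<mu> x * W x) = (\<Sum>x\<in>infosets G. pseq G \<mu> x * P \<nu> x)
      + (\<Sum>x\<in>infosets G. pseq G \<mu> x * (P \<nu> x * (real (horizon G) - real (level G x))))"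
    unfolding sum.distrib[symmetric] by (intro sum.cong) (auto simp: W_def algebra_simps)
  ultimately show ?thesis by (simp add: S)
qed

lemma loss_bounds:
  assumes "x \<in> infosets G" "a \<in> acts G x"
  shows "0 \<le> loss P Rw \<nu> x a" "loss P Rw \<nu> x a \<le> P \<nu> x"
  using reach_nonneg[OF assms(1), of \<nu>] reward_bounds[OF assms, of \<nu>]
  by (auto simp: loss_def mult_left_le)

lemma inner_seq_loss_bounds:
  assumes \<mu>: "\<mu> \<in> policies G"
  shows "0 \<le> inner_seq G \<mu> (loss P Rw \<nu>)" "inner_seq G \<mu> (loss P Rw \<nu>) \<le> real (horizon G)"
proof -
  show "0 \<le> inner_seq G \<mu> (loss P Rw \<nu>)" unfolding inner_seq_def
    using seqp_bounds[OF \<mu>] loss_bounds by (intro sum_nonneg mult_nonneg_nonneg) auto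
  have "inner_seq G \<mu> (loss P Rw \<nu>) \<le> (\<Sum>x\<in>infosets G. \<Sum>a\<in>acts G x. seqp G \<mu> x a * P \<nu> x)"
    unfolding inner_seq_def using seqp_bounds[OF \<mu>] loss_bounds by (intro sum_mono mult_left_mono) auto
  then show "inner_seq G \<mu> (loss P Rw \<nu>) \<le> real (horizon G)" by (simp add: sum_seqp_reach[OF \<mu>])
qed

lemma infosets_nonempty: "infosets G \<noteq> {}"
  using sum_reach_roots[of undefined] by (auto simp: roots_def)

lemma A_X_pos: "0 < A_X G"
  unfolding A_X_def using infosets_nonempty finite_infosets card_acts_pos by (intro sum_pos) auto

end

section \<open>The uniform base policy and the adaptive rates\<close>

lemma card_acts_le_A_X: "x \<in> infosets G \<Longrightarrow> card (acts G x) \<le> A_X G"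
  unfolding A_X_def using finite_infosets by (intro member_le_sum) auto

lemma uniform_policy_pos: "x \<in> infosets G \<Longrightarrow> 0 < uniform_policy G x a"
  by (simp add: uniform_policy_def card_acts_pos)

lemma uniform_policy_policies: "uniform_policy G \<in> policies G"
  using card_acts_pos by (auto simp: policies_def uniform_policy_def)

text \<open>The local divergence to the uniform policy is the logarithm of the number of actions
  minus an entropy.\<close>

lemma dil_div_uniform_le:
  assumes \<mu>: "\<mu> \<in> policies G" and \<eta>: "\<And>x. x \<in> infosets G \<Longrightarrow> 0 < \<eta> x"
  shows "dil_div G \<eta> \<mu> (uniform_policy G) \<le> (\<Sum>x\<in>infosets G. pseq G \<mu> x / \<eta> x * ln (real (card (acts G x))))"
  unfolding dil_div_kl
proof (intro sum_mono mult_left_mono)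
  fix x assume x: "x \<in> infosets G"
  show "0 \<le> pseq G \<mu> x / \<eta> x" using pseq_bounds[OF \<mu> x] \<eta>[OF x] by simp
  have "kl \<mu> (uniform_policy G) x \<le> (\<Sum>a\<in>acts G x. \<mu> x a * ln (real (card (acts G x))))"
    unfolding kl_def
  proof (intro sum_mono)
    fix a assume a: "a \<in> acts G x"
    note b = policy_nonneg[OF \<mu> x a] policy_le_1[OF \<mu> x a]
    show "\<mu> x a * ln (\<mu> x a / uniform_policy G x a) \<le> \<mu> x a * ln (real (card (acts G x)))"
    proof (cases "\<mu> x a = 0")
      case False
      then have "0 < \<mu> x a" using b by simp
      then show ?thesis using b card_acts_pos[OF x]
        by (intro mult_left_mono) (auto simp: uniform_policy_def mult_left_le_one_le)
    qed simp
  qed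
  also have "\<dots> = ln (real (card (acts G x)))"
    using policy_sum[OF \<mu> x] by (simp flip: sum_distrib_right)
  finally show "kl \<mu> (uniform_policy G) x \<le> ln (real (card (acts G x)))" .
qed

definition avg :: "('x \<Rightarrow> 'a \<Rightarrow> real) \<Rightarrow> 'x \<Rightarrow> real" where
  "avg Pp x = (\<Sum>a\<in>acts G x. Pp x a) / real (card (acts G x))"

lemma eta_t_avg: "eta_t G \<eta> Pp x = Min ((\<lambda>x'. \<eta> / (1 + avg Pp x')) ` {x'\<in>infosets G. is_desc G x' x})"
  by (simp add: eta_t_def avg_def)

lemma avg_nonneg: "(\<And>a. a \<in> acts G x \<Longrightarrow> 0 \<le> Pp x a) \<Longrightarrow> 0 \<le> avg Pp x"
  by (simp add: avg_def sum_nonneg)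

lemma avg_mono: "(\<And>a. a \<in> acts G x \<Longrightarrow> Pp x a \<le> Pp' x a) \<Longrightarrow> avg Pp x \<le> avg Pp' x"
  by (simp add: avg_def divide_right_mono sum_mono)

lemma avg_le:
  assumes "x \<in> infosets G" "\<And>a. a \<in> acts G x \<Longrightarrow> Pp x a \<le> c"
  shows "avg Pp x \<le> c"
proof -
  have "(\<Sum>a\<in>acts G x. Pp x a) \<le> real (card (acts G x)) * c" 
    using sum_bounded_above[of "acts G x" "Pp x" c] assms(2) by simp
  then show ?thesis using card_acts_pos[OF assms(1)] by (simp add: avg_def field_simps)
qed

lemma finite_desc: "finite {x' \<in> infosets G. is_desc G x' x}"
  using finite_infosets by simp

lemma desc_refl: "x \<in> infosets G \<Longrightarrow> x \<in> {x' \<in> infosets G. is_desc G x' x}"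
  by (simp add: is_desc_def)

lemma eta_t_le:
  assumes "x' \<in> infosets G" "is_desc G x' x"
  shows "eta_t G \<eta> Pp x \<le> \<eta> / (1 + avg Pp x')"
  unfolding eta_t_avg using finite_desc assms by (intro Min_le) auto

lemma eta_t_attained:
  assumes "x \<in> infosets G"
  obtains x' where "x' \<in> infosets G" "is_desc G x' x" "eta_t G \<eta> Pp x = \<eta> / (1 + avg Pp x')"
proof -
  have "eta_t G \<eta> Pp x \<in> (\<lambda>x'. \<eta> / (1 + avg Pp x')) ` {x'\<in>infosets G. is_desc G x' x}"
    unfolding eta_t_avg using finite_desc desc_refl[OF assms] by (intro Min_in) auto
  then show ?thesis using that by blast
qed

lemma eta_t_pos:
  assumes "x \<in> infosets G" "0 < \<eta>" "\<And>x a. x \<in> infosets G \<Longrightarrow> a \<in> acts G x \<Longrightarrow> 0 \<le> Pp x a"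
  shows "0 < eta_t G \<eta> Pp x"
proof -
  obtain x' where x': "x' \<in> infosets G" "eta_t G \<eta> Pp x = \<eta> / (1 + avg Pp x')"
    using eta_t_attained[OF assms(1)] by metis
  then have "0 \<le> avg Pp x'" using assms(3) by (intro avg_nonneg) auto
  then show ?thesis using x' assms(2) by (simp add: add_pos_nonneg)
qed

text \<open>Descendants of the child are descendants of its parent, so the minimum at the child runs
  over fewer information sets. This monotonicity is the purpose of the minimum in the rate.\<close>

lemma eta_t_child_ge:
  assumes "x' \<in> infosets G" "parent G x' = Some (x, a)"
  shows "eta_t G \<eta> Pp x \<le> eta_t G \<eta> Pp x'"
proof -
  obtain y where y: "y \<in> infosets G" "is_desc G y x'" "eta_t G \<eta> Pp x' = \<eta> / (1 + avg Pp y)"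
    using eta_t_attained[OF assms(1)] by metis
  have "is_desc G y x" using y(2) assms(2) unfolding is_desc_def by (auto intro: rtranclp.rtrancl_into_rtrancl)
  then show ?thesis using eta_t_le[OF y(1)] y(3) by simp
qed

lemma eta_t_antimono:
  assumes "x \<in> infosets G" "0 < \<eta>" "\<And>x a. x \<in> infosets G \<Longrightarrow> a \<in> acts G x \<Longrightarrow> 0 \<le> Pp x a"
    and "\<And>x a. x \<in> infosets G \<Longrightarrow> a \<in> acts G x \<Longrightarrow> Pp x a \<le> Pp' x a"
  shows "eta_t G \<eta> Pp' x \<le> eta_t G \<eta> Pp x"
proof -
  obtain y where y: "y \<in> infosets G" "is_desc G y x" "eta_t G \<eta> Pp x = \<eta> / (1 + avg Pp y)"
    using eta_t_attained[OF assms(1)] by metis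
  have "0 \<le> avg Pp y" "avg Pp y \<le> avg Pp' y" using y assms by (auto intro: avg_nonneg avg_mono)
  then have "\<eta> / (1 + avg Pp' y) \<le> \<eta> / (1 + avg Pp y)" using assms(2) by (intro frac_le) auto
  then show ?thesis using eta_t_le[OF y(1,2), of \<eta> Pp'] y(3) by simp
qed

lemma inverse_eta_t_le:
  assumes "x \<in> infosets G" "0 < \<eta>" "\<And>x'. x' \<in> infosets G \<Longrightarrow> is_desc G x' x \<Longrightarrow> 1 + avg Pp x' \<le> c"
  shows "1 / eta_t G \<eta> Pp x \<le> c / \<eta>"
proof -
  obtain y where y: "y \<in> infosets G" "is_desc G y x" "eta_t G \<eta> Pp x = \<eta> / (1 + avg Pp y)"
    using eta_t_attained[OF assms(1)] by metis
  then show ?thesis using assms(3)[OF y(1,2)] assms(2) by (simp add: divide_right_mono)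
qed

end

section \<open>Exponential supermartingale bounds\<close>

text \<open>Bounded on the whole space rather than almost everywhere: the class is closed under
  sums, products and exp, and its members are integrable under a probability measure, so
  integrability reduces to introduction rules.\<close>

definition bdd_borel :: "'w measure \<Rightarrow> ('w \<Rightarrow> real) \<Rightarrow> bool" where
  "bdd_borel N f \<longleftrightarrow> f \<in> borel_measurable N \<and> (\<exists>B. \<forall>w\<in>space N. \<bar>f w\<bar> \<le> B)"

lemma bdd_borelI: "f \<in> borel_measurable N \<Longrightarrow> (\<And>w. w \<in> space N \<Longrightarrow> \<bar>f w\<bar> \<le> B) \<Longrightarrow> bdd_borel N f"
  unfolding bdd_borel_def by blast

lemma bdd_borel_const: "bdd_borel N (\<lambda>_. c)"
  by (rule bdd_borelI[of _ _ "\<bar>c\<bar>"]) auto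

lemma bdd_borel_add:
  assumes "bdd_borel N f" "bdd_borel N g"
  shows "bdd_borel N (\<lambda>w. f w + g w)"
proof -
  obtain B C where "\<forall>w\<in>space N. \<bar>f w\<bar> \<le> B" "\<forall>w\<in>space N. \<bar>g w\<bar> \<le> C"
    using assms by (auto simp: bdd_borel_def)
  then have "\<bar>f w + g w\<bar> \<le> B + C" if "w \<in> space N" for w
    using that by (meson abs_triangle_ineq add_mono order_trans)
  then show ?thesis using assms by (intro bdd_borelI[of _ _ "B + C"]) (auto simp: bdd_borel_def)
qed

lemma bdd_borel_mult:
  assumes "bdd_borel N f" "bdd_borel N g"
  shows "bdd_borel N (\<lambda>w. f w * g w)"
proof -
  obtain B C where *: "\<forall>w\<in>space N. \<bar>f w\<bar> \<le> B" "\<forall>w\<in>space N. \<bar>g w\<bar> \<le> C"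
    using assms by (auto simp: bdd_borel_def)
  have "\<bar>f w * g w\<bar> \<le> B * C" if "w \<in> space N" for w
    unfolding abs_mult using * that by (intro mult_mono) (auto intro: order_trans[OF abs_ge_zero])
  then show ?thesis using assms by (intro bdd_borelI[of _ _ "B * C"]) (auto simp: bdd_borel_def)
qed

lemma bdd_borel_uminus: "bdd_borel N f \<Longrightarrow> bdd_borel N (\<lambda>w. - f w)"
  by (simp add: bdd_borel_def)

lemma bdd_borel_diff:
  assumes "bdd_borel N f" "bdd_borel N g"
  shows "bdd_borel N (\<lambda>w. f w - g w)"
  using bdd_borel_add[OF assms(1) bdd_borel_uminus[OF assms(2)]] by simp

lemma bdd_borel_sum:
  assumes "\<And>i. i \<in> I \<Longrightarrow> bdd_borel N (f i)"
  shows "bdd_borel N (\<lambda>w. \<Sum>i\<in>I. f i w)"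
  using assms
proof (induction I rule: infinite_finite_induct)
  case (insert i I)
  then have "bdd_borel N (\<lambda>w. f i w + (\<Sum>i\<in>I. f i w))" by (intro bdd_borel_add) auto
  then show ?case using insert by simp
qed (simp_all add: bdd_borel_const)

lemma bdd_borel_exp:
  assumes "bdd_borel N f"
  shows "bdd_borel N (\<lambda>w. exp (f w))"
proof -
  obtain B where *: "\<forall>w\<in>space N. \<bar>f w\<bar> \<le> B" using assms by (auto simp: bdd_borel_def)
  have "f w \<le> B" if "w \<in> space N" for w using bspec[OF * that] by simp
  moreover have "f \<in> borel_measurable N" using assms by (simp add: bdd_borel_def)
  ultimately show ?thesis by (intro bdd_borelI[of _ _ "exp B"]) simp_all
qed

lemma bdd_borel_subalg:
  assumes "subalgebra M N" "bdd_borel N f"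
  shows "bdd_borel M f"
proof -
  have "space N = space M" using assms(1) unfolding subalgebra_def by blast
  moreover have "f \<in> borel_measurable M"
    by (rule measurable_from_subalg[OF assms(1)]) (use assms(2) in \<open>simp add: bdd_borel_def\<close>)
  ultimately show ?thesis using assms(2) unfolding bdd_borel_def by metis
qed

lemmas bdd_borel_intros = bdd_borel_const bdd_borel_add bdd_borel_mult bdd_borel_diff bdd_borel_uminus
  bdd_borel_sum bdd_borel_exp

section \<open>Conditional means and exponential tail bounds\<close>

locale filtered_prob_space = prob_space M for M :: "'w measure" +
  fixes F :: "nat \<Rightarrow> 'w measure"
  assumes F_sub: "\<And>t. sigma_finite_subalgebra M (F t)"
    and F_mono: "\<And>s t. s \<le> t \<Longrightarrow> sets (F s) \<subseteq> sets (F t)"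
begin

lemma subalg: "subalgebra M (F t)"
  using F_sub by (rule sigma_finite_subalgebra.subalg)

lemma space_F [simp]: "space (F t) = space M"
  using subalg by (simp add: subalgebra_def)

lemma subalg_le: "s \<le> t \<Longrightarrow> subalgebra (F t) (F s)"
  using F_mono by (simp add: subalgebra_def)

lemma bdd_borel_integrable:
  assumes "bdd_borel M f" shows "integrable M f"
proof -
  obtain B where "\<forall>w\<in>space M. \<bar>f w\<bar> \<le> B" "f \<in> borel_measurable M" using assms by (auto simp: bdd_borel_def)
  then show ?thesis by (intro integrable_const_bound[of _ B]) auto
qed

lemma bdd_borel_F_M: "bdd_borel (F t) f \<Longrightarrow> bdd_borel M f"
  using bdd_borel_subalg[OF subalg] .

text \<open>A weak form of \<open>E[Y | F_t] = y\<close> that is stable under finite sums of \<open>Y\<close>.\<close>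

definition cond_mean :: "nat \<Rightarrow> ('w \<Rightarrow> real) \<Rightarrow> ('w \<Rightarrow> real) \<Rightarrow> bool" where
  "cond_mean t Y y \<longleftrightarrow> (\<forall>f. bdd_borel (F t) f \<longrightarrow> (\<integral>w. f w * Y w \<partial>M) = (\<integral>w. f w * y w \<partial>M))"

lemma cond_meanI:
  assumes Y: "bdd_borel M Y" and y: "bdd_borel (F t) y" and ae: "AE w in M. real_cond_exp M (F t) Y w = y w"
  shows "cond_mean t Y y"
  unfolding cond_mean_def
proof (intro allI impI)
  fix f assume f: "bdd_borel (F t) f"
  interpret S: sigma_finite_subalgebra M "F t" by (rule F_sub)
  have fM: "bdd_borel M f" "bdd_borel M y" using f y bdd_borel_F_M by auto
  have "(\<integral>w. f w * Y w \<partial>M) = (\<integral>w. f w * real_cond_exp M (F t) Y w \<partial>M)"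
    using f Y fM by (intro S.real_cond_exp_intg(2)[symmetric] bdd_borel_integrable bdd_borel_mult)
      (auto simp: bdd_borel_def)
  also have "\<dots> = (\<integral>w. f w * y w \<partial>M)"
    using fM ae by (intro integral_cong_AE) (auto simp: bdd_borel_def)
  finally show "(\<integral>w. f w * Y w \<partial>M) = (\<integral>w. f w * y w \<partial>M)" .
qed

lemma cond_mean_sum:
  assumes "\<And>i. i \<in> I \<Longrightarrow> bdd_borel M (Y i)" "\<And>i. i \<in> I \<Longrightarrow> bdd_borel (F t) (y i)"
    and "\<And>i. i \<in> I \<Longrightarrow> cond_mean t (Y i) (y i)"
  shows "cond_mean t (\<lambda>w. \<Sum>i\<in>I. Y i w) (\<lambda>w. \<Sum>i\<in>I. y i w)"
  unfolding cond_mean_def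
proof (intro allI impI)
  fix f assume f: "bdd_borel (F t) f"
  have fM: "bdd_borel M f" using f bdd_borel_F_M by auto
  have "(\<integral>w. f w * (\<Sum>i\<in>I. Y i w) \<partial>M) = (\<Sum>i\<in>I. \<integral>w. f w * Y i w \<partial>M)"
    unfolding sum_distrib_left using assms fM
    by (intro Bochner_Integration.integral_sum bdd_borel_integrable bdd_borel_mult)
  also have "\<dots> = (\<Sum>i\<in>I. \<integral>w. f w * y i w \<partial>M)"
    using assms(3) f by (intro sum.cong) (auto simp: cond_mean_def)
  also have "\<dots> = (\<integral>w. f w * (\<Sum>i\<in>I. y i w) \<partial>M)"
    unfolding sum_distrib_left using bdd_borel_F_M[OF assms(2)] fM
    by (intro Bochner_Integration.integral_sum[symmetric] bdd_borel_integrable bdd_borel_mult)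
  finally show "(\<integral>w. f w * (\<Sum>i\<in>I. Y i w) \<partial>M) = (\<integral>w. f w * (\<Sum>i\<in>I. y i w) \<partial>M)" .
qed

text \<open>The expectations of the partial exponentials do not increase, and Markov's inequality
  concludes. Dominating \<open>exp (D t)\<close> by a function affine in \<open>Y t\<close> with
  predictable coefficients lets only the conditional mean of \<open>Y t\<close> enter; no
  conditional expectation of an exponential is formed.\<close>

lemma exp_sum_tail_bound:
  fixes D Y a b y :: "nat \<Rightarrow> 'w \<Rightarrow> real"
  assumes D: "\<And>t. t \<in> {1..T} \<Longrightarrow> bdd_borel (F t) (D t)"
    and Y: "\<And>t. t \<in> {1..T} \<Longrightarrow> bdd_borel M (Y t)"
    and a: "\<And>t. t \<in> {1..T} \<Longrightarrow> bdd_borel (F (t - 1)) (a t)"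
    and b: "\<And>t. t \<in> {1..T} \<Longrightarrow> bdd_borel (F (t - 1)) (b t)"
    and y: "\<And>t. t \<in> {1..T} \<Longrightarrow> bdd_borel (F (t - 1)) (y t)"
    and mean: "\<And>t. t \<in> {1..T} \<Longrightarrow> cond_mean (t - 1) (Y t) (y t)"
    and dom: "\<And>t w. t \<in> {1..T} \<Longrightarrow> w \<in> space M \<Longrightarrow> exp (D t w) \<le> a t w + b t w * Y t w"
    and le1: "\<And>t w. t \<in> {1..T} \<Longrightarrow> w \<in> space M \<Longrightarrow> a t w + b t w * y t w \<le> 1"
    and s: "1 \<le> s"
  shows "prob {w \<in> space M. c \<le> (\<Sum>t=s..T. D t w)} \<le> exp (- c)"
proof -
  define Z where "Z n w = exp (\<Sum>t=s..n. D t w)" for n w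
  have Zbdd: "bdd_borel (F n) (Z n)" if "n \<le> T" for n
    unfolding Z_def using that s
    by (intro bdd_borel_exp bdd_borel_sum bdd_borel_subalg[OF subalg_le D]) auto
  have "(\<integral>w. Z n w \<partial>M) \<le> 1" if "n \<le> T" for n
    using that
  proof (induction n)
    case 0
    then show ?case using s by (simp add: Z_def prob_space)
  next
    case (Suc n)
    let ?t = "Suc n"
    have t: "?t \<in> {1..T}" using Suc by simp
    show ?case
    proof (cases "?t < s")
      case True
      then show ?thesis by (simp add: Z_def prob_space)
    next
      case False
      then have eq: "Z ?t w = Z n w * exp (D ?t w)" for w by (simp add: Z_def exp_add)
      have ZM: "bdd_borel M (Z n)" using Zbdd[of n] Suc bdd_borel_F_M by auto
      have aM: "bdd_borel M (a ?t)" "bdd_borel M (b ?t)" "bdd_borel M (y ?t)" "bdd_borel M (D ?t)"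
        using a[OF t] b[OF t] y[OF t] D[OF t] bdd_borel_F_M by auto
      have YM: "bdd_borel M (Y ?t)" using Y[OF t] .
      have "(\<integral>w. Z ?t w \<partial>M) \<le> (\<integral>w. Z n w * a ?t w + (Z n w * b ?t w) * Y ?t w \<partial>M)"
      proof (rule integral_mono)
        show "integrable M (Z ?t)" unfolding eq[abs_def]
          using ZM aM by (intro bdd_borel_integrable bdd_borel_intros)
        show "integrable M (\<lambda>w. Z n w * a ?t w + (Z n w * b ?t w) * Y ?t w)"
          using ZM aM YM by (intro bdd_borel_integrable bdd_borel_intros)
        fix w assume w: "w \<in> space M"
        have "Z ?t w \<le> Z n w * (a ?t w + b ?t w * Y ?t w)" unfolding eq
          using dom[OF t w] by (intro mult_left_mono) (auto simp: Z_def)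
        then show "Z ?t w \<le> Z n w * a ?t w + (Z n w * b ?t w) * Y ?t w" by (simp add: algebra_simps)
      qed
      also have "\<dots> = (\<integral>w. Z n w * a ?t w \<partial>M) + (\<integral>w. (Z n w * b ?t w) * Y ?t w \<partial>M)"
        using ZM aM YM by (intro Bochner_Integration.integral_add bdd_borel_integrable bdd_borel_intros)
      also have "(\<integral>w. (Z n w * b ?t w) * Y ?t w \<partial>M) = (\<integral>w. (Z n w * b ?t w) * y ?t w \<partial>M)"
        using mean[OF t] bdd_borel_mult[OF Zbdd[of n] b[OF t, simplified]] Suc by (simp add: cond_mean_def)
      also have "(\<integral>w. Z n w * a ?t w \<partial>M) + \<dots> = (\<integral>w. Z n w * a ?t w + (Z n w * b ?t w) * y ?t w \<partial>M)"
        using ZM aM YM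
        by (intro Bochner_Integration.integral_add[symmetric] bdd_borel_integrable bdd_borel_intros)
      also have "\<dots> \<le> (\<integral>w. Z n w \<partial>M)"
      proof (rule integral_mono)
        show "integrable M (Z n)" using ZM by (rule bdd_borel_integrable)
        show "integrable M (\<lambda>w. Z n w * a ?t w + (Z n w * b ?t w) * y ?t w)"
          using ZM aM by (intro bdd_borel_integrable bdd_borel_intros)
        fix w assume w: "w \<in> space M"
        have "Z n w * (a ?t w + b ?t w * y ?t w) \<le> Z n w * 1"
          using le1[OF t w] by (intro mult_left_mono) (auto simp: Z_def)
        then show "Z n w * a ?t w + (Z n w * b ?t w) * y ?t w \<le> Z n w" by (simp add: algebra_simps)
      qed
      finally show ?thesis using Suc by simp
    qed
  qed
  then have EZ: "(\<integral>w. Z T w \<partial>M) \<le> 1" by simp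
  have int: "integrable M (Z T)" using Zbdd[of T] bdd_borel_F_M bdd_borel_integrable by blast
  have "prob {w \<in> space M. c \<le> (\<Sum>t=s..T. D t w)} = prob {w \<in> space M. exp c \<le> Z T w}"
    by (simp add: Z_def)
  also have "\<dots> \<le> (\<integral>w. Z T w \<partial>M) / exp c"
    by (rule integral_Markov_inequality_measure[OF int sets.empty_sets]) (auto simp: Z_def)
  also have "\<dots> \<le> 1 / exp c" using EZ by (intro divide_right_mono) auto
  finally show ?thesis by (simp add: exp_minus field_simps)
qed

text \<open>For Y in [0, 1], exp (2 r Y) lies below its chord 1 + (exp (2 r) - 1) Y, which is affine
  in Y. Inserting the mean m l leaves at most 1 + 2 g l by
  \<open>implicit_exploration_exp_bound\<close>, and the factor exp (- 2 g l) compensates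
  this.\<close>

lemma implicit_exploration_tail_bound:
  fixes m g l Y :: "nat \<Rightarrow> 'w \<Rightarrow> real"
  assumes m: "\<And>t. t \<in> {1..T} \<Longrightarrow> bdd_borel (F (t - 1)) (m t)"
      "\<And>t w. t \<in> {1..T} \<Longrightarrow> w \<in> space M \<Longrightarrow> 0 \<le> m t w"
    and g: "\<And>t. t \<in> {1..T} \<Longrightarrow> bdd_borel (F (t - 1)) (g t)"
      "\<And>t w. t \<in> {1..T} \<Longrightarrow> w \<in> space M \<Longrightarrow> 0 < g t w"
    and l: "\<And>t. t \<in> {1..T} \<Longrightarrow> bdd_borel (F (t - 1)) (l t)"
      "\<And>t w. t \<in> {1..T} \<Longrightarrow> w \<in> space M \<Longrightarrow> 0 \<le> l t w"
    and Y: "\<And>t. t \<in> {1..T} \<Longrightarrow> Y t \<in> borel_measurable (F t)"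
      "\<And>t w. t \<in> {1..T} \<Longrightarrow> w \<in> space M \<Longrightarrow> 0 \<le> Y t w \<and> Y t w \<le> 1"
    and mean: "\<And>t. t \<in> {1..T} \<Longrightarrow> AE w in M. real_cond_exp M (F (t - 1)) (Y t) w = m t w * l t w"
    and s: "1 \<le> s"
  shows "prob {w \<in> space M. c \<le> (\<Sum>t=s..T. 2 * g t w * (Y t w / (m t w + g t w) - l t w))} \<le> exp (- c)"
proof -
  define r where "r t w = g t w / (m t w + g t w)" for t w
  have r: "bdd_borel (F (t - 1)) (r t)" if t: "t \<in> {1..T}" for t
  proof (rule bdd_borelI[of _ _ 1])
    show "r t \<in> borel_measurable (F (t - 1))"
      unfolding r_def using m(1)[OF t] g(1)[OF t] by (auto simp: bdd_borel_def)
    fix w assume "w \<in> space (F (t - 1))"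
    then show "\<bar>r t w\<bar> \<le> 1" using m(2)[OF t, of w] g(2)[OF t, of w] by (simp add: r_def)
  qed
  have YF: "bdd_borel (F t) (Y t)" if t: "t \<in> {1..T}" for t
    using Y(1)[OF t] Y(2)[OF t] by (intro bdd_borelI[of _ _ 1]) (auto simp: abs_le_iff intro: order_trans)
  have up: "bdd_borel (F t) f" if "bdd_borel (F (t - 1)) f" for t f
    using bdd_borel_subalg[OF subalg_le that] by simp
  have eq: "2 * g t w * (Y t w / (m t w + g t w) - l t w) = 2 * (r t w * Y t w) - 2 * (g t w * l t w)" for t w
    by (simp add: r_def algebra_simps)
  show ?thesis unfolding eq
  proof (rule exp_sum_tail_bound[where Y = Y and y = "\<lambda>t w. m t w * l t w" and s = s
        and a = "\<lambda>t w. exp (- (2 * (g t w * l t w)))"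
        and b = "\<lambda>t w. exp (- (2 * (g t w * l t w))) * (exp (2 * r t w) - 1)"])
    fix t assume t: "t \<in> {1..T}"
    show "bdd_borel (F t) (\<lambda>w. 2 * (r t w * Y t w) - 2 * (g t w * l t w))"
      using YF[OF t] up[OF r[OF t]] up[OF g(1)[OF t]] up[OF l(1)[OF t]] by (intro bdd_borel_intros)
    show YM: "bdd_borel M (Y t)" using YF[OF t] bdd_borel_F_M by blast
    show "bdd_borel (F (t - 1)) (\<lambda>w. exp (- (2 * (g t w * l t w))))"
      using g(1)[OF t] l(1)[OF t] by (intro bdd_borel_intros)
    show "bdd_borel (F (t - 1)) (\<lambda>w. exp (- (2 * (g t w * l t w))) * (exp (2 * r t w) - 1))"
      using g(1)[OF t] l(1)[OF t] r[OF t] by (intro bdd_borel_intros)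
    show y: "bdd_borel (F (t - 1)) (\<lambda>w. m t w * l t w)"
      using m(1)[OF t] l(1)[OF t] by (intro bdd_borel_intros)
    show "cond_mean (t - 1) (Y t) (\<lambda>w. m t w * l t w)"
      using YM y mean[OF t] by (rule cond_meanI)
    fix w assume w: "w \<in> space M"
    have convex: "exp (2 * (r t w * Y t w)) \<le> 1 + (exp (2 * r t w) - 1) * Y t w"
    proof (cases "Y t w = 0")
      case False
      then have "Y t w / 1 * (1 - exp (- 1 * (- (2 * r t w)))) \<le> 1 - exp (- Y t w * (- (2 * r t w)))"
        using Y(2)[OF t w] by (intro one_minus_exp_scale) auto
      then show ?thesis by (simp add: algebra_simps)
    qed simp
    have "exp (2 * (r t w * Y t w) - 2 * (g t w * l t w))
        = exp (- (2 * (g t w * l t w))) * exp (2 * (r t w * Y t w))" by (simp flip: exp_add)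
    also have "\<dots> \<le> exp (- (2 * (g t w * l t w))) * (1 + (exp (2 * r t w) - 1) * Y t w)"
      using convex by (intro mult_left_mono) auto
    finally show "exp (2 * (r t w * Y t w) - 2 * (g t w * l t w)) \<le> exp (- (2 * (g t w * l t w)))
        + exp (- (2 * (g t w * l t w))) * (exp (2 * r t w) - 1) * Y t w"
      by (simp only: distrib_left mult_1_right mult.assoc)
    have "m t w * (exp (2 * r t w) - 1) \<le> 2 * g t w"
      using implicit_exploration_exp_bound[OF m(2)[OF t w] g(2)[OF t w]] by (simp add: r_def)
    then have "l t w * (m t w * (exp (2 * r t w) - 1)) \<le> l t w * (2 * g t w)"
      using l(2)[OF t w] by (rule mult_left_mono)
    then have "1 + (exp (2 * r t w) - 1) * (m t w * l t w) \<le> 1 + 2 * (g t w * l t w)"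
      by (simp add: mult_ac)
    also have "\<dots> \<le> exp (2 * (g t w * l t w))" by (rule exp_ge_add_one_self)
    finally have "exp (- (2 * (g t w * l t w))) * (1 + (exp (2 * r t w) - 1) * (m t w * l t w))
        \<le> exp (- (2 * (g t w * l t w))) * exp (2 * (g t w * l t w))" by (intro mult_left_mono) auto
    then show "exp (- (2 * (g t w * l t w)))
        + exp (- (2 * (g t w * l t w))) * (exp (2 * r t w) - 1) * (m t w * l t w) \<le> 1"
      by (simp only: distrib_left mult_1_right mult.assoc flip: exp_add) simp
  qed (rule s)
qed

text \<open>For S in [0, H] the quadratic bound on exp (- \<theta> S), with S^2 \<le> H S, is affine
  in S. Once the mean v \<le> H is inserted, the compensator \<open>k\<close> absorbs the
  second-order term.\<close>

lemma azuma_tail_bound: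
  fixes v S :: "nat \<Rightarrow> 'w \<Rightarrow> real" and H \<theta> c :: real
  assumes v: "\<And>t. t \<in> {1..T} \<Longrightarrow> v t \<in> borel_measurable (F (t - 1))"
      "\<And>t w. t \<in> {1..T} \<Longrightarrow> w \<in> space M \<Longrightarrow> 0 \<le> v t w \<and> v t w \<le> H"
    and S: "\<And>t. t \<in> {1..T} \<Longrightarrow> S t \<in> borel_measurable (F t)"
      "\<And>t w. t \<in> {1..T} \<Longrightarrow> w \<in> space M \<Longrightarrow> 0 \<le> S t w \<and> S t w \<le> H"
    and mean: "\<And>t. t \<in> {1..T} \<Longrightarrow> cond_mean (t - 1) (S t) (v t)"
    and \<theta>: "0 < \<theta>"
  shows "prob {w \<in> space M. c / \<theta> + \<theta> * H\<^sup>2 * real T / 2 \<le> (\<Sum>t=1..T. v t w - S t w)} \<le> exp (- c)"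
proof -
  define k where "k = \<theta>\<^sup>2 * H\<^sup>2 / 2"
  have "{w \<in> space M. c / \<theta> + \<theta> * H\<^sup>2 * real T / 2 \<le> (\<Sum>t=1..T. v t w - S t w)}
      = {w \<in> space M. c \<le> (\<Sum>t=1..T. \<theta> * (v t w - S t w) - k)}"
  proof (intro Collect_cong conj_cong refl)
    fix w
    have "c / \<theta> + \<theta> * H\<^sup>2 * real T / 2 \<le> X \<longleftrightarrow> c \<le> \<theta> * X - real T * k" for X
      using \<theta> by (simp add: k_def field_simps power2_eq_square)
    then show "c / \<theta> + \<theta> * H\<^sup>2 * real T / 2 \<le> (\<Sum>t=1..T. v t w - S t w)
      \<longleftrightarrow> c \<le> (\<Sum>t=1..T. \<theta> * (v t w - S t w) - k)"
      by (simp add: sum_subtractf sum_distrib_left[symmetric] right_diff_distrib[symmetric])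
  qed
  also have "prob \<dots> \<le> exp (- c)"
  proof (rule exp_sum_tail_bound[where Y = S and y = v
        and a = "\<lambda>t w. exp (\<theta> * v t w - k)" and b = "\<lambda>t w. exp (\<theta> * v t w - k) * (\<theta>\<^sup>2 * H / 2 - \<theta>)"])
    fix t assume t: "t \<in> {1..T}"
    show vF: "bdd_borel (F (t - 1)) (v t)"
      using v(1)[OF t] v(2)[OF t] by (intro bdd_borelI[of _ _ H]) (auto simp: abs_le_iff intro: order_trans)
    have vF': "bdd_borel (F t) (v t)" using bdd_borel_subalg[OF subalg_le vF] by simp
    have SF: "bdd_borel (F t) (S t)"
      using S(1)[OF t] S(2)[OF t] by (intro bdd_borelI[of _ _ H]) (auto simp: abs_le_iff intro: order_trans)
    show "bdd_borel M (S t)" using SF bdd_borel_F_M by blast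
    show "bdd_borel (F t) (\<lambda>w. \<theta> * (v t w - S t w) - k)" using vF' SF by (intro bdd_borel_intros)
    show "bdd_borel (F (t - 1)) (\<lambda>w. exp (\<theta> * v t w - k))"
      using vF by (intro bdd_borel_intros)
    then show "bdd_borel (F (t - 1)) (\<lambda>w. exp (\<theta> * v t w - k) * (\<theta>\<^sup>2 * H / 2 - \<theta>))"
      by (intro bdd_borel_mult bdd_borel_const)
    show "cond_mean (t - 1) (S t) (v t)" using mean[OF t] .
    fix w assume w: "w \<in> space M"
    note vb = v(2)[OF t w] and Sb = S(2)[OF t w]
    have "exp (- (\<theta> * S t w)) \<le> 1 - \<theta> * S t w + (\<theta> * S t w)\<^sup>2 / 2"
      using Sb \<theta> by (intro exp_minus_le_quadratic) auto
    also have "(\<theta> * S t w)\<^sup>2 / 2 \<le> \<theta>\<^sup>2 / 2 * (S t w * H)"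
    proof -
      have "\<theta>\<^sup>2 / 2 * (S t w * S t w) \<le> \<theta>\<^sup>2 / 2 * (S t w * H)"
        using Sb by (intro mult_left_mono) auto
      then show ?thesis by (simp add: power2_eq_square mult_ac)
    qed
    finally have "exp (- (\<theta> * S t w)) \<le> 1 + (\<theta>\<^sup>2 * H / 2 - \<theta>) * S t w" by (simp add: algebra_simps)
    then have *: "exp (\<theta> * v t w - k) * exp (- (\<theta> * S t w)) \<le> exp (\<theta> * v t w - k) * (1 + (\<theta>\<^sup>2 * H / 2 - \<theta>) * S t w)"
      by (intro mult_left_mono) auto
    show "exp (\<theta> * (v t w - S t w) - k) \<le> exp (\<theta> * v t w - k)
        + exp (\<theta> * v t w - k) * (\<theta>\<^sup>2 * H / 2 - \<theta>) * S t w"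
    proof -
      have "\<theta> * (v t w - S t w) - k = (\<theta> * v t w - k) + - (\<theta> * S t w)" by (simp add: algebra_simps)
      then show ?thesis using * by (simp only: exp_add distrib_left mult_1_right mult.assoc)
    qed
    have "\<theta>\<^sup>2 / 2 * (v t w * H) \<le> \<theta>\<^sup>2 / 2 * (H * H)" using vb by (intro mult_left_mono mult_right_mono) auto
    then have "1 + (\<theta>\<^sup>2 * H / 2 - \<theta>) * v t w \<le> 1 + (k - \<theta> * v t w)"
      by (simp add: k_def algebra_simps power2_eq_square)
    also have "\<dots> \<le> exp (k - \<theta> * v t w)" by (rule exp_ge_add_one_self)
    finally have "exp (\<theta> * v t w - k) * (1 + (\<theta>\<^sup>2 * H / 2 - \<theta>) * v t w)
        \<le> exp (\<theta> * v t w - k) * exp (k - \<theta> * v t w)" by (intro mult_left_mono) auto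
    then show "exp (\<theta> * v t w - k) + exp (\<theta> * v t w - k) * (\<theta>\<^sup>2 * H / 2 - \<theta>) * v t w \<le> 1"
      by (simp only: distrib_left mult_1_right mult.assoc flip: exp_add) simp
  qed simp
  finally show ?thesis .
qed

end

section \<open>Adaptive-FTRL on one sample path\<close>

locale ftrl_run = efg_tree G for G :: "('x, 'a) efg" +
  fixes mu :: "nat \<Rightarrow> 'w \<Rightarrow> 'x \<Rightarrow> 'a \<Rightarrow> real"
    and Xo :: "nat \<Rightarrow> nat \<Rightarrow> 'w \<Rightarrow> 'x" and Ao :: "nat \<Rightarrow> nat \<Rightarrow> 'w \<Rightarrow> 'a"
    and Ro :: "nat \<Rightarrow> nat \<Rightarrow> 'w \<Rightarrow> real" and w :: 'w and T :: nat and \<eta> \<gamma> :: real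
  assumes \<eta>_pos: "0 < \<eta>" and \<gamma>_ge_1: "1 \<le> \<gamma>"
    and obs: "\<And>t h. t \<in> {1..T} \<Longrightarrow> h \<in> {1..horizon G} \<Longrightarrow>
        Xo t h w \<in> infosets G \<and> level G (Xo t h w) = h \<and> Ao t h w \<in> acts G (Xo t h w)
        \<and> 0 \<le> Ro t h w \<and> Ro t h w \<le> 1
        \<and> (h < horizon G \<longrightarrow> parent G (Xo t (Suc h) w) = Some (Xo t h w, Ao t h w))"
    and ftrl: "\<And>t. t \<in> {1..T} \<Longrightarrow> ftrl_step G \<eta> (uniform_policy G)
          (Ptil G \<gamma> mu Xo Ao (t - 1) w) (Ltil G \<gamma> mu Xo Ao Ro (t - 1) w) (mu t w)"
begin

text \<open>In the notation of the algorithm, \<open>Pt\<close>, \<open>gt\<close>, \<open>mt\<close>, \<open>pt\<close>, \<open>lt\<close> are \<open>P~^t\<close>, \<open>\<gamma>^t\<close>, \<open>\<mu>^t_{1:}\<close>,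
\<open>p~^t\<close>, \<open>l~^t\<close> on the sample path \<open>w\<close>.\<close>

definition Pt :: "nat \<Rightarrow> 'x \<Rightarrow> 'a \<Rightarrow> real" where
  "Pt n = Ptil G \<gamma> mu Xo Ao n w"

definition gt :: "nat \<Rightarrow> 'x \<Rightarrow> 'a \<Rightarrow> real" where
  "gt t x a = \<gamma> / (1 + Pt (t - 1) x a)"

definition mt :: "nat \<Rightarrow> 'x \<Rightarrow> 'a \<Rightarrow> real" where
  "mt t = seqp G (mu t w)"

definition vis :: "nat \<Rightarrow> 'x \<Rightarrow> 'a \<Rightarrow> bool" where
  "vis t x a \<longleftrightarrow> Xo t (level G x) w = x \<and> Ao t (level G x) w = a"

definition pt :: "nat \<Rightarrow> 'x \<Rightarrow> 'a \<Rightarrow> real" where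
  "pt t x a = (if vis t x a then 1 else 0) / (mt t x a + gt t x a)"

definition lt :: "nat \<Rightarrow> 'x \<Rightarrow> 'a \<Rightarrow> real" where
  "lt t x a = (if vis t x a then 1 - Ro t (level G x) w else 0) / (mt t x a + gt t x a)"

section \<open>Elementary bounds on the estimators\<close>

lemma Pt_0: "Pt 0 x a = 0"
  and Pt_Suc: "Pt (Suc n) x a = Pt n x a + pt (Suc n) x a"
  by (auto simp: Pt_def pt_def vis_def gt_def mt_def)

lemma Ltil_Suc: "Ltil G \<gamma> mu Xo Ao Ro (Suc n) w x a = Ltil G \<gamma> mu Xo Ao Ro n w x a + lt (Suc n) x a"
  by (auto simp: Pt_def lt_def vis_def gt_def mt_def)

lemma Pt_sum: "Pt n x a = (\<Sum>t=1..n. pt t x a)"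
  by (induction n) (auto simp: Pt_0 Pt_Suc)

lemma Ltil_sum: "Ltil G \<gamma> mu Xo Ao Ro n w x a = (\<Sum>t=1..n. lt t x a)"
  by (induction n) (auto simp: Ltil_Suc simp del: Ltil.simps(2))

lemma mu_policy: "t \<in> {1..T} \<Longrightarrow> mu t w \<in> policies G"
  using ftrl by (auto simp: ftrl_step_def)

lemma level_range: "x \<in> infosets G \<Longrightarrow> level G x \<in> {1..horizon G}"
  using level_ge_1 level_le_horizon by simp

lemma mt_bounds: 
  assumes "t \<in> {1..T}" "x \<in> infosets G" "a \<in> acts G x"
  shows "0 \<le> mt t x a" "mt t x a \<le> 1"
  using seqp_bounds[OF mu_policy] assms by (auto simp: mt_def)

lemma Pt_nonneg:
  assumes "n \<le> T" and x: "x \<in> infosets G" "a \<in> acts G x"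
  shows "0 \<le> Pt n x a"
  using assms(1)
proof (induction n)
  case (Suc n)
  have "0 \<le> mt (Suc n) x a" using mt_bounds Suc x by simp
  moreover have "0 \<le> gt (Suc n) x a" using Suc \<gamma>_ge_1 by (simp add: gt_def)
  ultimately show ?case using Suc by (simp add: Pt_Suc pt_def)
qed (simp add: Pt_0)

lemma gt_pos:
  assumes "t \<in> {1..T}" and x: "x \<in> infosets G" "a \<in> acts G x"
  shows "0 < gt t x a"
proof -
  have "t - 1 \<le> T" using assms(1) by auto
  from Pt_nonneg[OF this x] show ?thesis using \<gamma>_ge_1 by (simp add: gt_def)
qed

text \<open>The last bound is where \<gamma> \<ge> 1 enters, through p~ \<le> 1 / \<gamma>^t = (1 +
  P~) / \<gamma>; it is the condition for telescoping into a logarithm. The third is the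
  second-order condition of \<open>path_stability\<close>.\<close>

lemma pt_bounds:
  assumes t: "t \<in> {1..T}" and x: "x \<in> infosets G" "a \<in> acts G x"
  shows "0 \<le> pt t x a" "gt t x a * pt t x a \<le> 1" "mt t x a * pt t x a \<le> 1" "pt t x a \<le> 1 + Pt (t - 1) x a"
proof -
  note m = mt_bounds[OF assms] and g = gt_pos[OF assms]
  show "0 \<le> pt t x a" "gt t x a * pt t x a \<le> 1" "mt t x a * pt t x a \<le> 1"
    using m g by (auto simp: pt_def divide_simps)
  have "t - 1 \<le> T" using t by auto
  from Pt_nonneg[OF this x] have P: "0 \<le> Pt (t - 1) x a" .
  have "pt t x a \<le> 1 / gt t x a" using m g by (auto simp: pt_def intro!: divide_left_mono)
  also have "\<dots> = (1 + Pt (t - 1) x a) / \<gamma>" by (simp add: gt_def)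
  also have "\<dots> \<le> (1 + Pt (t - 1) x a) / 1" using P \<gamma>_ge_1 by (intro divide_left_mono) auto
  finally show "pt t x a \<le> 1 + Pt (t - 1) x a" by simp
qed

lemma lt_bounds:
  assumes t: "t \<in> {1..T}" and x: "x \<in> infosets G" "a \<in> acts G x"
  shows "0 \<le> lt t x a" "lt t x a \<le> pt t x a"
proof -
  have "0 < mt t x a + gt t x a" using mt_bounds[OF assms] gt_pos[OF assms] by simp
  then show "0 \<le> lt t x a" "lt t x a \<le> pt t x a"
    using obs[OF t level_range[OF x(1)]] by (auto simp: lt_def pt_def divide_right_mono)
qed

lemma Pt_mono:
  assumes "n \<le> k" "k \<le> T" and x: "x \<in> infosets G" "a \<in> acts G x"
  shows "Pt n x a \<le> Pt k x a"
  unfolding Pt_sum using assms pt_bounds(1)[OF _ x] by (intro sum_mono2) auto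

lemma sum_pt_ratio_le:
  assumes x: "x \<in> infosets G" "a \<in> acts G x"
  shows "(\<Sum>t=1..T. pt t x a / (1 + Pt (t - 1) x a)) \<le> log 2 (1 + Pt T x a)"
proof (rule sum_increment_ratio_le_log)
  fix n assume n: "n < T"
  show "0 \<le> pt (Suc n) x a" "pt (Suc n) x a \<le> 1 + Pt n x a"
    using pt_bounds(1,4)[of "Suc n", OF _ x] n by auto
qed (simp_all add: Pt_0 Pt_Suc)

lemma sum_avg_pt_ratio_le:
  assumes x: "x \<in> infosets G"
  shows "(\<Sum>t=1..T. avg (pt t) x / (1 + avg (Pt (t - 1)) x)) \<le> log 2 (1 + avg (Pt T) x)"
proof (rule sum_increment_ratio_le_log)
  show "avg (Pt 0) x = 0" by (simp add: avg_def Pt_0)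
  fix n assume n: "n < T"
  show "avg (Pt (Suc n)) x = avg (Pt n) x + avg (pt (Suc n)) x"
    by (simp add: avg_def Pt_Suc sum.distrib add_divide_distrib)
  show "0 \<le> avg (pt (Suc n)) x" using n x pt_bounds(1)[of "Suc n"] by (intro avg_nonneg) auto
  have "avg (pt (Suc n)) x \<le> avg (\<lambda>x a. 1 + Pt n x a) x"
    using n x pt_bounds(4)[of "Suc n"] by (intro avg_mono) auto
  also have "\<dots> = 1 + avg (Pt n) x"
    using card_acts_pos[OF x] by (simp add: avg_def sum.distrib field_simps)
  finally show "avg (pt (Suc n)) x \<le> 1 + avg (Pt n) x" .
qed

lemma sum_path_obs:
  fixes f :: "'x \<Rightarrow> 'a \<Rightarrow> real"
  assumes t: "t \<in> {1..T}"
  shows "(\<Sum>x\<in>infosets G. \<Sum>a\<in>acts G x. if vis t x a then f x a else 0)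
    = (\<Sum>h=1..horizon G. f (Xo t h w) (Ao t h w))"
  unfolding vis_def
  by (rule sum_path[where X = "\<lambda>h. Xo t h w" and A = "\<lambda>h. Ao t h w"]) (use obs[OF t] in auto)

text \<open>\<open>path_stability\<close> with the played policy as base. The rate is then relaxed
  from the minimum over descendants to the information set itself, and the loss estimate to
  \<open>pt\<close>. Since \<open>pt\<close> vanishes off the path, the path sum becomes a sum over
  the tree, which can be summed over episodes at fixed x.\<close>

lemma episode_stability:
  assumes n: "n < T" and \<mu>: "\<mu> \<in> policies G"
  shows "inner_seq G (mu (Suc n) w) (lt (Suc n)) - real (horizon G) *
      (\<Sum>x\<in>infosets G. \<Sum>a\<in>acts G x. \<eta> / (1 + avg (Pt n) x) * pt (Suc n) x a)
    \<le> inner_seq G \<mu> (lt (Suc n)) + dil_div G (eta_t G \<eta> (Pt n)) \<mu> (mu (Suc n) w)"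
proof -
  let ?t = "Suc n" and ?e = "eta_t G \<eta> (Pt n)"
  let ?X = "\<lambda>h. Xo (Suc n) h w" and ?A = "\<lambda>h. Ao (Suc n) h w"
  have t: "?t \<in> {1..T}" using n by simp
  note o = obs[OF t]
  have epos: "0 < ?e x" if "x \<in> infosets G" for x
    using that \<eta>_pos Pt_nonneg n by (intro eta_t_pos) auto
  define c where "c h = lt ?t (?X h) (?A h)" for h
  have cb: "0 \<le> c h" "mt ?t (?X h) (?A h) * c h \<le> 1" "c h \<le> pt ?t (?X h) (?A h)" if "h \<in> {1..horizon G}" for h
  proof -
    note x = o[OF that]
    show "0 \<le> c h" "c h \<le> pt ?t (?X h) (?A h)" using lt_bounds[OF t] x by (auto simp: c_def)
    then have "mt ?t (?X h) (?A h) * c h \<le> mt ?t (?X h) (?A h) * pt ?t (?X h) (?A h)"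
      using mt_bounds(1)[OF t] x by (intro mult_left_mono) auto
    then show "mt ?t (?X h) (?A h) * c h \<le> 1" using pt_bounds(3)[OF t] x by (auto intro: order_trans)
  qed
  have min: "inner_seq G (mu ?t w) (Ltil G \<gamma> mu Xo Ao Ro n w) + dil_div G ?e (mu ?t w) (uniform_policy G)
      \<le> inner_seq G \<mu>' (Ltil G \<gamma> mu Xo Ao Ro n w) + dil_div G ?e \<mu>' (uniform_policy G)"
    if "\<mu>' \<in> policies G" for \<mu>'
    using ftrl[OF t] that by (simp add: ftrl_step_def Pt_def)
  have pos: "0 < mu ?t w x a" if "x \<in> infosets G" "a \<in> acts G x" for x a
    by (rule ftrl_minimizer(1)[where \<eta> = ?e and b = "uniform_policy G", OF mu_policy[OF t] min uniform_policy_pos epos that])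
  have "inner_seq G (mu ?t w) (lt ?t) - real (horizon G) * (\<Sum>h=1..horizon G. ?e (?X h) * c h)
    \<le> inner_seq G \<mu> (lt ?t) + dil_div G ?e \<mu> (mu ?t w)"
  proof (rule path_stability[where X = ?X and A = ?A])
    show "?X h \<in> infosets G \<and> level G (?X h) = h \<and> ?A h \<in> acts G (?X h)
        \<and> (h < horizon G \<longrightarrow> parent G (?X (Suc h)) = Some (?X h, ?A h))" if "h \<in> {1..horizon G}" for h
      using o[OF that] by simp
    show "mu ?t w \<in> policies G" using mu_policy[OF t] .
    show "?e (?X h) \<le> ?e (?X (Suc h))" if "h \<in> {1..<horizon G}" for h
      using that o[of h] o[of "Suc h"] by (intro eta_t_child_ge[of _ _ "?A h"]) auto
    show "seqp G (mu ?t w) (?X h) (?A h) * c h \<le> 1" if "h \<in> {1..horizon G}" for h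
      using cb(2)[OF that] by (simp add: mt_def)
    show "lt ?t x a = (if ?X (level G x) = x \<and> ?A (level G x) = a then c (level G x) else 0)" for x a
      by (auto simp: c_def lt_def vis_def)
  qed (use pos epos cb \<mu> in auto)
  moreover have "(\<Sum>h=1..horizon G. ?e (?X h) * c h)
      \<le> (\<Sum>h=1..horizon G. \<eta> / (1 + avg (Pt n) (?X h)) * pt ?t (?X h) (?A h))"
  proof (intro sum_mono mult_mono)
    fix h assume h: "h \<in> {1..horizon G}"
    note x = o[OF h]
    show "?e (?X h) \<le> \<eta> / (1 + avg (Pt n) (?X h))"
      using x by (intro eta_t_le) (auto simp: is_desc_def)
    then show "0 \<le> \<eta> / (1 + avg (Pt n) (?X h))" using epos[of "?X h"] x by simp
  qed (use cb in auto)
  moreover have "(\<Sum>h=1..horizon G. \<eta> / (1 + avg (Pt n) (?X h)) * pt ?t (?X h) (?A h))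
      = (\<Sum>x\<in>infosets G. \<Sum>a\<in>acts G x. \<eta> / (1 + avg (Pt n) x) * pt ?t x a)"
    by (subst sum_path_obs[OF t, of "\<lambda>x a. \<eta> / (1 + avg (Pt n) x) * pt ?t x a", symmetric])
      (auto simp: pt_def intro!: sum.cong)
  ultimately show ?thesis
    by (smt (verit) mult_left_mono of_nat_0_le_iff)
qed

text \<open>Summing \<open>pt\<close> over the actions of \<open>x\<close> gives the number of
  actions times the average, which matches the average in the denominator of the rate. The
  logarithmic bound thus applies to averages, weighted by the numbers of actions.\<close>

lemma estimated_regret:
  assumes \<mu>: "\<mu> \<in> policies G"
  shows "(\<Sum>t=1..T. inner_seq G (mu t w) (lt t)) - inner_seq G \<mu> (Ltil G \<gamma> mu Xo Ao Ro T w)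
    \<le> dil_div G (eta_t G \<eta> (Pt T)) \<mu> (uniform_policy G)
      + real (horizon G) * \<eta> * (\<Sum>x\<in>infosets G. real (card (acts G x)) * log 2 (1 + avg (Pt T) x))"
proof -
  define B where "B t = real (horizon G) *
      (\<Sum>x\<in>infosets G. \<Sum>a\<in>acts G x. \<eta> / (1 + avg (Pt (t - 1)) x) * pt t x a)" for t
  have "(\<Sum>t=1..T. inner_seq G (mu t w) (lt t)) - inner_seq G \<mu> (Ltil G \<gamma> mu Xo Ao Ro T w)
    \<le> dil_div G (eta_t G \<eta> (Pt T)) \<mu> (uniform_policy G) + (\<Sum>t=1..T. B t)"
  proof (rule ftrl_regret[where m = "\<lambda>t. mu t w" and l = lt and L = "\<lambda>n. Ltil G \<gamma> mu Xo Ao Ro n w"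
        and \<eta> = "\<lambda>n. eta_t G \<eta> (Pt n)" and b = "uniform_policy G" and B = B])
    show "0 < eta_t G \<eta> (Pt n) x" if "n \<le> T" "x \<in> infosets G" for n x
      using that \<eta>_pos Pt_nonneg by (intro eta_t_pos) auto
    show "eta_t G \<eta> (Pt (Suc n)) x \<le> eta_t G \<eta> (Pt n) x" if "n < T" "x \<in> infosets G" for n x
      using that \<eta>_pos Pt_nonneg Pt_mono[of n "Suc n"] by (intro eta_t_antimono) auto
    show "mu (Suc n) w \<in> policies G" if "n < T" for n using that mu_policy by simp
    show "inner_seq G (mu (Suc n) w) (Ltil G \<gamma> mu Xo Ao Ro n w) + dil_div G (eta_t G \<eta> (Pt n)) (mu (Suc n) w) (uniform_policy G)
      \<le> inner_seq G \<mu>' (Ltil G \<gamma> mu Xo Ao Ro n w) + dil_div G (eta_t G \<eta> (Pt n)) \<mu>' (uniform_policy G)"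
      if "n < T" "\<mu>' \<in> policies G" for n \<mu>'
      using ftrl[of "Suc n"] that by (simp add: ftrl_step_def Pt_def)
    show "inner_seq G (mu (Suc n) w) (lt (Suc n)) - B (Suc n)
      \<le> inner_seq G \<mu>' (lt (Suc n)) + dil_div G (eta_t G \<eta> (Pt n)) \<mu>' (mu (Suc n) w)"
      if "n < T" "\<mu>' \<in> policies G" for n \<mu>'
      using episode_stability[OF that] by (simp add: B_def)
  qed (use \<mu> uniform_policy_policies uniform_policy_pos Ltil_Suc in auto)
  also have "(\<Sum>t=1..T. B t) = real (horizon G) * \<eta> * (\<Sum>x\<in>infosets G. real (card (acts G x)) *
      (\<Sum>t=1..T. avg (pt t) x / (1 + avg (Pt (t - 1)) x)))"
  proof -
    have "B t = real (horizon G) * \<eta> * (\<Sum>x\<in>infosets G. real (card (acts G x)) *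
        (avg (pt t) x / (1 + avg (Pt (t - 1)) x)))" for t
      unfolding B_def mult.assoc sum_distrib_left[of \<eta>]
    proof (intro arg_cong2[where f = "(*)"] sum.cong refl)
      fix x assume x: "x \<in> infosets G"
      have "real (card (acts G x)) * avg (pt t) x = (\<Sum>a\<in>acts G x. pt t x a)"
        using card_acts_pos[OF x] by (simp add: avg_def)
      then show "(\<Sum>a\<in>acts G x. \<eta> / (1 + avg (Pt (t - 1)) x) * pt t x a)
          = \<eta> * (real (card (acts G x)) * (avg (pt t) x / (1 + avg (Pt (t - 1)) x)))"
        unfolding sum_distrib_left[symmetric] by simp
    qed
    then have "(\<Sum>t=1..T. B t) = real (horizon G) * \<eta> * (\<Sum>t=1..T. \<Sum>x\<in>infosets G. real (card (acts G x)) *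
        (avg (pt t) x / (1 + avg (Pt (t - 1)) x)))"
      by (simp add: sum_distrib_left)
    then show ?thesis by (subst (asm) sum.swap) (simp add: sum_distrib_left)
  qed
  also have "\<dots> \<le> real (horizon G) * \<eta> * (\<Sum>x\<in>infosets G. real (card (acts G x)) * log 2 (1 + avg (Pt T) x))"
    using \<eta>_pos sum_avg_pt_ratio_le by (intro mult_left_mono sum_mono) auto
  finally show ?thesis by simp
qed

text \<open>Since (m + g) l~ is the observed loss, or 0 at pairs not visited, the realized minus the
  estimated loss is exactly g l~ \<le> g p~ = \<gamma> p~ / (1 + P~).\<close>

lemma exploration_bias:
  "(\<Sum>t=1..T. (\<Sum>h=1..horizon G. 1 - Ro t h w) - inner_seq G (mu t w) (lt t))
    \<le> \<gamma> * (\<Sum>x\<in>infosets G. \<Sum>a\<in>acts G x. log 2 (1 + Pt T x a))"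
proof -
  have "(\<Sum>h=1..horizon G. 1 - Ro t h w) - inner_seq G (mu t w) (lt t)
      \<le> (\<Sum>x\<in>infosets G. \<Sum>a\<in>acts G x. \<gamma> * (pt t x a / (1 + Pt (t - 1) x a)))" if t: "t \<in> {1..T}" for t
  proof -
    have "(\<Sum>h=1..horizon G. 1 - Ro t h w) = (\<Sum>h=1..horizon G. 1 - Ro t (level G (Xo t h w)) w)"
      using obs[OF t] by (intro sum.cong) auto
    also have "\<dots> = (\<Sum>x\<in>infosets G. \<Sum>a\<in>acts G x. if vis t x a then 1 - Ro t (level G x) w else 0)"
      by (rule sum_path_obs[OF t, symmetric])
    finally have "(\<Sum>h=1..horizon G. 1 - Ro t h w) - inner_seq G (mu t w) (lt t)
        = (\<Sum>x\<in>infosets G. \<Sum>a\<in>acts G x. (if vis t x a then 1 - Ro t (level G x) w else 0) - mt t x a * lt t x a)"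
      by (simp add: inner_seq_def sum_subtractf mt_def)
    also have "\<dots> \<le> (\<Sum>x\<in>infosets G. \<Sum>a\<in>acts G x. \<gamma> * (pt t x a / (1 + Pt (t - 1) x a)))"
    proof (intro sum_mono)
      fix x a assume x: "x \<in> infosets G" "a \<in> acts G x"
      have pos: "0 < mt t x a + gt t x a" using mt_bounds[OF t x] gt_pos[OF t x] by simp
      have "(if vis t x a then 1 - Ro t (level G x) w else 0) - mt t x a * lt t x a = gt t x a * lt t x a"
        using pos by (simp add: lt_def field_simps)
      also have "\<dots> \<le> gt t x a * pt t x a"
        using lt_bounds[OF t x] gt_pos[OF t x] by (intro mult_left_mono) auto
      finally show "(if vis t x a then 1 - Ro t (level G x) w else 0) - mt t x a * lt t x a
          \<le> \<gamma> * (pt t x a / (1 + Pt (t - 1) x a))" by (simp add: gt_def)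
    qed
    finally show ?thesis .
  qed
  then have "(\<Sum>t=1..T. (\<Sum>h=1..horizon G. 1 - Ro t h w) - inner_seq G (mu t w) (lt t))
      \<le> (\<Sum>t=1..T. \<Sum>x\<in>infosets G. \<Sum>a\<in>acts G x. \<gamma> * (pt t x a / (1 + Pt (t - 1) x a)))"
    by (rule sum_mono)
  also have "\<dots> = (\<Sum>x\<in>infosets G. \<Sum>t=1..T. \<Sum>a\<in>acts G x. \<gamma> * (pt t x a / (1 + Pt (t - 1) x a)))"
    by (rule sum.swap)
  also have "\<dots> = (\<Sum>x\<in>infosets G. \<Sum>a\<in>acts G x. \<Sum>t=1..T. \<gamma> * (pt t x a / (1 + Pt (t - 1) x a)))"
    by (intro sum.cong refl sum.swap)
  also have "\<dots> = \<gamma> * (\<Sum>x\<in>infosets G. \<Sum>a\<in>acts G x. \<Sum>t=1..T. pt t x a / (1 + Pt (t - 1) x a))"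
    by (simp add: sum_distrib_left)
  also have "\<dots> \<le> \<gamma> * (\<Sum>x\<in>infosets G. \<Sum>a\<in>acts G x. log 2 (1 + Pt T x a))"
    using \<gamma>_ge_1 sum_pt_ratio_le by (intro mult_left_mono sum_mono) auto
  finally show ?thesis .
qed


text \<open>The deterministic half: the favourable event enters as \<open>reach\<close>,
  \<open>losses\<close> and \<open>realized\<close>. The first two hold for each pair (x, a), so
  weighting by \<open>seqp G \<mu>\<close> covers every comparator at once, without a union over
  policies.\<close>

lemma regret_bound:
  fixes P :: "'nu \<Rightarrow> 'x \<Rightarrow> real" and Rw :: "'nu \<Rightarrow> 'x \<Rightarrow> 'a \<Rightarrow> real" and nu :: "nat \<Rightarrow> 'nu"
    and \<iota> lam q :: real
  defines "A \<equiv> real (A_X G)" and "H \<equiv> real (horizon G)"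
  assumes opp: "valid_opponents G P Rw"
    and T: "1 \<le> T" and \<iota>: "1 \<le> \<iota>" "ln A \<le> \<iota>" and lam: "lam = 1 + log 2 (1 + real T)"
    and q: "0 < q" "\<iota> * real T = lam * A * q\<^sup>2" and \<eta>: "\<eta> = 2 * q" and \<gamma>: "\<gamma> = sqrt (2 * H) * q"
    and large: "36 * \<iota> * lam * A \<le> real T"
    and reach: "\<And>s x a. s \<in> {1..T} \<Longrightarrow> x \<in> infosets G \<Longrightarrow> a \<in> acts G x \<Longrightarrow>
      (\<Sum>t=s..T. 2 * gt t x a * (pt t x a - P (nu t) x)) \<le> \<iota>"
    and losses: "\<And>s x a. s \<in> {1..T} \<Longrightarrow> x \<in> infosets G \<Longrightarrow> a \<in> acts G x \<Longrightarrow>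
      (\<Sum>t=s..T. 2 * gt t x a * (lt t x a - loss P Rw (nu t) x a)) \<le> \<iota>"
    and realized: "(\<Sum>t=1..T. inner_seq G (mu t w) (loss P Rw (nu t)) - (\<Sum>h=1..horizon G. 1 - Ro t h w))
      \<le> H * (lam * A * q)"
    and \<mu>: "\<mu> \<in> policies G"
  shows "(\<Sum>t=1..T. inner_seq G (mu t w) (loss P Rw (nu t)) - inner_seq G \<mu> (loss P Rw (nu t)))
    \<le> 6 * H * (lam * A * q)"
proof -
  define S where "S = lam * A * q"
  have A1: "1 \<le> A" using A_X_pos[OF opp] by (simp add: A_def)
  have H1: "1 \<le> H" using horizon_ge_1 by (simp add: H_def)
  have "log 2 2 \<le> log 2 (1 + real T)" using T by (intro log_mono) auto
  then have lam2: "2 \<le> lam" by (simp add: lam)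
  have S0: "0 \<le> S" using A1 lam2 q by (simp add: S_def)
  have HS: "0 \<le> H * S" using H1 S0 by simp
  have "6 * \<iota> \<le> q"
  proof (rule power2_le_imp_le)
    have "lam * A * (6 * \<iota>)\<^sup>2 = \<iota> * (36 * \<iota> * lam * A)" by (simp add: power2_eq_square)
    also have "\<dots> \<le> \<iota> * real T" using large \<iota> by (intro mult_left_mono) auto
    also have "\<dots> = lam * A * q\<^sup>2" by (rule q)
    finally show "(6 * \<iota>)\<^sup>2 \<le> q\<^sup>2" using lam2 A1 by simp
  qed (use q in simp)
  \<comment> \<open>1.4^2 \<le> 2 \<le> 1.42^2, and H \<le> H^2 for the upper bound.\<close>
  have sqrt2H: "1.4 \<le> sqrt (2 * H)" "sqrt (2 * H) \<le> 1.42 * H"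
  proof -
    show "1.4 \<le> sqrt (2 * H)" using H1 by (intro real_le_rsqrt) (auto simp: power2_eq_square)
    have "2 * H \<le> 2 * H * H" using H1 by simp
    then show "sqrt (2 * H) \<le> 1.42 * H" using H1 by (intro real_le_lsqrt) (auto simp: power2_eq_square)
  qed
  have "1.4 * (6 * \<iota>) \<le> \<gamma>" unfolding \<gamma> using sqrt2H \<open>6 * \<iota> \<le> q\<close> \<iota> by (intro mult_mono) auto
  then have \<gamma>8: "8 * \<iota> \<le> \<gamma>" using \<iota> by simp
  \<comment> \<open>The final weight 2 \<gamma>^T = 2 \<gamma> / (1 + P~^{T-1}) turns \<iota> into
    \<kappa> (1 + P~^{T-1}). The bound 1/16 comes from \<gamma> \<ge> 8 \<iota>.\<close>
  define \<kappa> where "\<kappa> = \<iota> / (2 * \<gamma>)"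
  have \<kappa>: "0 \<le> \<kappa>" "\<kappa> \<le> 1 / 16" using \<gamma>8 \<iota> \<gamma>_ge_1 by (auto simp: \<kappa>_def field_simps)
  define PT where "PT x = (\<Sum>t=1..T. P (nu t) x)" for x
  have PT0: "0 \<le> PT x" if "x \<in> infosets G" for x
    unfolding PT_def using reach_nonneg[OF opp that] by (intro sum_nonneg) auto
  have PT_le: "PT x \<le> real T" if "x \<in> infosets G" for x
  proof -
    have "PT x \<le> (\<Sum>t=1..T. 1)" unfolding PT_def using reach_le_1[OF opp that] by (intro sum_mono) auto
    then show ?thesis by simp
  qed
  have gt_decr: "gt (Suc t) x a \<le> gt t x a" if "t \<in> {1..<T}" "x \<in> infosets G" "a \<in> acts G x" for t x a
  proof -
    have t: "t - 1 \<le> T" "t - 1 \<le> t" "t \<le> T" using that(1) by auto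
    have "0 \<le> Pt (t - 1) x a" "Pt (t - 1) x a \<le> Pt t x a"
      using Pt_nonneg[OF t(1) that(2,3)] Pt_mono[OF t(2,3) that(2,3)] by auto
    then show ?thesis unfolding gt_def using \<gamma>_ge_1 by (intro divide_left_mono mult_pos_pos) auto
  qed
  have tails: "(\<Sum>t=1..T. D t) \<le> \<kappa> * (1 + Pt T x a)"
    if x: "x \<in> infosets G" "a \<in> acts G x"
      and D: "\<And>s. s \<in> {1..T} \<Longrightarrow> (\<Sum>t=s..T. 2 * gt t x a * D t) \<le> \<iota>" for x a and D :: "nat \<Rightarrow> real"
  proof -
    have "(\<Sum>t=1..T. D t) \<le> \<iota> / (2 * gt T x a)"
      by (rule sum_le_of_weighted_tails[where g = "\<lambda>t. 2 * gt t x a"]) (use gt_pos gt_decr x D T in auto)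
    also have "\<dots> = \<kappa> * (1 + Pt (T - 1) x a)" by (simp add: gt_def \<kappa>_def)
    also have "\<dots> \<le> \<kappa> * (1 + Pt T x a)" using Pt_mono[of "T - 1" T x a] x \<kappa> by (intro mult_left_mono) auto
    finally show ?thesis .
  qed
  \<comment> \<open>The deviation bound has \<open>Pt T\<close> on its right-hand side too; with
    \<kappa> \<le> 1/16 it is moved to the left, whence 16/15.\<close>
  have Pt_le: "1 + Pt T x a \<le> 16 / 15 * (1 + PT x)" if x: "x \<in> infosets G" "a \<in> acts G x" for x a
  proof -
    have "(\<Sum>t=1..T. pt t x a - P (nu t) x) \<le> \<kappa> * (1 + Pt T x a)"
      by (rule tails[OF x]) (use reach x in auto)
    then have "Pt T x a - PT x \<le> \<kappa> * (1 + Pt T x a)" by (simp add: Pt_sum PT_def sum_subtractf)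
    also have "\<dots> \<le> 1 / 16 * (1 + Pt T x a)" using \<kappa> Pt_nonneg[of T x a] x by (intro mult_right_mono) auto
    finally show ?thesis by simp
  qed
  \<comment> \<open>The factor 16/15 is rounded up to 2, and log_2 2 is the summand 1 of
    \<open>lam\<close>.\<close>
  have log_le: "log 2 z \<le> lam" if "0 < z" "z \<le> 16 / 15 * (1 + PT x)" "x \<in> infosets G" for z x
  proof -
    have "z \<le> 2 * (1 + real T)" using that PT_le[of x] by simp
    then have "log 2 z \<le> log 2 (2 * (1 + real T))" using that by (intro log_mono) auto
    also have "\<dots> = log 2 2 + log 2 (1 + real T)" by (rule log_mult_pos) auto
    also have "\<dots> = lam" by (simp add: lam)
    finally show ?thesis .
  qed
  have avg_le': "1 + avg (Pt T) x \<le> 16 / 15 * (1 + PT x)" if x: "x \<in> infosets G" for x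
  proof -
    have "avg (Pt T) x \<le> 16 / 15 * (1 + PT x) - 1"
    proof (rule avg_le[OF x])
      fix a assume "a \<in> acts G x"
      then show "Pt T x a \<le> 16 / 15 * (1 + PT x) - 1" using Pt_le[OF x, of a] by linarith
    qed
    then show ?thesis by linarith
  qed
  define N where "N = (\<Sum>x\<in>infosets G. \<Sum>a\<in>acts G x. seqp G \<mu> x a * (1 + PT x))"
  \<comment> \<open>The 1 in \<open>1 + PT x\<close> costs at most A, as \<open>seqp\<close> is at
    most 1; and A \<le> T / 72 by \<open>large\<close> with \<iota> \<ge> 1 and lam \<ge> 2.\<close>
  have N: "N \<le> 73 / 72 * (H * real T)"
  proof -
    have "N = (\<Sum>x\<in>infosets G. \<Sum>a\<in>acts G x. seqp G \<mu> x a)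
        + (\<Sum>x\<in>infosets G. \<Sum>a\<in>acts G x. \<Sum>t=1..T. seqp G \<mu> x a * P (nu t) x)"
      by (simp add: N_def PT_def distrib_left sum.distrib sum_distrib_left)
    also have "(\<Sum>x\<in>infosets G. \<Sum>a\<in>acts G x. \<Sum>t=1..T. seqp G \<mu> x a * P (nu t) x)
        = (\<Sum>x\<in>infosets G. \<Sum>t=1..T. \<Sum>a\<in>acts G x. seqp G \<mu> x a * P (nu t) x)"
      by (intro sum.cong refl sum.swap)
    also have "\<dots> = (\<Sum>t=1..T. \<Sum>x\<in>infosets G. \<Sum>a\<in>acts G x. seqp G \<mu> x a * P (nu t) x)"
      by (rule sum.swap)
    also have "\<dots> = H * real T" by (simp add: sum_seqp_reach[OF opp \<mu>] H_def)
    finally have N_eq: "N = (\<Sum>x\<in>infosets G. \<Sum>a\<in>acts G x. seqp G \<mu> x a) + H * real T" .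
    have "(\<Sum>x\<in>infosets G. \<Sum>a\<in>acts G x. seqp G \<mu> x a) \<le> (\<Sum>x\<in>infosets G. \<Sum>a\<in>acts G x. 1)"
      using seqp_bounds[OF \<mu>] by (intro sum_mono) auto
    also have "\<dots> = A" by (simp add: A_def A_X_def)
    finally have "N \<le> A + H * real T" using N_eq by simp
    moreover have "36 * 1 * 2 * A \<le> 36 * \<iota> * lam * A" using \<iota> lam2 A1 by (intro mult_mono) auto
    moreover have "1 * real T \<le> H * real T" using H1 by (intro mult_right_mono) auto
    ultimately show ?thesis using large by linarith
  qed
  have bias: "(\<Sum>t=1..T. inner_seq G \<mu> (lt t) - inner_seq G \<mu> (loss P Rw (nu t))) \<le> 0.4 * (H * S)"
  proof -
    have "(\<Sum>t=1..T. inner_seq G \<mu> (lt t) - inner_seq G \<mu> (loss P Rw (nu t)))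
        = (\<Sum>t=1..T. \<Sum>x\<in>infosets G. \<Sum>a\<in>acts G x. seqp G \<mu> x a * (lt t x a - loss P Rw (nu t) x a))"
      by (simp add: inner_seq_def right_diff_distrib sum_subtractf)
    also have "\<dots> = (\<Sum>x\<in>infosets G. \<Sum>t=1..T. \<Sum>a\<in>acts G x. seqp G \<mu> x a * (lt t x a - loss P Rw (nu t) x a))"
      by (rule sum.swap)
    also have "\<dots> = (\<Sum>x\<in>infosets G. \<Sum>a\<in>acts G x. \<Sum>t=1..T. seqp G \<mu> x a * (lt t x a - loss P Rw (nu t) x a))"
      by (intro sum.cong refl sum.swap)
    also have "\<dots> \<le> (\<Sum>x\<in>infosets G. \<Sum>a\<in>acts G x. \<kappa> * (16 / 15) * (seqp G \<mu> x a * (1 + PT x)))"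
    proof (intro sum_mono)
      fix x a assume x: "x \<in> infosets G" "a \<in> acts G x"
      have "(\<Sum>t=1..T. lt t x a - loss P Rw (nu t) x a) \<le> \<kappa> * (1 + Pt T x a)"
        by (rule tails[OF x]) (use losses x in auto)
      also have "\<dots> \<le> \<kappa> * (16 / 15 * (1 + PT x))" using Pt_le[OF x] \<kappa> by (intro mult_left_mono) auto
      finally have "seqp G \<mu> x a * (\<Sum>t=1..T. lt t x a - loss P Rw (nu t) x a)
          \<le> seqp G \<mu> x a * (\<kappa> * (16 / 15 * (1 + PT x)))"
        using seqp_bounds[OF \<mu> x] by (intro mult_left_mono) auto
      then show "(\<Sum>t=1..T. seqp G \<mu> x a * (lt t x a - loss P Rw (nu t) x a))
          \<le> \<kappa> * (16 / 15) * (seqp G \<mu> x a * (1 + PT x))"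
        by (simp only: sum_distrib_left mult_ac)
    qed
    also have "\<dots> = \<kappa> * (16 / 15) * N" by (simp add: N_def sum_distrib_left)
    also have "\<dots> \<le> \<kappa> * (16 / 15) * (73 / 72 * (H * real T))" using N \<kappa> by (intro mult_left_mono) auto
    also have "\<dots> = (16 / 15 * (73 / 72) / 2) * (H * (\<iota> * real T / \<gamma>))" by (simp add: \<kappa>_def)
    \<comment> \<open>With \<iota> T = lam A q^2, one factor q cancels against \<gamma> = sqrt(2H)
      q; the root is then weakened to 1.4.\<close>
    also have "\<iota> * real T / \<gamma> = S / sqrt (2 * H)"
      unfolding q(2) \<gamma> S_def using q(1) by (simp add: power2_eq_square)
    also have "(16 / 15 * (73 / 72) / 2) * (H * (S / sqrt (2 * H))) \<le> (16 / 15 * (73 / 72) / 2) * (H * (S / 1.4))"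
      using H1 S0 sqrt2H by (intro mult_left_mono divide_left_mono) auto
    also have "\<dots> \<le> 0.4 * (H * S)" using HS by simp
    finally show ?thesis .
  qed
  have penalty: "dil_div G (eta_t G \<eta> (Pt T)) \<mu> (uniform_policy G) \<le> 0.55 * (H * S)"
  proof -
    have epos: "0 < eta_t G \<eta> (Pt T) x" if "x \<in> infosets G" for x
      using that \<eta>_pos Pt_nonneg by (intro eta_t_pos) auto
    have "dil_div G (eta_t G \<eta> (Pt T)) \<mu> (uniform_policy G)
        \<le> (\<Sum>x\<in>infosets G. pseq G \<mu> x / eta_t G \<eta> (Pt T) x * ln (real (card (acts G x))))"
      using epos by (rule dil_div_uniform_le[OF \<mu>])
    also have "\<dots> \<le> (\<Sum>x\<in>infosets G. 16 / 15 * \<iota> / \<eta> * (pseq G \<mu> x * (1 + PT x)))"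
    proof (intro sum_mono)
      fix x assume x: "x \<in> infosets G"
      have "1 / eta_t G \<eta> (Pt T) x \<le> 16 / 15 * (1 + PT x) / \<eta>"
      proof (rule inverse_eta_t_le[OF x \<eta>_pos])
        fix x' assume x': "x' \<in> infosets G" "is_desc G x' x"
        \<comment> \<open>Reach probabilities do not grow down the tree, so the descendant attaining
          the minimum is charged to \<open>x\<close> itself.\<close>
        have "PT x' \<le> PT x" unfolding PT_def using reach_desc_le[OF opp x'] by (intro sum_mono) auto
        then show "1 + avg (Pt T) x' \<le> 16 / 15 * (1 + PT x)" using avg_le'[OF x'(1)] by simp
      qed
      moreover have c: "1 \<le> real (card (acts G x))" using card_acts_pos[OF x] by simp
      moreover have "ln (real (card (acts G x))) \<le> \<iota>"
      proof -
        have "ln (real (card (acts G x))) \<le> ln A" using c card_acts_le_A_X[OF x] by (simp add: A_def)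
        then show ?thesis using \<iota> by simp
      qed
      ultimately have "1 / eta_t G \<eta> (Pt T) x * ln (real (card (acts G x))) \<le> 16 / 15 * (1 + PT x) / \<eta> * \<iota>"
        using PT0[OF x] \<eta>_pos by (intro mult_mono) auto
      then have "pseq G \<mu> x * (1 / eta_t G \<eta> (Pt T) x * ln (real (card (acts G x))))
          \<le> pseq G \<mu> x * (16 / 15 * (1 + PT x) / \<eta> * \<iota>)"
        using pseq_bounds[OF \<mu> x] by (intro mult_left_mono) auto
      then show "pseq G \<mu> x / eta_t G \<eta> (Pt T) x * ln (real (card (acts G x)))
          \<le> 16 / 15 * \<iota> / \<eta> * (pseq G \<mu> x * (1 + PT x))"
        by (simp only: divide_inverse mult_1_left mult_ac)
    qed
    also have "\<dots> = 16 / 15 * \<iota> / \<eta> * N"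
      unfolding N_def sum_distrib_left[symmetric]
      by (intro arg_cong2[where f = "(*)"] sum.cong refl) (simp add: sum_seqp[OF \<mu>] flip: sum_distrib_right)
    also have "\<dots> \<le> 16 / 15 * \<iota> / \<eta> * (73 / 72 * (H * real T))"
      using N \<iota> \<eta>_pos by (intro mult_left_mono) auto
    also have "\<dots> = (16 / 15 * (73 / 72)) * (H * (\<iota> * real T / \<eta>))" by simp
    also have "\<iota> * real T / \<eta> = S / 2" unfolding q(2) \<eta> S_def using q(1) by (simp add: power2_eq_square)
    also have "(16 / 15 * (73 / 72)) * (H * (S / 2)) \<le> 0.55 * (H * S)" using HS by simp
    finally show ?thesis .
  qed
  have stability: "H * \<eta> * (\<Sum>x\<in>infosets G. real (card (acts G x)) * log 2 (1 + avg (Pt T) x)) \<le> 2 * (H * S)"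
  proof -
    have "(\<Sum>x\<in>infosets G. real (card (acts G x)) * log 2 (1 + avg (Pt T) x))
        \<le> (\<Sum>x\<in>infosets G. real (card (acts G x)) * lam)"
    proof (intro sum_mono mult_left_mono)
      fix x assume x: "x \<in> infosets G"
      have "0 \<le> avg (Pt T) x" using x Pt_nonneg by (intro avg_nonneg) auto
      then show "log 2 (1 + avg (Pt T) x) \<le> lam" using avg_le'[OF x] x by (intro log_le) auto
    qed auto
    also have "\<dots> = lam * A" by (simp add: A_def A_X_def sum_distrib_left mult.commute)
    finally have "H * \<eta> * (\<Sum>x\<in>infosets G. real (card (acts G x)) * log 2 (1 + avg (Pt T) x)) \<le> H * \<eta> * (lam * A)"
      using H1 \<eta>_pos by (intro mult_left_mono) auto
    also have "\<dots> = 2 * (H * S)" by (simp add: \<eta> S_def)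
    finally show ?thesis .
  qed
  have exploration: "\<gamma> * (\<Sum>x\<in>infosets G. \<Sum>a\<in>acts G x. log 2 (1 + Pt T x a)) \<le> 1.42 * (H * S)"
  proof -
    have "(\<Sum>x\<in>infosets G. \<Sum>a\<in>acts G x. log 2 (1 + Pt T x a)) \<le> (\<Sum>x\<in>infosets G. \<Sum>a\<in>acts G x. lam)"
    proof (intro sum_mono)
      fix x a assume x: "x \<in> infosets G" "a \<in> acts G x"
      show "log 2 (1 + Pt T x a) \<le> lam" using Pt_le[OF x] Pt_nonneg[of T x a] x by (intro log_le) auto
    qed
    also have "\<dots> = lam * A" by (simp add: A_def A_X_def sum_distrib_left mult.commute)
    finally have "\<gamma> * (\<Sum>x\<in>infosets G. \<Sum>a\<in>acts G x. log 2 (1 + Pt T x a)) \<le> \<gamma> * (lam * A)"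
      using \<gamma>_ge_1 by (intro mult_left_mono) auto
    also have "\<dots> = sqrt (2 * H) * S" by (simp add: \<gamma> S_def)
    also have "\<dots> \<le> 1.42 * H * S" using sqrt2H S0 by (intro mult_right_mono) auto
    finally show ?thesis by simp
  qed
  have inner_L: "inner_seq G \<mu> (Ltil G \<gamma> mu Xo Ao Ro T w) = (\<Sum>t=1..T. inner_seq G \<mu> (lt t))"
  proof -
    have "inner_seq G \<mu> (Ltil G \<gamma> mu Xo Ao Ro T w)
        = (\<Sum>x\<in>infosets G. \<Sum>a\<in>acts G x. \<Sum>t=1..T. seqp G \<mu> x a * lt t x a)"
      by (simp add: inner_seq_def Ltil_sum sum_distrib_left)
    also have "\<dots> = (\<Sum>x\<in>infosets G. \<Sum>t=1..T. \<Sum>a\<in>acts G x. seqp G \<mu> x a * lt t x a)"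
      by (intro sum.cong refl sum.swap)
    also have "\<dots> = (\<Sum>t=1..T. inner_seq G \<mu> (lt t))" unfolding inner_seq_def by (rule sum.swap)
    finally show ?thesis .
  qed
  have "(\<Sum>t=1..T. inner_seq G (mu t w) (loss P Rw (nu t)) - inner_seq G \<mu> (loss P Rw (nu t)))
      = (\<Sum>t=1..T. inner_seq G (mu t w) (loss P Rw (nu t)) - (\<Sum>h=1..horizon G. 1 - Ro t h w))
        + (\<Sum>t=1..T. (\<Sum>h=1..horizon G. 1 - Ro t h w) - inner_seq G (mu t w) (lt t))
        + ((\<Sum>t=1..T. inner_seq G (mu t w) (lt t)) - inner_seq G \<mu> (Ltil G \<gamma> mu Xo Ao Ro T w))
        + (\<Sum>t=1..T. inner_seq G \<mu> (lt t) - inner_seq G \<mu> (loss P Rw (nu t)))"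
    unfolding inner_L by (simp only: sum_subtractf)
  also have "\<dots> \<le> H * S + 1.42 * (H * S) + (0.55 * (H * S) + 2 * (H * S)) + 0.4 * (H * S)"
    using realized exploration_bias exploration estimated_regret[OF \<mu>] penalty stability bias
    by (fold S_def H_def) linarith
  also have "\<dots> \<le> 6 * (H * S)" using HS by simp
  finally show ?thesis by (simp add: S_def)
qed

end

section \<open>The high-probability regret bound\<close>

lemma borel_measurable_seqp:
  assumes "\<And>x a. (\<lambda>w. m w x a) \<in> borel_measurable N"
  shows "(\<lambda>w. seqp G (m w) x a) \<in> borel_measurable N"
proof -
  have "(\<lambda>w. seq_aux n G (m w) x a) \<in> borel_measurable N" for n
  proof (induction n arbitrary: x a)
    case (Suc n)
    show ?case
    proof (cases "parent G x")
      case None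
      then show ?thesis using assms by simp
    next
      case (Some yb)
      then show ?thesis using assms Suc by (cases yb) (simp add: borel_measurable_times)
    qed
  qed simp
  then show ?thesis by (simp add: seqp_def)
qed

theorem theorem5:
  fixes G :: "('x, 'a) efg"
    and P :: "'nu \<Rightarrow> 'x \<Rightarrow> real" and Rw :: "'nu \<Rightarrow> 'x \<Rightarrow> 'a \<Rightarrow> real"
    and M :: "'w measure" and F :: "nat \<Rightarrow> 'w measure"
    and Xo :: "nat \<Rightarrow> nat \<Rightarrow> 'w \<Rightarrow> 'x" and Ao :: "nat \<Rightarrow> nat \<Rightarrow> 'w \<Rightarrow> 'a"
    and Ro :: "nat \<Rightarrow> nat \<Rightarrow> 'w \<Rightarrow> real"
    and mu :: "nat \<Rightarrow> 'w \<Rightarrow> 'x \<Rightarrow> 'a \<Rightarrow> real" and nu :: "nat \<Rightarrow> 'w \<Rightarrow> 'nu"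
    and T :: nat and \<delta> \<iota>' lam \<eta> \<gamma> :: real
  assumes tree: "game_tree G"
    and opp: "valid_opponents G P Rw"
    and delta: "0 < \<delta>" "\<delta> < 1"
    and iota_def: "\<iota>' = ln (3 * real (A_X G) * real T / \<delta>)"
    and lambda_def: "lam = 1 + log 2 (1 + real T)"
    and eta_def: "\<eta> = 2 * sqrt (\<iota>' * real T / (lam * real (A_X G)))"
    and gamma_def: "\<gamma> = sqrt (2 * \<iota>' * real (horizon G) * real T / (lam * real (A_X G)))"
    \<comment> \<open>probability space and filtration\<close>
    and M: "prob_space M"
    and F_sub: "\<And>t. sigma_finite_subalgebra M (F t)"
    and F_mono: "\<And>s t. s \<le> t \<Longrightarrow> sets (F s) \<subseteq> sets (F t)"
    \<comment> \<open>observations of episode t are F_t-measurable and well-formed\<close>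
    and Xo_meas: "\<And>t h. Xo t h \<in> measurable (F t) (count_space UNIV)"
    and Ao_meas: "\<And>t h. Ao t h \<in> measurable (F t) (count_space UNIV)"
    and Ro_meas: "\<And>t h. Ro t h \<in> borel_measurable (F t)"
    and obs_wf: "\<And>t h w. t \<in> {1..T} \<Longrightarrow> h \<in> {1..horizon G} \<Longrightarrow> w \<in> space M \<Longrightarrow>
        Xo t h w \<in> infosets G \<and> level G (Xo t h w) = h \<and> Ao t h w \<in> acts G (Xo t h w)
        \<and> 0 \<le> Ro t h w \<and> Ro t h w \<le> 1
        \<and> (h < horizon G \<longrightarrow> parent G (Xo t (Suc h) w) = Some (Xo t h w, Ao t h w))"
    \<comment> \<open>mu^t and nu^t are F_{t-1}-measurable\<close>
    and mu_meas: "\<And>t x a. t \<in> {1..T} \<Longrightarrow> (\<lambda>w. mu t w x a) \<in> borel_measurable (F (t - 1))"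
    and nuP_meas: "\<And>t x. t \<in> {1..T} \<Longrightarrow> (\<lambda>w. P (nu t w) x) \<in> borel_measurable (F (t - 1))"
    and nuR_meas: "\<And>t x a. t \<in> {1..T} \<Longrightarrow> (\<lambda>w. Rw (nu t w) x a) \<in> borel_measurable (F (t - 1))"
    \<comment> \<open>the conditional law of the observations in episode t\<close>
    and cond_visit: "\<And>t x a. t \<in> {1..T} \<Longrightarrow> x \<in> infosets G \<Longrightarrow> a \<in> acts G x \<Longrightarrow>
        AE w in M. real_cond_exp M (F (t - 1))
            (\<lambda>w. if Xo t (level G x) w = x \<and> Ao t (level G x) w = a then 1 else 0) w
          = P (nu t w) x * seqp G (mu t w) x a"
    and cond_loss: "\<And>t x a. t \<in> {1..T} \<Longrightarrow> x \<in> infosets G \<Longrightarrow> a \<in> acts G x \<Longrightarrow>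
        AE w in M. real_cond_exp M (F (t - 1))
            (\<lambda>w. if Xo t (level G x) w = x \<and> Ao t (level G x) w = a
                 then 1 - Ro t (level G x) w else 0) w
          = seqp G (mu t w) x a * loss P Rw (nu t w) x a"
    \<comment> \<open>the max-player runs Adaptive-FTRL with base policy the uniform policy\<close>
    and ftrl: "\<And>t w. t \<in> {1..T} \<Longrightarrow> w \<in> space M \<Longrightarrow>
        ftrl_step G \<eta> (uniform_policy G)
          (Ptil G \<gamma> mu Xo Ao (t - 1) w) (Ltil G \<gamma> mu Xo Ao Ro (t - 1) w) (mu t w)"
  shows "\<exists>E\<in>sets M. measure M E \<ge> 1 - \<delta> \<and>
    (\<forall>w\<in>E. \<forall>\<mu>d\<in>policies G.
       (\<Sum>t=1..T. inner_seq G (mu t w) (loss P Rw (nu t w)) - inner_seq G \<mu>d (loss P Rw (nu t w)))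
         \<le> 6 * real (horizon G) * sqrt (\<iota>' * lam * real (A_X G) * real T))"
proof (cases "T = 0")
  case True
  interpret prob_space M by (rule M)
  show ?thesis using True delta by (intro bexI[of _ "space M"]) (auto simp: prob_space)
next
  case False
  then have T: "1 \<le> T" by simp
  interpret tr: efg_tree G by unfold_locales (rule tree)
  interpret filtered_prob_space M F
    using M F_sub F_mono by (simp add: filtered_prob_space_def filtered_prob_space_axioms_def)
  define A where "A = real (A_X G)"
  define H where "H = real (horizon G)"
  have A1: "1 \<le> A" using tr.A_X_pos[OF opp] by (simp add: A_def)
  have H1: "1 \<le> H" using tr.horizon_ge_1 by (simp add: H_def)
  have "log 2 2 \<le> log 2 (1 + real T)" using T by (intro log_mono) auto
  then have lam2: "2 \<le> lam" by (simp add: lambda_def)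
  have AT: "1 \<le> A * real T" using A1 T by (simp add: mult_ge1_I)
  have arg: "3 * (A * real T) \<le> 3 * A * real T / \<delta>"
  proof -
    have "3 * (A * real T) * \<delta> \<le> 3 * (A * real T) * 1" using delta AT by (intro mult_left_mono) auto
    then show ?thesis using delta by (simp add: pos_le_divide_eq)
  qed
  have iota1: "1 \<le> \<iota>'"
  proof -
    have "exp 1 \<le> 3 * A * real T / \<delta>" using exp_le arg AT by simp
    then show ?thesis using arg AT unfolding iota_def A_def[symmetric] by (subst ln_ge_iff) auto
  qed
  have lnA: "ln A \<le> \<iota>'"
  proof -
    have "A * 1 \<le> A * real T" using A1 T by (intro mult_left_mono) auto
    then have "A \<le> 3 * A * real T / \<delta>" using arg AT by simp
    then show ?thesis unfolding iota_def A_def[symmetric] using A1 by simp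
  qed
  have exp_iota: "exp (- \<iota>') = \<delta> / (3 * A * real T)"
    using arg AT delta unfolding iota_def A_def[symmetric] exp_minus by (subst exp_ln) auto
  define q where "q = sqrt (\<iota>' * real T / (lam * A))"
  have "0 < \<iota>' * real T / (lam * A)" using iota1 T lam2 A1 by simp
  then have q0: "0 < q" and q2: "q\<^sup>2 = \<iota>' * real T / (lam * A)" by (auto simp: q_def)
  have q2': "\<iota>' * real T = lam * A * q\<^sup>2" using q2 lam2 A1 by simp
  have \<eta>q: "\<eta> = 2 * q" by (simp add: eta_def q_def A_def)
  have \<gamma>q: "\<gamma> = sqrt (2 * H) * q"
    unfolding gamma_def q_def A_def[symmetric] H_def[symmetric] real_sqrt_mult[symmetric]
    by (simp add: mult_ac)
  have Sq: "sqrt (\<iota>' * lam * A * real T) = lam * A * q"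
  proof -
    have "\<iota>' * lam * A * real T = (lam * A * q)\<^sup>2"
      using q2' by (simp add: power2_eq_square mult_ac)
    then show ?thesis using q0 lam2 A1 by simp
  qed
  have pol: "mu t w \<in> policies G" if "t \<in> {1..T}" "w \<in> space M" for t w
    using ftrl[OF that] by (simp add: ftrl_step_def)
  show ?thesis
  proof (cases "36 * \<iota>' * lam * A \<le> real T")
    case False
    \<comment> \<open>T^2 \<le> 36 \<iota>' lam A T = (6 lam A q)^2; an episode costs at most
      H.\<close>
    have "real T \<le> 6 * (lam * A * q)"
    proof (rule power2_le_imp_le)
      have "(real T)\<^sup>2 \<le> real T * (36 * \<iota>' * lam * A)"
        using False by (simp add: power2_eq_square mult_left_mono)
      also have "\<dots> = 36 * (lam * A) * (\<iota>' * real T)" by simp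
      also have "\<dots> = (6 * (lam * A * q))\<^sup>2" unfolding q2' by (simp add: power2_eq_square)
      finally show "(real T)\<^sup>2 \<le> (6 * (lam * A * q))\<^sup>2" .
    qed (use q0 lam2 A1 in simp)
    then have "H * real T \<le> H * (6 * (lam * A * q))" using H1 by (intro mult_left_mono) auto
    then have HT: "H * real T \<le> 6 * H * (lam * A * q)" by (simp only: mult_ac)
    have "(\<Sum>t=1..T. inner_seq G (mu t w) (loss P Rw (nu t w)) - inner_seq G \<mu>d (loss P Rw (nu t w)))
        \<le> 6 * H * (lam * A * q)"
      if w: "w \<in> space M" "\<mu>d \<in> policies G" for w \<mu>d
    proof -
      have "(\<Sum>t=1..T. inner_seq G (mu t w) (loss P Rw (nu t w)) - inner_seq G \<mu>d (loss P Rw (nu t w))) \<le> (\<Sum>t=1..T. H)"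
      proof (intro sum_mono)
        fix t assume t: "t \<in> {1..T}"
        show "inner_seq G (mu t w) (loss P Rw (nu t w)) - inner_seq G \<mu>d (loss P Rw (nu t w)) \<le> H"
          using tr.inner_seq_loss_bounds(2)[OF opp pol[OF t w(1)], of "nu t w"]
            tr.inner_seq_loss_bounds(1)[OF opp w(2), of "nu t w"] by (simp add: H_def)
      qed
      then show ?thesis using HT by (simp add: mult.commute)
    qed
    then show ?thesis using delta
      unfolding A_def[symmetric] H_def[symmetric] Sq
      by (intro bexI[of _ "space M"]) (auto simp: prob_space)
  next
    case large: True
    have "6 * \<iota>' \<le> q"
    proof (rule power2_le_imp_le)
      have "lam * A * (6 * \<iota>')\<^sup>2 = \<iota>' * (36 * \<iota>' * lam * A)" by (simp add: power2_eq_square)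
      also have "\<dots> \<le> \<iota>' * real T" using large iota1 by (intro mult_left_mono) auto
      also have "\<dots> = lam * A * q\<^sup>2" by (rule q2')
      finally show "(6 * \<iota>')\<^sup>2 \<le> q\<^sup>2" using lam2 A1 by simp
    qed (use q0 in simp)
    moreover have "1 \<le> sqrt (2 * H)" using H1 by simp
    ultimately have "1 * 1 \<le> sqrt (2 * H) * q" using iota1 by (intro mult_mono) auto
    then have \<gamma>1: "1 \<le> \<gamma>" by (simp add: \<gamma>q)
    have run: "ftrl_run G mu Xo Ao Ro w T \<eta> \<gamma>" if w: "w \<in> space M" for w
      using tr.efg_tree_axioms \<gamma>1 q0 obs_wf[OF _ _ w] ftrl[OF _ w]
      by (simp add: ftrl_run_def ftrl_run_axioms_def \<eta>q)
    define m where "m x a t w = seqp G (mu t w) x a" for x a t w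
    define g where "g x a t w = \<gamma> / (1 + Ptil G \<gamma> mu Xo Ao (t - 1) w x a)" for x a t w
    define V where "V x a t w = (if Xo t (level G x) w = x \<and> Ao t (level G x) w = a then 1 else 0 :: real)" for x a t w
    define Y where "Y x a t w = (if Xo t (level G x) w = x \<and> Ao t (level G x) w = a then 1 - Ro t (level G x) w else 0)" for x a t w
    define l where "l x a t w = loss P Rw (nu t w) x a" for x a t w
    have up: "f \<in> borel_measurable (F t)" if "f \<in> borel_measurable (F s)" "s \<le> t" for f :: "'w \<Rightarrow> real" and s t
      using measurable_from_subalg[OF subalg_le that(1)] that(2) .
    have toM: "f \<in> borel_measurable M" if "f \<in> borel_measurable (F s)" for f :: "'w \<Rightarrow> real" and s
      using measurable_from_subalg[OF subalg that] .
    have m_meas: "m x a t \<in> borel_measurable (F (t - 1))" if "t \<in> {1..T}" for x a t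
      unfolding m_def using mu_meas[OF that] by (rule borel_measurable_seqp)
    have V_meas: "V x a t \<in> borel_measurable (F t)" and Y_meas: "Y x a t \<in> borel_measurable (F t)" for x a t
    proof -
      note [measurable] = Xo_meas[of t "level G x"] Ao_meas[of t "level G x"] Ro_meas[of t "level G x"]
      show "V x a t \<in> borel_measurable (F t)" "Y x a t \<in> borel_measurable (F t)"
        unfolding V_def Y_def by measurable
    qed
    have P_meas: "(\<lambda>w. Ptil G \<gamma> mu Xo Ao n w x a) \<in> borel_measurable (F n)" if "n \<le> T" for n x a
      using that
    proof (induction n)
      case (Suc n)
      have "Ptil G \<gamma> mu Xo Ao (Suc n) w x a = Ptil G \<gamma> mu Xo Ao n w x a
          + V x a (Suc n) w / (m x a (Suc n) w + \<gamma> / (1 + Ptil G \<gamma> mu Xo Ao n w x a))" for w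
        by (simp add: V_def m_def)
      moreover have "(\<lambda>w. Ptil G \<gamma> mu Xo Ao n w x a) \<in> borel_measurable (F (Suc n))"
        by (rule up[of _ n]) (use Suc in auto)
      moreover have "m x a (Suc n) \<in> borel_measurable (F (Suc n))"
        by (rule up[OF m_meas]) (use Suc in auto)
      ultimately show ?case using V_meas[of x a "Suc n"] by (simp add: borel_measurable_add borel_measurable_divide)
    qed simp
    \<comment> \<open>\<gamma>^t depends on P~^{t-1} only, so the weights 2 \<gamma>^t are
      predictable, as the tail bound requires.\<close>
    have g_meas: "g x a t \<in> borel_measurable (F (t - 1))" if "t \<in> {1..T}" for x a t
    proof -
      have "t - 1 \<le> T" using that by auto
      then show ?thesis unfolding g_def using P_meas by (intro borel_measurable_divide borel_measurable_add) auto
    qed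
    have l_meas: "l x a t \<in> borel_measurable (F (t - 1))" if "t \<in> {1..T}" for x a t
      unfolding l_def loss_def using nuP_meas[OF that] nuR_meas[OF that]
      by (intro borel_measurable_times borel_measurable_diff) auto
    have m_b: "0 \<le> m x a t w \<and> m x a t w \<le> 1" if "t \<in> {1..T}" "w \<in> space M" "x \<in> infosets G" "a \<in> acts G x" for x a t w
      using tr.seqp_bounds[OF pol[OF that(1,2)] that(3,4)] by (simp add: m_def)
    have g_b: "0 < g x a t w \<and> g x a t w \<le> \<gamma>" if "t \<in> {1..T}" "w \<in> space M" "x \<in> infosets G" "a \<in> acts G x" for x a t w
    proof -
      interpret r: ftrl_run G mu Xo Ao Ro w T \<eta> \<gamma> by (rule run[OF that(2)])
      have "t - 1 \<le> T" using that by auto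
      from r.Pt_nonneg[OF this that(3,4)] have "0 \<le> Ptil G \<gamma> mu Xo Ao (t - 1) w x a" by (simp add: r.Pt_def)
      then show ?thesis using \<gamma>1 by (simp add: g_def field_simps)
    qed
    have V_b: "0 \<le> V x a t w \<and> V x a t w \<le> 1" for x a t w by (simp add: V_def)
    have Y_b: "0 \<le> Y x a t w \<and> Y x a t w \<le> 1" if "t \<in> {1..T}" "w \<in> space M" "x \<in> infosets G" for x a t w
      using obs_wf[OF that(1) _ that(2), of "level G x"] tr.level_ge_1[OF that(3)] tr.level_le_horizon[OF that(3)]
      by (simp add: Y_def)
    have P_b: "0 \<le> P \<nu> x \<and> P \<nu> x \<le> 1" if "x \<in> infosets G" for \<nu> x
      using tr.reach_nonneg[OF opp that] tr.reach_le_1[OF opp that] by simp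
    have l_b: "0 \<le> l x a t w \<and> l x a t w \<le> 1" if "x \<in> infosets G" "a \<in> acts G x" for x a t w
      using tr.loss_bounds[OF opp that, of "nu t w"] P_b[OF that(1), of "nu t w"] by (simp add: l_def)
    have bddI: "bdd_borel (F t) f" if "f \<in> borel_measurable (F t)" "\<And>w. w \<in> space M \<Longrightarrow> 0 \<le> f w \<and> f w \<le> B" for t f and B :: real
      using that by (intro bdd_borelI[of _ _ B]) auto
    have m_bdd: "bdd_borel (F (t - 1)) (m x a t)" and g_bdd: "bdd_borel (F (t - 1)) (g x a t)"
      and P_bdd: "bdd_borel (F (t - 1)) (\<lambda>w. P (nu t w) x)" and l_bdd: "bdd_borel (F (t - 1)) (l x a t)"
      if "t \<in> {1..T}" "x \<in> infosets G" "a \<in> acts G x" for t x a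
      using bddI[OF m_meas[OF that(1)] m_b[OF that(1) _ that(2,3)]]
        bddI[OF g_meas[OF that(1)], of x a \<gamma>] g_b[OF that(1) _ that(2,3)]
        bddI[OF nuP_meas[OF that(1)] P_b[OF that(2)]] bddI[OF l_meas[OF that(1)] l_b[OF that(2,3)]]
      by (auto simp: less_imp_le)
    define bad1 where "bad1 i = (case i of ((x, a), s) \<Rightarrow> {w \<in> space M.
      \<iota>' \<le> (\<Sum>t=s..T. 2 * g x a t w * (V x a t w / (m x a t w + g x a t w) - P (nu t w) x))})" for i
    define bad2 where "bad2 i = (case i of ((x, a), s) \<Rightarrow> {w \<in> space M.
      \<iota>' \<le> (\<Sum>t=s..T. 2 * g x a t w * (Y x a t w / (m x a t w + g x a t w) - l x a t w))})" for i
    \<comment> \<open>The realized loss written over the tree rather than over the steps: its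
      conditional mean is then a finite sum of those given by \<open>cond_loss\<close>.\<close>
    define S where "S t w = (\<Sum>x\<in>infosets G. \<Sum>a\<in>acts G x. Y x a t w)" for t w
    define v where "v t w = inner_seq G (mu t w) (loss P Rw (nu t w))" for t w
    \<comment> \<open>Chosen so that \<theta> H^2 T / 2 = H (lam A q) / 2. The other term \<iota>' /
      \<theta> is then H q, at most the same amount because lam A \<ge> 2.\<close>
    define \<theta> where "\<theta> = lam * A * q / (real T * H)"
    define bad3 where "bad3 = {w \<in> space M. \<iota>' / \<theta> + \<theta> * H\<^sup>2 * real T / 2 \<le> (\<Sum>t=1..T. v t w - S t w)}"
    \<comment> \<open>All pairs (x, a) with all starting episodes s: A T events in each of two
      families, each event of probability at most exp (- \<iota>') = \<delta> / (3 A T).\<close>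
    define K where "K = Sigma (infosets G) (acts G) \<times> {1..T}"
    have finK: "finite K" using tr.finite_infosets tr.finite_acts by (auto simp: K_def)
    have cardK: "real (card K) = A * real T"
      using tr.finite_infosets tr.finite_acts by (simp add: K_def card_cartesian_product A_def A_X_def)
    have mM: "m x a t \<in> borel_measurable M" "g x a t \<in> borel_measurable M" "V x a t \<in> borel_measurable M"
      "Y x a t \<in> borel_measurable M" "l x a t \<in> borel_measurable M" "(\<lambda>w. P (nu t w) x) \<in> borel_measurable M"
      if "t \<in> {1..T}" for x a t
      using toM[OF m_meas[OF that]] toM[OF g_meas[OF that]] toM[OF V_meas] toM[OF Y_meas]
        toM[OF l_meas[OF that]] toM[OF nuP_meas[OF that]] by blast+
    have bad_sets: "bad1 i \<in> sets M" "bad2 i \<in> sets M" if iK: "i \<in> K" for i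
    proof -
      obtain x a s where i: "i = ((x, a), s)" "s \<in> {1..T}" using iK by (auto simp: K_def)
      have t: "t \<in> {1..T}" if "t \<in> {s..T}" for t using that i(2) by auto
      have "(\<lambda>w. \<Sum>t=s..T. 2 * g x a t w * (V x a t w / (m x a t w + g x a t w) - P (nu t w) x)) \<in> borel_measurable M"
        using mM[OF t]
        by (intro borel_measurable_sum borel_measurable_times borel_measurable_diff borel_measurable_divide borel_measurable_add) auto
      then show "bad1 i \<in> sets M" unfolding bad1_def i by simp
      have "(\<lambda>w. \<Sum>t=s..T. 2 * g x a t w * (Y x a t w / (m x a t w + g x a t w) - l x a t w)) \<in> borel_measurable M"
        using mM[OF t]
        by (intro borel_measurable_sum borel_measurable_times borel_measurable_diff borel_measurable_divide borel_measurable_add) auto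
      then show "bad2 i \<in> sets M" unfolding bad2_def i by simp
    qed
    have bad1_prob: "prob (bad1 i) \<le> exp (- \<iota>')" if iK: "i \<in> K" for i
    proof -
      obtain x a s where i: "i = ((x, a), s)" "s \<in> {1..T}" "x \<in> infosets G" "a \<in> acts G x" using iK by (auto simp: K_def)
      show ?thesis unfolding bad1_def i prod.case
      proof (rule implicit_exploration_tail_bound)
        fix t assume t: "t \<in> {1..T}"
        show "AE w in M. real_cond_exp M (F (t - 1)) (V x a t) w = m x a t w * P (nu t w) x"
          using cond_visit[OF t i(3,4)] unfolding V_def m_def by (simp add: mult.commute)
      qed (use i m_bdd g_bdd P_bdd m_b g_b P_b V_b V_meas in auto)
    qed
    have bad2_prob: "prob (bad2 i) \<le> exp (- \<iota>')" if iK: "i \<in> K" for i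
    proof -
      obtain x a s where i: "i = ((x, a), s)" "s \<in> {1..T}" "x \<in> infosets G" "a \<in> acts G x" using iK by (auto simp: K_def)
      show ?thesis unfolding bad2_def i prod.case
      proof (rule implicit_exploration_tail_bound)
        fix t assume t: "t \<in> {1..T}"
        show "AE w in M. real_cond_exp M (F (t - 1)) (Y x a t) w = m x a t w * l x a t w"
          using cond_loss[OF t i(3,4)] unfolding Y_def m_def l_def by simp
      qed (use i m_bdd g_bdd l_bdd m_b g_b l_b Y_b Y_meas in auto)
    qed
    have S_eq: "S t w = (\<Sum>h=1..horizon G. 1 - Ro t h w)" if "t \<in> {1..T}" "w \<in> space M" for t w
    proof -
      interpret r: ftrl_run G mu Xo Ao Ro w T \<eta> \<gamma> by (rule run[OF that(2)])
      have "S t w = (\<Sum>h=1..horizon G. 1 - Ro t (level G (Xo t h w)) w)"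
        unfolding S_def Y_def r.vis_def[symmetric] by (rule r.sum_path_obs[OF that(1)])
      also have "\<dots> = (\<Sum>h=1..horizon G. 1 - Ro t h w)" using obs_wf[OF that(1) _ that(2)] by (intro sum.cong) auto
      finally show ?thesis .
    qed
    have S_b: "0 \<le> S t w \<and> S t w \<le> H" if "t \<in> {1..T}" "w \<in> space M" for t w
    proof -
      have "(\<Sum>h=1..horizon G. 1 - Ro t h w) \<le> (\<Sum>h=1..horizon G. 1)"
        using obs_wf[OF that(1) _ that(2)] by (intro sum_mono) auto
      moreover have "0 \<le> (\<Sum>h=1..horizon G. 1 - Ro t h w)"
        using obs_wf[OF that(1) _ that(2)] by (intro sum_nonneg) auto
      ultimately show ?thesis unfolding S_eq[OF that] by (simp add: H_def)
    qed
    have v_b: "0 \<le> v t w \<and> v t w \<le> H" if "t \<in> {1..T}" "w \<in> space M" for t w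
      using tr.inner_seq_loss_bounds[OF opp pol[OF that]] by (simp add: v_def H_def)
    have v_eq: "v t = (\<lambda>w. \<Sum>x\<in>infosets G. \<Sum>a\<in>acts G x. m x a t w * l x a t w)" for t
      by (simp add: v_def[abs_def] inner_seq_def m_def l_def)
    have S_meas: "S t \<in> borel_measurable (F t)" for t
      unfolding S_def[abs_def] using Y_meas by (intro borel_measurable_sum) auto
    have v_meas: "v t \<in> borel_measurable (F (t - 1))" if "t \<in> {1..T}" for t
      unfolding v_eq using m_meas[OF that] l_meas[OF that] by (intro borel_measurable_sum borel_measurable_times) auto
    have \<theta>0: "0 < \<theta>" using lam2 A1 q0 T H1 by (simp add: \<theta>_def)
    have bad3_prob: "prob bad3 \<le> exp (- \<iota>')"
      unfolding bad3_def
    proof (rule azuma_tail_bound)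
      fix t assume t: "t \<in> {1..T}"
      have Ybdd: "bdd_borel M (Y x a t)" if "x \<in> infosets G" for x a
        using bdd_borel_F_M[OF bddI[OF Y_meas Y_b[OF t _ that]]] .
      have "cond_mean (t - 1) (Y x a t) (\<lambda>w. m x a t w * l x a t w)" if "x \<in> infosets G" "a \<in> acts G x" for x a
      proof (rule cond_meanI[OF Ybdd[OF that(1)] bdd_borel_mult[OF m_bdd[OF t that] l_bdd[OF t that]]])
        show "AE w in M. real_cond_exp M (F (t - 1)) (Y x a t) w = m x a t w * l x a t w"
          using cond_loss[OF t that] unfolding Y_def m_def l_def by simp
      qed
      then show "cond_mean (t - 1) (S t) (v t)"
        unfolding S_def[abs_def] v_eq using Ybdd m_bdd[OF t] l_bdd[OF t]
        by (intro cond_mean_sum bdd_borel_sum bdd_borel_mult) auto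
    qed (use v_meas v_b S_meas S_b \<theta>0 in auto)
    have bad3_sets: "bad3 \<in> sets M"
    proof -
      have "(\<lambda>w. \<Sum>t=1..T. v t w - S t w) \<in> borel_measurable M"
        using toM[OF v_meas] toM[OF S_meas] by (intro borel_measurable_sum borel_measurable_diff) auto
      then show ?thesis unfolding bad3_def by simp
    qed
    define Bad where "Bad = (\<Union>i\<in>K. bad1 i) \<union> (\<Union>i\<in>K. bad2 i) \<union> bad3"
    have UN_sets: "(\<Union>i\<in>K. bad1 i) \<in> sets M" "(\<Union>i\<in>K. bad2 i) \<in> sets M"
      using finK bad_sets by (auto intro!: sets.finite_UN simp del: split_paired_All)
    have Bad_sets: "Bad \<in> sets M" unfolding Bad_def using UN_sets bad3_sets by (intro sets.Un)
    have union: "prob (\<Union>i\<in>K. B i) \<le> \<delta> / 3"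
      if "\<And>i. i \<in> K \<Longrightarrow> B i \<in> sets M" "\<And>i. i \<in> K \<Longrightarrow> prob (B i) \<le> exp (- \<iota>')" for B
    proof -
      have "prob (\<Union>i\<in>K. B i) \<le> (\<Sum>i\<in>K. prob (B i))"
        using finK that(1) by (intro finite_measure_subadditive_finite) auto
      also have "\<dots> \<le> real (card K) * exp (- \<iota>')" using that(2) by (rule sum_bounded_above)
      also have "\<dots> = \<delta> / 3" unfolding cardK exp_iota using A1 T by simp
      finally show ?thesis .
    qed
    have "prob Bad \<le> prob (\<Union>i\<in>K. bad1 i) + prob (\<Union>i\<in>K. bad2 i) + prob bad3"
      unfolding Bad_def using UN_sets bad3_sets
      by (intro order_trans[OF measure_Un_le] add_right_mono measure_Un_le) auto
    also have "\<dots> \<le> \<delta> / 3 + \<delta> / 3 + \<delta> / 3"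
    proof (intro add_mono union bad_sets bad1_prob bad2_prob)
      have "exp (- \<iota>') \<le> \<delta> / 3"
        unfolding exp_iota using AT delta by (intro divide_left_mono) auto
      then show "prob bad3 \<le> \<delta> / 3" using bad3_prob by simp
    qed
    finally have "1 - \<delta> \<le> prob (space M - Bad)" using Bad_sets by (simp add: prob_compl)
    moreover have "(\<Sum>t=1..T. inner_seq G (mu t w) (loss P Rw (nu t w)) - inner_seq G \<mu>d (loss P Rw (nu t w)))
        \<le> 6 * H * (lam * A * q)" if w: "w \<in> space M - Bad" and \<mu>d: "\<mu>d \<in> policies G" for w \<mu>d
    proof -
      have wM: "w \<in> space M" using w by simp
      interpret r: ftrl_run G mu Xo Ao Ro w T \<eta> \<gamma> by (rule run[OF wM])
      have gt: "r.gt t x a = g x a t w" and mt: "r.mt t x a = m x a t w" for t x a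
        by (simp_all add: r.gt_def g_def r.Pt_def r.mt_def m_def)
      have pt: "r.pt t x a = V x a t w / (m x a t w + g x a t w)"
        and lt: "r.lt t x a = Y x a t w / (m x a t w + g x a t w)" for t x a
        by (simp_all add: r.pt_def r.lt_def gt mt V_def Y_def r.vis_def)
      show ?thesis
        unfolding A_def H_def
      proof (rule r.regret_bound[OF opp T iota1 _ lambda_def q0 _ \<eta>q])
        show "ln (real (A_X G)) \<le> \<iota>'" using lnA by (simp add: A_def)
        show "\<iota>' * real T = lam * real (A_X G) * q\<^sup>2" using q2' by (simp add: A_def)
        show "\<gamma> = sqrt (2 * real (horizon G)) * q" using \<gamma>q by (simp add: H_def)
        show "36 * \<iota>' * lam * real (A_X G) \<le> real T" using large by (simp add: A_def)
        show "\<mu>d \<in> policies G" by (rule \<mu>d)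
        fix s x a assume "s \<in> {1..T}" "x \<in> infosets G" "a \<in> acts G x"
        then have "((x, a), s) \<in> K" by (simp add: K_def)
        then have "w \<notin> bad1 ((x, a), s)" "w \<notin> bad2 ((x, a), s)" using w by (auto simp: Bad_def)
        then show "(\<Sum>t=s..T. 2 * r.gt t x a * (r.pt t x a - P (nu t w) x)) \<le> \<iota>'"
          "(\<Sum>t=s..T. 2 * r.gt t x a * (r.lt t x a - loss P Rw (nu t w) x a)) \<le> \<iota>'"
          unfolding gt pt lt using wM by (auto simp: bad1_def bad2_def l_def)
      next
        have "\<iota>' / \<theta> + \<theta> * H\<^sup>2 * real T / 2 = H * q + H * (lam * A * q) / 2"
        proof -
          have "\<iota>' / \<theta> = (\<iota>' * real T) * H / (lam * A * q)" by (simp add: \<theta>_def)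
          also have "\<dots> = H * q" unfolding q2' using lam2 A1 q0 by (simp add: power2_eq_square)
          finally have "\<iota>' / \<theta> = H * q" .
          moreover have "\<theta> * H\<^sup>2 * real T / 2 = H * (lam * A * q) / 2"
            using T H1 by (simp add: \<theta>_def power2_eq_square)
          ultimately show ?thesis by simp
        qed
        also have "\<dots> \<le> H * (lam * A * q)"
        proof -
          have "2 * 1 \<le> lam * A" using lam2 A1 by (intro mult_mono) auto
          then have "H * (2 * q) \<le> H * (lam * A * q)" using H1 q0 by (intro mult_left_mono mult_right_mono) auto
          then show ?thesis by simp
        qed
        finally have "(\<Sum>t=1..T. v t w - S t w) \<le> H * (lam * A * q)"
          using w wM by (auto simp: Bad_def bad3_def)
        moreover have "(\<Sum>t=1..T. v t w - S t w) = (\<Sum>t=1..T. v t w - (\<Sum>h=1..horizon G. 1 - Ro t h w))"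
          using S_eq[OF _ wM] by (intro sum.cong) auto
        ultimately show "(\<Sum>t=1..T. inner_seq G (mu t w) (loss P Rw (nu t w)) - (\<Sum>h=1..horizon G. 1 - Ro t h w))
            \<le> real (horizon G) * (lam * real (A_X G) * q)" by (simp add: v_def A_def H_def)
      qed
    qed
    ultimately show ?thesis using Bad_sets
      unfolding A_def[symmetric] H_def[symmetric] Sq
      by (intro bexI[of _ "space M - Bad"]) auto
  qed
qed

end
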